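(* Let $n\ge2$. For $1\le j\le n$ let $\Phi_j:\mathbb{R}^n\times\mathbb{R}^{n-1}\to\mathbb{R}$ be smooth, let $\psi_j:\mathbb{R}^n\times\mathbb{R}^{n-1}\to\mathbb{C}$ be smooth and compactly supported, and for $\lambda\geq 1$ let $$T_{j,\lambda}f(x)=\int_{\mathbb{R}^{n-1}}e^{i\lambda\Phi_j(x,\xi)}\psi_j(x,\xi)f(\xi)\,d\xi,\qquad x\in\mathbb{R}^n .$$ Assume that there is a constant $c>0$ such that $$\det\bigl(X(\Phi_1)(x_1,\xi_1),\dots,X(\Phi_n)(x_n,\xi_n)\bigr)\ge c$$ for all $(x_1,\xi_1)\in\operatorname{supp}(\psi_1),\dots,(x_n,\xi_n)\in\operatorname{supp}(\psi_n)$. Then there is a constant $C<\infty$, independent of $\lambda$ and of $f_1,\dots,f_n$, such that for all $\lambda\ge1$ and all $f_1,\dots,f_n\in L^2(\mathbb{R}^{n-1})$, $$\int_{x_1+\cdots+x_n=0}|T_{1,\lambda}f_1(x_1)|^2\cdots|T_{n,\lambda}f_n(x_n)|^2\,dx\le C\,\lambda^{-n(n-1)}\|f_1\|_{L^2(\mathbb{R}^{n-1})}^2\cdots\|f_n\|_{L^2(\mathbb{R}^{n-1})}^2 .$$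
   Context: For a smooth $\Phi:\mathbb{R}^n\times\mathbb{R}^{n-1}\to\mathbb{R}$, $X(\Phi)=\bigwedge_{\ell=1}^{n-1}\frac{\partial}{\partial\xi_\ell}\nabla_x\Phi$, interpreted by Hodge duality as an $\mathbb{R}^n$-valued function on $\mathbb{R}^n\times\mathbb{R}^{n-1}$; that is, $X(\Phi)(x,\xi)$ is the vector in $\mathbb{R}^n$ determined by $\langle X(\Phi)(x,\xi),v\rangle=\det\bigl(\partial_{\xi_1}\nabla_x\Phi(x,\xi),\dots,\partial_{\xi_{n-1}}\nabla_x\Phi(x,\xi),v\bigr)$ for all $v\in\mathbb{R}^n$. The integral over $x_1+\cdots+x_n=0$ is with respect to $dx_1\cdots dx_{n-1}$ on $(\mathbb{R}^n)^{n-1}$, with $x_n=-x_1-\cdots-x_{n-1}$. *)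

theory Defs
  imports "HOL-Analysis.Analysis"
begin

text \<open>
  Conventions. With \<open>n - 1 = CARD('m)\<close>, the space \<open>real ^ 'm\<close> is the space of
  the frequency variable, and \<open>real ^ 'm option\<close>, of dimension
  \<open>CARD('m option) = CARD('m) + 1 = n\<close>, is the space of the position variable. As \<open>'m\<close> is an
  arbitrary finite (nonempty) type, this covers exactly the dimensions \<open>n \<ge> 2\<close>.
  The index \<open>None\<close> plays the role of the last index \<open>n\<close>, and \<open>Some l\<close> those of the indices
  below \<open>n\<close>, both for coordinates and for the family of operators. Rows and columns of the
  determinants below are indexed by the same finite type, so no choice of a linear ordering
  of that type enters.
\<close>

primrec C_k :: "nat \<Rightarrow> ('a::real_normed_vector \<Rightarrow> 'b::real_normed_vector) \<Rightarrow> bool" where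
  "C_k 0 f \<longleftrightarrow> continuous_on UNIV f"
| "C_k (Suc k) f \<longleftrightarrow> (\<forall>x. f differentiable (at x)) \<and>
     (\<forall>v. C_k k (\<lambda>x. frechet_derivative f (at x) v))"

definition smooth :: "('a::euclidean_space \<Rightarrow> 'b::real_normed_vector) \<Rightarrow> bool" where
  "smooth f \<longleftrightarrow> (\<forall>k. C_k k f)"

definition supp :: "('a::topological_space \<Rightarrow> 'b::zero) \<Rightarrow> 'a set" where
  "supp f = closure {x. f x \<noteq> 0}"

definition grad :: "('a::real_inner \<Rightarrow> real) \<Rightarrow> 'a \<Rightarrow> 'a" where
  "grad f x = (THE D. GDERIV f x :> D)"

definition partial_deriv :: "'m::finite \<Rightarrow> (real ^ 'm \<Rightarrow> 'b::real_normed_vector) \<Rightarrow> real ^ 'm \<Rightarrow> 'b" where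
  "partial_deriv l g \<xi> = vector_derivative (\<lambda>t. g (\<xi> + t *\<^sub>R axis l 1)) (at 0)"

definition det_cols :: "('n::finite \<Rightarrow> real ^ 'n) \<Rightarrow> real" where
  "det_cols c = det (\<chi> i k. c k $ i)"

definition mixed_deriv ::
    "((real ^ 'm option) \<times> (real ^ 'm::finite) \<Rightarrow> real) \<Rightarrow> 'm \<Rightarrow>
     (real ^ 'm option) \<times> (real ^ 'm) \<Rightarrow> real ^ 'm option" where
  "mixed_deriv \<Phi> l = (\<lambda>(x, \<xi>). partial_deriv l (\<lambda>\<eta>. grad (\<lambda>y. \<Phi> (y, \<eta>)) x) \<xi>)"

definition X_field ::
    "((real ^ 'm option) \<times> (real ^ 'm::finite) \<Rightarrow> real) \<Rightarrow>
     (real ^ 'm option) \<times> (real ^ 'm) \<Rightarrow> real ^ 'm option" where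
  "X_field \<Phi> p = (THE w. \<forall>v. w \<bullet> v = det_cols (case_option v (\<lambda>l. mixed_deriv \<Phi> l p)))"

text \<open>The description in \<open>X_field\<close> is proper: the vector exists and is unique.\<close>

lemma X_field_inner:
  "X_field \<Phi> p \<bullet> v = det_cols (case_option v (\<lambda>l. mixed_deriv \<Phi> l p))"
proof -
  define F where "F v = det_cols (case_option v (\<lambda>l. mixed_deriv \<Phi> l p))" for v
  have F: "F v = det (\<chi> k. if k = None then v else mixed_deriv \<Phi> (the k) p)" for v
  proof -
    have "(\<chi> i k. case_option v (\<lambda>l. mixed_deriv \<Phi> l p) k $ i) =
        transpose (\<chi> k. if k = None then v else mixed_deriv \<Phi> (the k) p)"
      by (auto simp: vec_eq_iff transpose_def split: option.splits)
    then show ?thesis by (simp add: F_def det_cols_def)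
  qed
  have "linear F"
  proof (rule linearI)
    show "F (a + b) = F a + F b" for a b
      unfolding F by (rule det_row_add)
    show "F (r *\<^sub>R a) = r *\<^sub>R F a" for r a
      using det_row_mul[of None r "\<lambda>_. a" "\<lambda>k. mixed_deriv \<Phi> (the k) p"]
      by (simp only: F scalar_mult_eq_scaleR real_scaleR_def)
  qed
  then have ex: "adjoint F 1 \<bullet> v = F v" for v
    using adjoint_works[of F v 1] by (simp add: inner_commute)
  have "(THE w. \<forall>v. w \<bullet> v = F v) = adjoint F 1"
  proof (rule the_equality)
    show "w = adjoint F 1" if "\<forall>v. w \<bullet> v = F v" for w
    proof -
      have "\<forall>v. v \<bullet> w = v \<bullet> adjoint F 1"
        using that ex by (simp add: inner_commute)
      then show ?thesis by (simp only: vector_eq_ldot)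
    qed
  qed (simp add: ex)
  then have "(THE w. \<forall>v. w \<bullet> v = F v) \<bullet> v = F v"
    by (simp add: ex)
  then show ?thesis by (simp add: X_field_def F_def)
qed

definition L2 :: "('a::euclidean_space \<Rightarrow> complex) set" where
  "L2 = {f. f \<in> borel_measurable lebesgue \<and> integrable lebesgue (\<lambda>\<xi>. (cmod (f \<xi>))\<^sup>2)}"

definition L2_norm :: "('a::euclidean_space \<Rightarrow> complex) \<Rightarrow> real" where
  "L2_norm f = sqrt (LINT \<xi>|lebesgue. (cmod (f \<xi>))\<^sup>2)"

definition T_op ::
    "('a \<times> 'b::euclidean_space \<Rightarrow> real) \<Rightarrow> ('a \<times> 'b \<Rightarrow> complex) \<Rightarrow> real \<Rightarrow>
     ('b \<Rightarrow> complex) \<Rightarrow> 'a \<Rightarrow> complex" where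
  "T_op \<Phi> \<psi> lam f x =
     (LINT \<xi>|lebesgue. exp (\<i> * of_real (lam * \<Phi> (x, \<xi>))) * \<psi> (x, \<xi>) * f \<xi>)"

text \<open>Completes \<open>n - 1\<close> vectors to an \<open>n\<close>-tuple with sum zero.\<close>

definition zero_sum_tuple :: "'a::ab_group_add ^ 'm::finite \<Rightarrow> 'm option \<Rightarrow> 'a" where
  "zero_sum_tuple y = case_option (- (\<Sum>k\<in>UNIV. y $ k)) (\<lambda>k. y $ k)"

end

theory Submission
  imports Defs
begin

text \<open>
  The product of the functions \<open>T_op (\<Phi> j) (\<psi> j) lam (f j)\<close>, restricted to tuples with sum zero, is a
  single oscillatory integral operator applied to the tensor product of the \<open>f j\<close>; its phase
  \<open>\<Psi>\<close> is the sum of the \<open>\<Phi> j\<close> and both of its variables have dimension \<open>n * (n - 1)\<close>. The determinant hypothesis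
  makes the mixed Hessian of \<open>\<Psi>\<close> nondegenerate: a vector \<open>d\<close> in its kernel gives
  vectors \<open>V j\<close>, combinations of the \<open>\<partial>\<^sub>\<xi> \<nabla>\<^sub>x (\<Phi> j)\<close>, that are orthogonal to all zero-sum tuples, hence all equal,
  hence orthogonal to every \<open>X_field (\<Phi> j)\<close>, hence zero. So the theorem is an instance of
  Hoermander's \<open>L\<^sup>2\<close> estimate for nondegenerate phases. That estimate follows from Schur's test for \<open>T\<^sup>* T\<close>,
  localized by a bump weight in \<open>y\<close> and a sharp cutoff in \<open>\<xi>\<close>: integrating by parts
  \<open>2 * n * (n - 1)\<close> times in one fixed coordinate direction bounds the kernel by a negative power of \<open>lam * norm (\<xi> - \<eta>)\<close>.
\<close>

section \<open>Directional derivatives of smooth functions\<close>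

text \<open>The obstacle is uniformity. The coordinate direction in which the derivative of
  \<open>\<Psi> (y, \<xi>) - \<Psi> (y, \<eta>)\<close> is at least a multiple of
  \<open>norm (\<xi> - \<eta>)\<close> depends on \<open>\<xi>\<close> and \<open>\<eta>\<close>,
  and the bound persists only for \<open>y\<close> near a point of the support. This forces a
  localization at a scale independent of \<open>lam\<close>; finite covers undo it at the cost of a
  constant. The cutoff in \<open>y\<close> is differentiated in the integrations by parts, the one
  in \<open>\<xi>\<close> is not, so the latter may be an indicator function. Divided by
  \<open>norm (\<xi> - \<eta>)\<close>, the derivative of the phase difference is bounded away from
  zero and has bounded derivatives, with constants that do not depend on \<open>\<xi>\<close>,
  \<open>\<eta>\<close> or \<open>lam\<close>. With \<open>N = n * (n - 1)\<close>, the
  \<open>2 * N\<close> integrations give the decay \<open>(lam * norm (\<xi> - \<eta>))\<close> to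
  the power \<open>- 2 * N\<close>. Together with the trivial bound this is dominated by a product
  over the \<open>N\<close> coordinates of \<open>1 / (1 + (lam * t)^2)\<close>, with integral at
  most \<open>(pi / lam) ^ N\<close>: the source of the power of \<open>lam\<close>.\<close>

definition dd :: "'a::real_normed_vector \<Rightarrow> ('a \<Rightarrow> 'b::real_normed_vector) \<Rightarrow> 'a \<Rightarrow> 'b" where
  "dd v f x = frechet_derivative f (at x) v"

lemma dd_eqI: "(f has_derivative f') (at x) \<Longrightarrow> dd v f x = f' v"
  unfolding dd_def by (metis frechet_derivative_at)

text \<open>Restates the recursion through \<open>dd\<close>: with the direction as first argument,
  \<open>dd v\<close> is an operator on functions, which can be iterated by
  \<open>^^\<close>.\<close>

lemma C_k_Suc_iff:
  "C_k (Suc k) f \<longleftrightarrow> (\<forall>x. f differentiable (at x)) \<and> (\<forall>v. C_k k (dd v f))"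
  by (simp add: dd_def [abs_def])

lemma C_k_antimono: "C_k (Suc k) f \<Longrightarrow> C_k k f"
proof (induction k arbitrary: f)
  case 0
  then show ?case
    by (simp add: C_k_Suc_iff continuous_on_eq_continuous_within differentiable_imp_continuous_within)
next
  case (Suc k)
  then show ?case by (metis C_k_Suc_iff)
qed

lemma smooth_imp_C_k: "smooth f \<Longrightarrow> C_k k f"
  by (simp add: smooth_def)

lemma smooth_dd: "smooth f \<Longrightarrow> smooth (dd v f)"
  by (meson C_k_Suc_iff smooth_def)

lemma smooth_funpow_dd: "smooth f \<Longrightarrow> smooth ((dd v ^^ k) f)"
  by (induction k) (auto intro: smooth_dd)

lemma smooth_continuous_on: "smooth f \<Longrightarrow> continuous_on S f"
  using smooth_imp_C_k[of f 0] by (auto intro: continuous_on_subset)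

lemma smooth_has_derivative: "smooth f \<Longrightarrow> (f has_derivative (\<lambda>v. dd v f x)) (at x)"
  using smooth_imp_C_k[of f 1] by (simp add: dd_def frechet_derivative_works)

lemma smooth_dd_linear: "smooth f \<Longrightarrow> linear (\<lambda>v. dd v f x)"
  using smooth_has_derivative[of f x] by (simp add: has_derivative_linear)

text \<open>Turns Frechet derivatives into derivatives of one-variable functions along a line, the
  form in which \<open>bounded_dd\<close> and the integration by parts are phrased.\<close>

lemma smooth_line_derivative:
  assumes "smooth f"
  shows "((\<lambda>t. f (p + t *\<^sub>R v)) has_vector_derivative dd v f (p + t *\<^sub>R v)) (at t)"
proof -
  have "((\<lambda>t. f (p + t *\<^sub>R v)) has_derivative (\<lambda>s. dd (s *\<^sub>R v) f (p + t *\<^sub>R v))) (at t)"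
    by (rule has_derivative_compose[OF _ smooth_has_derivative[OF assms]])
       (auto intro!: derivative_eq_intros)
  then show ?thesis
    by (simp add: has_vector_derivative_def linear_cmul[OF smooth_dd_linear[OF assms]])
qed

section \<open>Closure properties of smooth functions\<close>

lemma C_k_const: "C_k k (\<lambda>x. c)"
proof (induction k arbitrary: c)
  case (Suc k)
  have "dd v (\<lambda>x. c) = (\<lambda>x. 0)" for v :: 'a
    by (rule ext, rule dd_eqI) (rule has_derivative_const)
  with Suc show ?case by (simp add: C_k_Suc_iff del: C_k.simps)
qed simp

lemma C_k_add: "C_k k f \<Longrightarrow> C_k k g \<Longrightarrow> C_k k (\<lambda>x. f x + g x)"
proof (induction k arbitrary: f g)
  case (Suc k)
  have "dd v (\<lambda>x. f x + g x) = (\<lambda>x. dd v f x + dd v g x)" for v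
    using Suc.prems unfolding C_k_Suc_iff
    by (intro ext dd_eqI has_derivative_add) (auto simp: dd_def frechet_derivative_works)
  with Suc show ?case by (simp add: C_k_Suc_iff del: C_k.simps)
qed (simp add: continuous_on_add)

lemma C_k_mult:
  fixes f g :: "'a::real_normed_vector \<Rightarrow> 'b::real_normed_algebra"
  shows "C_k k f \<Longrightarrow> C_k k g \<Longrightarrow> C_k k (\<lambda>x. f x * g x)"
proof (induction k arbitrary: f g)
  case (Suc k)
  have "dd v (\<lambda>x. f x * g x) = (\<lambda>x. f x * dd v g x + dd v f x * g x)" for v
    using Suc.prems unfolding C_k_Suc_iff
    by (intro ext dd_eqI has_derivative_mult) (auto simp: dd_def frechet_derivative_works)
  with Suc Suc.prems[THEN C_k_antimono] show ?case
    by (auto simp: C_k_Suc_iff simp del: C_k.simps intro!: C_k_add)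
qed (simp add: continuous_on_mult)

lemma C_k_compose_linear:
  assumes L: "bounded_linear L"
  shows "C_k k f \<Longrightarrow> C_k k (\<lambda>x. f (L x))"
proof (induction k arbitrary: f)
  case 0
  then show ?case
    using linear_continuous_on[OF L] by (auto intro: continuous_on_compose2)
next
  case (Suc k)
  have D: "((\<lambda>x. f (L x)) has_derivative (\<lambda>v. dd (L v) f (L x))) (at x)" for x
    using Suc.prems unfolding C_k_Suc_iff
    by (intro has_derivative_compose[OF bounded_linear_imp_has_derivative[OF L]])
       (auto simp: dd_def frechet_derivative_works)
  have "dd v (\<lambda>x. f (L x)) = (\<lambda>x. dd (L v) f (L x))" for v
    by (intro ext dd_eqI D)
  with Suc D show ?case
    by (auto simp: C_k_Suc_iff differentiable_def simp del: C_k.simps)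
qed

lemma dd_compose_linear:
  assumes "bounded_linear L" "smooth f"
  shows "dd v (\<lambda>x. f (L x)) = (\<lambda>x. dd (L v) f (L x))"
  by (intro ext dd_eqI has_derivative_compose[OF bounded_linear_imp_has_derivative[OF assms(1)]]
        smooth_has_derivative assms(2))

lemma smooth_sum:
  "(\<And>i. i \<in> I \<Longrightarrow> smooth (f i)) \<Longrightarrow> smooth (\<lambda>x. \<Sum>i\<in>I. f i x)"
  by (induction I rule: infinite_finite_induct) (auto simp: smooth_def C_k_const intro!: C_k_add)

lemma dd_sum:
  "(\<And>i. i \<in> I \<Longrightarrow> smooth (f i)) \<Longrightarrow> dd v (\<lambda>x. \<Sum>i\<in>I. f i x) = (\<lambda>x. \<Sum>i\<in>I. dd v (f i) x)"
  by (intro ext dd_eqI has_derivative_sum) (auto intro: smooth_has_derivative)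

lemma smooth_prod:
  fixes f :: "'i \<Rightarrow> 'a::euclidean_space \<Rightarrow> 'b::real_normed_field"
  shows "(\<And>i. i \<in> I \<Longrightarrow> smooth (f i)) \<Longrightarrow> smooth (\<lambda>x. \<Prod>i\<in>I. f i x)"
  by (induction I rule: infinite_finite_induct) (auto simp: smooth_def C_k_const intro!: C_k_mult)

lemma smooth_compose_linear:
  "bounded_linear L \<Longrightarrow> smooth f \<Longrightarrow> smooth (\<lambda>x. f (L x))"
  by (simp add: smooth_def C_k_compose_linear)

lemma smooth_mvt:
  fixes f :: "'a::euclidean_space \<Rightarrow> real"
  assumes "smooth f"
  shows "\<exists>t\<in>{0<..<1}. f (p + v) - f p = dd v f (p + t *\<^sub>R v)"
proof -
  have "\<exists>t\<in>{0<..<1}. f (p + 1 *\<^sub>R v) - f (p + 0 *\<^sub>R v) = (1 - 0) * dd v f (p + t *\<^sub>R v)"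
    using smooth_line_derivative[OF assms, of p v]
    by (intro mvt_simple[of 0 1 "\<lambda>t. f (p + t *\<^sub>R v)" "\<lambda>t s. s * dd v f (p + t *\<^sub>R v)"])
       (auto simp: has_vector_derivative_def intro: has_derivative_at_withinI)
  then show ?thesis by simp
qed

section \<open>Uniform bounds on iterated derivatives in one direction\<close>

text \<open>A quantitative form of having \<open>k\<close> bounded derivatives in direction
  \<open>e\<close>: one constant serves for all orders, and the derivatives are asked for at points
  of \<open>S\<close> only, without continuity. This accommodates cutoffs of finite smoothness as
  well as reciprocals that make sense only on \<open>S\<close>.\<close>

primrec bounded_dd :: "'a::real_normed_vector \<Rightarrow> 'a set \<Rightarrow> nat \<Rightarrow> real \<Rightarrow> ('a \<Rightarrow> complex) \<Rightarrow> bool" where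
  "bounded_dd e S 0 C f \<longleftrightarrow> (\<forall>y\<in>S. cmod (f y) \<le> C)"
| "bounded_dd e S (Suc k) C f \<longleftrightarrow> (\<forall>y\<in>S. cmod (f y) \<le> C) \<and>
     (\<exists>f'. (\<forall>y\<in>S. ((\<lambda>t. f (y + t *\<^sub>R e)) has_vector_derivative f' y) (at 0)) \<and>
           bounded_dd e S k C f')"

lemma bounded_dd_bound: "bounded_dd e S k C f \<Longrightarrow> y \<in> S \<Longrightarrow> cmod (f y) \<le> C"
  by (cases k) auto

lemma bounded_dd_SucI:
  assumes "\<And>y. y \<in> S \<Longrightarrow> cmod (f y) \<le> C"
    and "\<And>y. y \<in> S \<Longrightarrow> ((\<lambda>t. f (y + t *\<^sub>R e)) has_vector_derivative f' y) (at 0)"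
    and "bounded_dd e S k C f'"
  shows "bounded_dd e S (Suc k) C f"
  using assms by auto

lemma bounded_dd_SucE:
  assumes "bounded_dd e S (Suc k) C f"
  obtains f' where "\<And>y. y \<in> S \<Longrightarrow> ((\<lambda>t. f (y + t *\<^sub>R e)) has_vector_derivative f' y) (at 0)"
    and "bounded_dd e S k C f'"
  using assms by auto

lemma bounded_dd_mono: "bounded_dd e S k C f \<Longrightarrow> C \<le> D \<Longrightarrow> bounded_dd e S k D f"
proof (induction k arbitrary: f)
  case (Suc k)
  from Suc.prems(1) obtain f' where "\<And>y. y \<in> S \<Longrightarrow> ((\<lambda>t. f (y + t *\<^sub>R e)) has_vector_derivative f' y) (at 0)"
    and "bounded_dd e S k C f'" by (rule bounded_dd_SucE) blast
  then show ?case
    using bounded_dd_bound[OF Suc.prems(1)] Suc.prems(2) Suc.IH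
    by (intro bounded_dd_SucI) (auto intro: order_trans)
qed (auto intro: order_trans)

lemma bounded_dd_antimono: "bounded_dd e S (Suc k) C f \<Longrightarrow> bounded_dd e S k C f"
proof (induction k arbitrary: f)
  case (Suc k)
  from Suc.prems obtain f' where "\<And>y. y \<in> S \<Longrightarrow> ((\<lambda>t. f (y + t *\<^sub>R e)) has_vector_derivative f' y) (at 0)"
    and "bounded_dd e S (Suc k) C f'" by (rule bounded_dd_SucE) blast
  then show ?case
    using bounded_dd_bound[OF Suc.prems] Suc.IH by (intro bounded_dd_SucI)
qed simp

section \<open>Stability of the bounds under sums, products and reciprocals\<close>

lemma bounded_dd_add:
  "bounded_dd e S k C f \<Longrightarrow> bounded_dd e S k D g \<Longrightarrow> bounded_dd e S k (C + D) (\<lambda>y. f y + g y)"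
proof (induction k arbitrary: f g)
  case (Suc k)
  from Suc.prems(1) obtain f' where "\<And>y. y \<in> S \<Longrightarrow> ((\<lambda>t. f (y + t *\<^sub>R e)) has_vector_derivative f' y) (at 0)"
    and "bounded_dd e S k C f'" by (rule bounded_dd_SucE) blast
  moreover from Suc.prems(2) obtain g' where "\<And>y. y \<in> S \<Longrightarrow> ((\<lambda>t. g (y + t *\<^sub>R e)) has_vector_derivative g' y) (at 0)"
    and "bounded_dd e S k D g'" by (rule bounded_dd_SucE) blast
  ultimately show ?case
    using bounded_dd_bound[OF Suc.prems(1)] bounded_dd_bound[OF Suc.prems(2)] Suc.IH
    by (intro bounded_dd_SucI[where f' = "\<lambda>y. f' y + g' y"] norm_triangle_mono has_vector_derivative_add)
qed (auto intro: norm_triangle_mono)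

lemma bounded_dd_uminus: "bounded_dd e S k C f \<Longrightarrow> bounded_dd e S k C (\<lambda>y. - f y)"
proof (induction k arbitrary: f)
  case (Suc k)
  from Suc.prems obtain f' where "\<And>y. y \<in> S \<Longrightarrow> ((\<lambda>t. f (y + t *\<^sub>R e)) has_vector_derivative f' y) (at 0)"
    and "bounded_dd e S k C f'" by (rule bounded_dd_SucE) blast
  then show ?case
    using bounded_dd_bound[OF Suc.prems] Suc.IH
    by (intro bounded_dd_SucI[where f' = "\<lambda>y. - f' y"] has_vector_derivative_minus) auto
qed auto

lemma bounded_dd_cnj: "bounded_dd e S k C f \<Longrightarrow> bounded_dd e S k C (\<lambda>y. cnj (f y))"
proof (induction k arbitrary: f)
  case (Suc k)
  from Suc.prems obtain f' where "\<And>y. y \<in> S \<Longrightarrow> ((\<lambda>t. f (y + t *\<^sub>R e)) has_vector_derivative f' y) (at 0)"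
    and "bounded_dd e S k C f'" by (rule bounded_dd_SucE) blast
  then show ?case
    using bounded_dd_bound[OF Suc.prems] Suc.IH
    by (intro bounded_dd_SucI[where f' = "\<lambda>y. cnj (f' y)"] has_vector_derivative_cnj) auto
qed auto

text \<open>The complement of \<open>K\<close> is open, so \<open>f\<close> vanishes along the line
  for small \<open>t\<close>.\<close>

lemma has_vector_derivative_zero_off_closed:
  fixes f :: "'a::real_normed_vector \<Rightarrow> complex"
  assumes "closed K" "\<And>y. y \<notin> K \<Longrightarrow> f y = 0" "y \<notin> K"
  shows "((\<lambda>t. f (y + t *\<^sub>R e)) has_vector_derivative 0) (at 0)"
proof -
  have "open ((\<lambda>t::real. y + t *\<^sub>R e) -` (- K))"
    using assms(1) by (intro open_vimage) (auto intro!: continuous_intros)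
  then have "((\<lambda>t. 0::complex) has_vector_derivative 0) (at 0) \<longleftrightarrow> ?thesis"
    using assms
    by (intro has_vector_derivative_cong_ev eventually_nhds_in_open[THEN eventually_mono]) auto
  then show ?thesis by simp
qed

lemma dd_zero_off_closed:
  fixes f :: "'a::real_normed_vector \<Rightarrow> complex"
  assumes "closed K" "\<And>y. y \<notin> K \<Longrightarrow> f y = 0" "y \<notin> K"
    and "((\<lambda>t. f (y + t *\<^sub>R e)) has_vector_derivative D) (at 0)"
  shows "D = 0"
  using has_vector_derivative_zero_off_closed[of K f y e] assms vector_derivative_unique_at by blast

text \<open>On \<open>K\<close> this is the product rule. Off \<open>K\<close> the product vanishes
  near \<open>y\<close> whatever \<open>h\<close> does there, and the formula still holds because
  \<open>g y\<close> and \<open>g' y\<close> are both zero.\<close>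

lemma has_vector_derivative_mult_off_closed:
  fixes g h :: "'a::real_normed_vector \<Rightarrow> complex"
  assumes "closed K" "K \<subseteq> S" "\<And>y. y \<notin> K \<Longrightarrow> g y = 0"
    and g': "\<And>y. ((\<lambda>t. g (y + t *\<^sub>R e)) has_vector_derivative g' y) (at 0)"
    and h': "\<And>y. y \<in> S \<Longrightarrow> ((\<lambda>t. h (y + t *\<^sub>R e)) has_vector_derivative h' y) (at 0)"
  shows "((\<lambda>t. g (y + t *\<^sub>R e) * h (y + t *\<^sub>R e)) has_vector_derivative g y * h' y + g' y * h y) (at 0)"
proof (cases "y \<in> K")
  case True
  then show ?thesis
    using has_vector_derivative_mult[OF g'[of y] h'[of y]] assms(2) by auto
next
  case False
  then show ?thesis
    using has_vector_derivative_zero_off_closed[of K "\<lambda>y. g y * h y" y e] assms(1,3)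
      dd_zero_off_closed[OF assms(1,3) False g'] by simp
qed

text \<open>In the application \<open>h\<close> is the reciprocal of a phase derivative that may vanish away from the
  support of \<open>g\<close>.\<close>

lemma bounded_dd_mult:
  assumes "closed K" "K \<subseteq> S" "0 \<le> C" "0 \<le> D"
  shows "bounded_dd e UNIV k C g \<Longrightarrow> bounded_dd e S k D h \<Longrightarrow> (\<And>y. y \<notin> K \<Longrightarrow> g y = 0) \<Longrightarrow>
    bounded_dd e UNIV k (2 ^ k * C * D) (\<lambda>y. g y * h y)"
proof (induction k arbitrary: g h)
  case 0
  have "cmod (g y * h y) \<le> C * D" for y
    using 0 assms by (cases "y \<in> K") (auto simp: norm_mult intro!: mult_mono)
  then show ?case by simp
next
  case (Suc k)
  obtain g' where g': "\<And>y. ((\<lambda>t. g (y + t *\<^sub>R e)) has_vector_derivative g' y) (at 0)"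
      "bounded_dd e UNIV k C g'"
    using Suc.prems(1) by (rule bounded_dd_SucE) blast
  obtain h' where h': "\<And>y. y \<in> S \<Longrightarrow> ((\<lambda>t. h (y + t *\<^sub>R e)) has_vector_derivative h' y) (at 0)"
      "bounded_dd e S k D h'"
    using Suc.prems(2) by (rule bounded_dd_SucE) blast
  \<comment> \<open>The derivative of \<open>g\<close> vanishes off \<open>K\<close> as well, so the
    induction hypothesis applies to both Leibniz terms; having two of them is what doubles the
    constant.\<close>
  have g'0: "g' y = 0" if "y \<notin> K" for y
    using dd_zero_off_closed[OF assms(1) Suc.prems(3) that g'(1)] .
  have "bounded_dd e UNIV k (2 ^ k * C * D + 2 ^ k * C * D) (\<lambda>y. g y * h' y + g' y * h y)"
    by (intro bounded_dd_add Suc.IH g' h' g'0 bounded_dd_antimono[OF Suc.prems(1)]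
        bounded_dd_antimono[OF Suc.prems(2)] Suc.prems(3))
  then have 1: "bounded_dd e UNIV k (2 ^ Suc k * C * D) (\<lambda>y. g y * h' y + g' y * h y)"
    by (simp add: mult_ac)
  have 2: "((\<lambda>t. g (y + t *\<^sub>R e) * h (y + t *\<^sub>R e)) has_vector_derivative g y * h' y + g' y * h y) (at 0)"
    for y
    by (rule has_vector_derivative_mult_off_closed[OF assms(1,2) Suc.prems(3) g'(1) h'(1)])
  have 3: "cmod (g y * h y) \<le> 2 ^ Suc k * C * D" for y
  proof (cases "y \<in> K")
    case True
    then have "cmod (g y * h y) \<le> C * D"
      using bounded_dd_bound[OF Suc.prems(1), of y] bounded_dd_bound[OF Suc.prems(2), of y] assms
      by (auto simp: norm_mult intro!: mult_mono)
    also have "1 * (C * D) \<le> 2 ^ Suc k * (C * D)"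
      using assms by (intro mult_right_mono one_le_power) auto
    finally show ?thesis by (simp add: mult.assoc)
  qed (use Suc.prems(3) assms in auto)
  show ?case
    by (intro bounded_dd_SucI[where f' = "\<lambda>y. g y * h' y + g' y * h y"] 1 2 3)
qed

lemma bounded_dd_mult_UNIV:
  assumes "0 \<le> C" "0 \<le> D" "bounded_dd e UNIV k C g" "bounded_dd e UNIV k D h"
  shows "bounded_dd e UNIV k (2 ^ k * C * D) (\<lambda>y. g y * h y)"
  using bounded_dd_mult[of UNIV UNIV C D e k g h] assms by auto

text \<open>The same Leibniz induction with both factors controlled on \<open>S\<close> only; it
  serves the reciprocal below.\<close>

lemma bounded_dd_mult_on:
  assumes "0 \<le> C" "0 \<le> D"
  shows "bounded_dd e S k C g \<Longrightarrow> bounded_dd e S k D h \<Longrightarrow>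
    bounded_dd e S k (2 ^ k * C * D) (\<lambda>y. g y * h y)"
proof (induction k arbitrary: g h)
  case 0
  then show ?case using assms by (auto simp: norm_mult intro!: mult_mono)
next
  case (Suc k)
  obtain g' where g': "\<And>y. y \<in> S \<Longrightarrow> ((\<lambda>t. g (y + t *\<^sub>R e)) has_vector_derivative g' y) (at 0)"
      "bounded_dd e S k C g'"
    using Suc.prems(1) by (rule bounded_dd_SucE) blast
  obtain h' where h': "\<And>y. y \<in> S \<Longrightarrow> ((\<lambda>t. h (y + t *\<^sub>R e)) has_vector_derivative h' y) (at 0)"
      "bounded_dd e S k D h'"
    using Suc.prems(2) by (rule bounded_dd_SucE) blast
  have "bounded_dd e S k (2 ^ k * C * D + 2 ^ k * C * D) (\<lambda>y. g y * h' y + g' y * h y)"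
    by (intro bounded_dd_add Suc.IH g' h' bounded_dd_antimono[OF Suc.prems(1)]
        bounded_dd_antimono[OF Suc.prems(2)])
  then have 1: "bounded_dd e S k (2 ^ Suc k * C * D) (\<lambda>y. g y * h' y + g' y * h y)"
    by (simp add: mult_ac)
  have 2: "((\<lambda>t. g (y + t *\<^sub>R e) * h (y + t *\<^sub>R e)) has_vector_derivative g y * h' y + g' y * h y) (at 0)"
    if "y \<in> S" for y
    using has_vector_derivative_mult[OF g'(1)[OF that] h'(1)[OF that]] by auto
  have 3: "cmod (g y * h y) \<le> 2 ^ Suc k * C * D" if "y \<in> S" for y
  proof -
    have "cmod (g y * h y) \<le> C * D"
      using bounded_dd_bound[OF Suc.prems(1) that] bounded_dd_bound[OF Suc.prems(2) that] assms
      by (auto simp: norm_mult intro!: mult_mono)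
    also have "1 * (C * D) \<le> 2 ^ Suc k * (C * D)"
      using assms by (intro mult_right_mono one_le_power) auto
    finally show ?thesis by (simp add: mult.assoc)
  qed
  show ?case
    by (intro bounded_dd_SucI[where f' = "\<lambda>y. g y * h' y + g' y * h y"] 1 2 3)
qed

text \<open>The derivative of \<open>1 / f\<close> is \<open>- f' * (1 / f)^2\<close>, which the
  induction hypothesis and the product bound control. The quantifiers over \<open>e\<close>,
  \<open>S\<close> and \<open>f\<close> stand after \<open>D\<close>: later \<open>f\<close> depends
  on the two frequencies, while the constant must not.\<close>

lemma bounded_dd_inverse:
  assumes "0 < c" "0 \<le> C"
  shows "\<exists>D\<ge>0. \<forall>(e::'a::real_normed_vector) S f. bounded_dd e S k C f \<longrightarrow> (\<forall>y\<in>S. c \<le> cmod (f y)) \<longrightarrow>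
    bounded_dd e S k D (\<lambda>y. inverse (f y))"
proof (induction k)
  case 0
  show ?case
    using assms by (intro exI[of _ "inverse c"]) (auto simp: norm_inverse intro!: le_imp_inverse_le)
next
  case (Suc k)
  then obtain D where D: "0 \<le> D" "\<And>(e::'a) S f. bounded_dd e S k C f \<Longrightarrow> (\<forall>y\<in>S. c \<le> cmod (f y)) \<Longrightarrow>
    bounded_dd e S k D (\<lambda>y. inverse (f y))" by blast
  \<comment> \<open>Constant for \<open>f' * (1 / f * 1 / f)\<close>, by two uses of the product
    bound.\<close>
  let ?E = "2 ^ k * C * (2 ^ k * D * D)"
  show ?case
  proof (intro exI[of _ "D + ?E"] conjI allI impI)
    fix e :: 'a and S f
    assume f: "bounded_dd e S (Suc k) C f" and c: "\<forall>y\<in>S. c \<le> cmod (f y)"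
    obtain f' where f': "\<And>y. y \<in> S \<Longrightarrow> ((\<lambda>t. f (y + t *\<^sub>R e)) has_vector_derivative f' y) (at 0)"
      "bounded_dd e S k C f'"
      using f by (rule bounded_dd_SucE) blast
    note inv = D(2)[OF bounded_dd_antimono[OF f] c]
    have "bounded_dd e S k ?E (\<lambda>y. - (f' y * (inverse (f y) * inverse (f y))))"
      using D(1) assms by (intro bounded_dd_uminus bounded_dd_mult_on f' inv) auto
    then have 1: "bounded_dd e S k (D + ?E) (\<lambda>y. - (f' y * (inverse (f y) * inverse (f y))))"
      by (rule bounded_dd_mono) (simp add: D(1))
    have 2: "((\<lambda>t. inverse (f (y + t *\<^sub>R e))) has_vector_derivative
        - (f' y * (inverse (f y) * inverse (f y)))) (at 0)" if "y \<in> S" for y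
    proof -
      have "f y \<noteq> 0" using c that assms(1) by auto
      then have "((\<lambda>t. inverse (f (y + t *\<^sub>R e))) has_derivative
        (\<lambda>s. - (inverse (f (y + 0 *\<^sub>R e)) * (s *\<^sub>R f' y) * inverse (f (y + 0 *\<^sub>R e))))) (at 0)"
        using f'(1)[OF that] unfolding has_vector_derivative_def
        by (intro Deriv.has_derivative_inverse) auto
      then show ?thesis
        by (simp add: has_vector_derivative_def mult_ac)
    qed
    have 3: "cmod (inverse (f y)) \<le> D + ?E" if "y \<in> S" for y
      using bounded_dd_bound[OF inv that] D(1) assms by (simp add: add_increasing2)
    show "bounded_dd e S (Suc k) (D + ?E) (\<lambda>y. inverse (f y))"
      by (intro bounded_dd_SucI[where f' = "\<lambda>y. - (f' y * (inverse (f y) * inverse (f y)))"] 1 2 3)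
  qed (use D(1) assms in auto)
qed

text \<open>For derivatives that are given explicitly. The start \<open>j\<close> is free so that
  the induction can pass from \<open>F j\<close> to \<open>F (Suc j)\<close>.\<close>

lemma bounded_dd_sequence:
  assumes "\<And>i y. y \<in> S \<Longrightarrow> ((\<lambda>t. F i (y + t *\<^sub>R e)) has_vector_derivative F (Suc i) y) (at 0)"
  shows "(\<And>i y. i \<le> j + k \<Longrightarrow> y \<in> S \<Longrightarrow> cmod (F i y) \<le> C) \<Longrightarrow> bounded_dd e S k C (F j)"
proof (induction k arbitrary: j)
  case (Suc k)
  have "bounded_dd e S k C (F (Suc j))"
    using Suc.prems by (intro Suc.IH) auto
  with Suc.prems show ?case by (intro bounded_dd_SucI[where f' = "F (Suc j)"] assms) auto
qed auto

section \<open>Integration by parts\<close>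

lemma integrable_bounded_support:
  fixes f :: "'a::euclidean_space \<Rightarrow> complex"
  assumes [measurable]: "f \<in> borel_measurable borel"
    and "bounded K" "\<And>y. y \<notin> K \<Longrightarrow> f y = 0" "\<And>y. cmod (f y) \<le> B"
  shows "integrable lborel f"
proof -
  obtain R where R: "K \<subseteq> cball 0 R"
    using \<open>bounded K\<close> by (auto simp: bounded_iff subset_iff)
  have "integrable lborel (\<lambda>y. B * indicator (cball (0::'a) R) y :: real)"
    using emeasure_compact_finite[of "cball (0::'a) R"]
    by (intro integrable_mult_right integrable_real_indicator) auto
  then show ?thesis
  proof (rule Bochner_Integration.integrable_bound)
    show "AE y in lborel. norm (f y) \<le> norm (B * indicator (cball (0::'a) R) y)"
      using assms(3,4) R by (intro AE_I2) (auto simp: indicator_def subset_iff intro: order_trans[OF assms(4) abs_ge_self])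
  qed auto
qed

text \<open>Passing from a limit at 0 to a sequence makes measurability of limits and dominated
  convergence available.\<close>

lemma has_vector_derivative_quotients:
  fixes f :: "real \<Rightarrow> complex"
  assumes "(f has_vector_derivative D) (at 0)"
  shows "(\<lambda>n. real (Suc n) *\<^sub>R (f (1 / real (Suc n)) - f 0)) \<longlonglongrightarrow> D"
proof -
  let ?t = "\<lambda>n. 1 / real (Suc n)"
  have "((\<lambda>h. norm (f (0 + h) - f 0 - h *\<^sub>R D) / norm h) \<longlongrightarrow> 0) (at 0)"
    using assms by (simp add: has_vector_derivative_def has_derivative_at)
  moreover have "filterlim ?t (at 0) sequentially"
    unfolding filterlim_at using LIMSEQ_inverse_real_of_nat by (auto simp: inverse_eq_divide)
  ultimately have "(\<lambda>n. norm (f (0 + ?t n) - f 0 - ?t n *\<^sub>R D) / norm (?t n)) \<longlonglongrightarrow> 0"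
    by (rule filterlim_compose)
  moreover have "norm (f (0 + ?t n) - f 0 - ?t n *\<^sub>R D) / norm (?t n) =
      norm (real (Suc n) *\<^sub>R (f (?t n) - f 0) - D)" for n
  proof -
    have "norm (f (0 + ?t n) - f 0 - ?t n *\<^sub>R D) / norm (?t n) =
       norm (real (Suc n) *\<^sub>R (f (0 + ?t n) - f 0 - ?t n *\<^sub>R D))"
      by simp
    also have "real (Suc n) *\<^sub>R (f (0 + ?t n) - f 0 - ?t n *\<^sub>R D) = real (Suc n) *\<^sub>R (f (?t n) - f 0) - D"
      by (simp add: scaleR_diff_right del: of_nat_Suc)
    finally show ?thesis .
  qed
  ultimately show ?thesis
    by (simp add: tendsto_norm_zero_iff LIM_zero_iff)
qed

lemma directional_derivative_measurable:
  fixes G :: "'a::euclidean_space \<Rightarrow> complex"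
  assumes [measurable]: "G \<in> borel_measurable borel"
    and "\<And>y. ((\<lambda>t. G (y + t *\<^sub>R e)) has_vector_derivative G' y) (at 0)"
  shows "G' \<in> borel_measurable borel"
proof (rule borel_measurable_LIMSEQ_metric)
  show "(\<lambda>n. real (Suc n) *\<^sub>R (G (y + (1 / real (Suc n)) *\<^sub>R e) - G y)) \<longlonglongrightarrow> G' y" for y
    using has_vector_derivative_quotients[OF assms(2)[of y]] by simp
qed measurable

text \<open>Difference quotients of \<open>G\<close> have integral zero by translation invariance of
  \<open>lborel\<close>, and the mean value inequality bounds them by \<open>B'\<close> on a fixed
  ball, so dominated convergence passes to the derivative.\<close>

lemma integral_directional_derivative:
  fixes G :: "'a::euclidean_space \<Rightarrow> complex"
  assumes G[measurable]: "G \<in> borel_measurable borel"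
    and K: "bounded K" "\<And>y. y \<notin> K \<Longrightarrow> G y = 0" and B: "\<And>y. cmod (G y) \<le> B"
    and D: "\<And>y. ((\<lambda>t. G (y + t *\<^sub>R e)) has_vector_derivative G' y) (at 0)"
    and B': "\<And>y. cmod (G' y) \<le> B'"
  shows "(LINT y|lborel. G' y) = 0"
proof -
  note [measurable] = directional_derivative_measurable[OF G D]
  let ?t = "\<lambda>n. 1 / real (Suc n)"
  let ?s = "\<lambda>n y. real (Suc n) *\<^sub>R (G (y + ?t n *\<^sub>R e) - G y)"
  have intG: "integrable lborel G"
    by (rule integrable_bounded_support[OF G K B])
  \<comment> \<open>\<open>D\<close> speaks of \<open>t = 0\<close> only; moving the base point
    gives the derivative at every \<open>t\<close>.\<close>
  have D2: "((\<lambda>t. G (y + t *\<^sub>R e)) has_vector_derivative G' (y + t *\<^sub>R e)) (at t)" for y t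
  proof -
    have "((\<lambda>s. G (y + (s + t) *\<^sub>R e)) has_vector_derivative G' (y + t *\<^sub>R e)) (at 0)"
      using D[of "y + t *\<^sub>R e"] by (simp add: algebra_simps)
    then show ?thesis
      unfolding has_vector_derivative_def has_derivative_at
      by (simp add: add.commute)
  qed
  have bd: "cmod (?s n y) \<le> B'" for n y
  proof -
    have "norm (G (y + ?t n *\<^sub>R e) - G (y + 0 *\<^sub>R e)) \<le> B' * norm (?t n - 0)"
    proof (rule differentiable_bound[of UNIV])
      show "((\<lambda>t. G (y + t *\<^sub>R e)) has_derivative (\<lambda>s. s *\<^sub>R G' (y + t *\<^sub>R e))) (at t within UNIV)" for t
        using D2[of y t] by (simp add: has_vector_derivative_def)
      show "onorm (\<lambda>s. s *\<^sub>R G' (y + t *\<^sub>R e)) \<le> B'" for t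
        by (rule onorm_le) (simp add: mult.commute[of B'] mult_left_mono B')
    qed auto
    then show ?thesis
      by (simp add: pos_le_divide_eq mult.commute del: of_nat_Suc)
  qed
  obtain R where R: "K \<subseteq> cball 0 R"
    using \<open>bounded K\<close> by (auto simp: bounded_iff subset_iff)
  \<comment> \<open>The steps \<open>1 / Suc n\<close> are at most 1, so one ball, larger by
    \<open>norm e\<close>, contains the supports of all difference quotients.\<close>
  have zero: "?s n y = 0" if "y \<notin> cball 0 (R + norm e)" for n y
  proof -
    have "norm (y + ?t n *\<^sub>R e) \<ge> norm y - norm (?t n *\<^sub>R e)"
      by (metis add_diff_cancel norm_triangle_ineq2 norm_minus_commute diff_diff_eq2 norm_triangle_sub add.commute diff_le_eq)
    moreover have "norm (?t n *\<^sub>R e) \<le> norm e"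
      by (simp add: divide_le_eq mult_left_le_one_le field_simps)
    ultimately have "y + ?t n *\<^sub>R e \<notin> K" "y \<notin> K"
      using that R norm_ge_zero[of e] by (auto simp: subset_iff dist_norm simp del: norm_ge_zero)
    with K(2) show ?thesis by simp
  qed
  have int0: "(LINT y|lborel. ?s n y) = 0" for n
  proof -
    have "(LINT y|lborel. G (y + ?t n *\<^sub>R e)) = (LINT y|distr lborel borel ((+) (?t n *\<^sub>R e)). G y)"
      by (subst integral_distr) (auto simp: add.commute)
    moreover have "integrable (distr lborel borel ((+) (?t n *\<^sub>R e))) G"
      using intG by (simp add: lborel_distr_plus)
    then have "integrable lborel (\<lambda>y. G (y + ?t n *\<^sub>R e))"
      by (subst (asm) integrable_distr_eq) (auto simp: add.commute)
    ultimately show ?thesis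
      using intG by (simp add: lborel_distr_plus)
  qed
  have "(\<lambda>n. LINT y|lborel. ?s n y) \<longlonglongrightarrow> (LINT y|lborel. G' y)"
  proof (rule integral_dominated_convergence)
    show "integrable lborel (\<lambda>y. B' * indicator (cball (0::'a) (R + norm e)) y :: real)"
      using emeasure_compact_finite[of "cball (0::'a) (R + norm e)"]
      by (intro integrable_mult_right integrable_real_indicator) auto
    show "AE y in lborel. (\<lambda>n. ?s n y) \<longlonglongrightarrow> G' y"
      using has_vector_derivative_quotients[OF D] by simp
    show "AE y in lborel. norm (?s n y) \<le> B' * indicator (cball (0::'a) (R + norm e)) y" for n
      using bd[of n] zero[of _ n] by (intro AE_I2) (auto simp: indicator_def)
  qed auto
  then show ?thesis
    unfolding int0 by (simp add: LIMSEQ_const_iff)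
qed

lemma norm_integral_bounded_support:
  fixes f :: "'a::euclidean_space \<Rightarrow> complex"
  assumes f: "f \<in> borel_measurable borel"
    and K: "compact K" "\<And>y. y \<notin> K \<Longrightarrow> f y = 0" and B: "\<And>y. cmod (f y) \<le> B"
  shows "cmod (LINT y|lborel. f y) \<le> B * measure lborel K"
proof -
  have fin: "emeasure lborel K < \<infinity>" and [measurable]: "K \<in> sets borel"
    using K(1) emeasure_compact_finite[OF K(1)] by (auto simp: compact_imp_closed)
  have "cmod (LINT y|lborel. f y) \<le> (LINT y|lborel. B * indicator K y)"
    using fin B K(2)
    by (intro order_trans[OF integral_norm_bound integral_mono] integrable_norm
          integrable_bounded_support[OF f compact_imp_bounded[OF K(1)] K(2) B]
          integrable_mult_right integrable_real_indicator) (auto simp: indicator_def)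
  then show ?thesis by simp
qed

text \<open>Each integration by parts trades the amplitude \<open>g\<close> for a derivative of \<open>g * h\<close>, where
  \<open>h / r\<close> is the reciprocal of the derivative of the phase, and gains a factor \<open>1 / (lam * r)\<close>.\<close>

lemma oscillatory_integral_decay:
  fixes \<phi> :: "'a::euclidean_space \<Rightarrow> real"
  assumes K: "compact K" "K \<subseteq> S" and "0 < r" "0 < lam" "0 \<le> D"
    and [measurable]: "\<phi> \<in> borel_measurable borel" "h \<in> borel_measurable borel"
    and \<phi>: "\<And>y. ((\<lambda>t. \<phi> (y + t *\<^sub>R e)) has_vector_derivative p y) (at 0)"
    and hp: "\<And>y. y \<in> S \<Longrightarrow> h y * of_real (p y) = of_real r"
  shows "bounded_dd e S k D h \<Longrightarrow> bounded_dd e UNIV k C g \<Longrightarrow> (\<And>y. y \<notin> K \<Longrightarrow> g y = 0) \<Longrightarrow>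
     g \<in> borel_measurable borel \<Longrightarrow> 0 \<le> C \<Longrightarrow>
     cmod (LINT y|lborel. exp (\<i> * of_real (lam * \<phi> y)) * g y) \<le> (2 ^ k * D / (lam * r)) ^ k * C * measure lborel K"
proof (induction k arbitrary: C g)
  case 0
  note [measurable] = 0(4)
  show ?case
    using norm_integral_bounded_support[of "\<lambda>y. exp (\<i> * of_real (lam * \<phi> y)) * g y" K C] K 0
    by (simp add: norm_mult)
next
  case (Suc k)
  note [measurable] = Suc.prems(4)
  let ?E = "\<lambda>y. exp (\<i> * of_real (lam * \<phi> y))"
  have closed: "closed K" and bdd: "bounded K"
    using K(1) by (auto simp: compact_imp_closed compact_imp_bounded)
  \<comment> \<open>Constant for \<open>g * h\<close>. The derivative \<open>g1\<close> of this
    product is the amplitude of the next round and has one controlled derivative less.\<close>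
  define C1 where "C1 = 2 ^ Suc k * C * D"
  have C1: "0 \<le> C1" using Suc.prems(5) \<open>0 \<le> D\<close> by (simp add: C1_def)
  have gh: "bounded_dd e UNIV (Suc k) C1 (\<lambda>y. g y * h y)"
    unfolding C1_def
    using bounded_dd_mult[OF closed K(2) Suc.prems(5) \<open>0 \<le> D\<close> Suc.prems(2,1,3)] .
  then obtain g1 where g1: "\<And>y. ((\<lambda>t. g (y + t *\<^sub>R e) * h (y + t *\<^sub>R e)) has_vector_derivative g1 y) (at 0)"
    "bounded_dd e UNIV k C1 g1" by (rule bounded_dd_SucE) blast
  have g10: "g1 y = 0" if "y \<notin> K" for y
    using dd_zero_off_closed[OF closed _ that, of "\<lambda>y. g y * h y"] g1(1) Suc.prems(3) by auto
  have [measurable]: "g1 \<in> borel_measurable borel"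
    by (rule directional_derivative_measurable[OF _ g1(1)]) measurable
  have derE: "((\<lambda>t. ?E (y + t *\<^sub>R e)) has_vector_derivative \<i> * of_real (lam * p y) * ?E y) (at 0)" for y
  proof -
    have "((\<lambda>t. \<i> * of_real (lam * \<phi> (y + t *\<^sub>R e))) has_vector_derivative \<i> * of_real (lam * p y)) (at 0)"
      using \<phi>[of y]
      by (intro has_vector_derivative_mult_right has_vector_derivative_of_real) 
         (auto simp: has_real_derivative_iff_has_vector_derivative intro!: has_vector_derivative_mult_right)
    from field_vector_diff_chain_at[OF this DERIV_exp] show ?thesis
      by (simp add: o_def mult.commute)
  qed
  have *: "\<i> * of_real (lam * p y) * ?E y * (g y * h y) = \<i> * of_real (lam * r) * (?E y * g y)" for y
  proof (cases "y \<in> K")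
    case True
    then have "of_real r = h y * of_real (p y)" using hp K(2) by auto
    then show ?thesis by (simp add: mult_ac)
  qed (simp add: Suc.prems(3))
  have der: "((\<lambda>t. ?E (y + t *\<^sub>R e) * (g (y + t *\<^sub>R e) * h (y + t *\<^sub>R e))) has_vector_derivative
      ?E y * g1 y + \<i> * of_real (lam * r) * (?E y * g y)) (at 0)" for y
    using has_vector_derivative_mult[OF derE[of y] g1(1)[of y]]
    by (simp only: scaleR_zero_left add_0_right *)
  have "(LINT y|lborel. ?E y * g1 y + \<i> * of_real (lam * r) * (?E y * g y)) = 0"
  proof (rule integral_directional_derivative[where K = K, OF _ bdd _ _ der])
    show "cmod (?E y * (g y * h y)) \<le> C1" for y
      using bounded_dd_bound[OF gh] by (simp add: norm_mult)
    show "cmod (?E y * g1 y + \<i> * of_real (lam * r) * (?E y * g y)) \<le> C1 + lam * r * C" for y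
      using bounded_dd_bound[OF g1(2), of y] bounded_dd_bound[OF Suc.prems(2), of y] \<open>0 < r\<close> \<open>0 < lam\<close>
      by (intro order_trans[OF norm_triangle_ineq] add_mono) (auto simp: norm_mult)
  qed (auto simp: Suc.prems(3))
  moreover have "integrable lborel (\<lambda>y. ?E y * g1 y)"
    using bounded_dd_bound[OF g1(2)]
    by (intro integrable_bounded_support[OF _ bdd]) (auto simp: norm_mult g10)
  moreover have "integrable lborel (\<lambda>y. ?E y * g y)"
    using bounded_dd_bound[OF Suc.prems(2)]
    by (intro integrable_bounded_support[OF _ bdd]) (auto simp: norm_mult Suc.prems(3))
  ultimately have "(LINT y|lborel. ?E y * g1 y) + \<i> * of_real (lam * r) * (LINT y|lborel. ?E y * g y) = 0"
    by (subst (asm) Bochner_Integration.integral_add) auto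
  then have "(LINT y|lborel. ?E y * g1 y) = - (\<i> * of_real (lam * r) * (LINT y|lborel. ?E y * g y))"
    by (simp add: add_eq_0_iff)
  then have "cmod (LINT y|lborel. ?E y * g1 y) = lam * r * cmod (LINT y|lborel. ?E y * g y)"
    using \<open>0 < r\<close> \<open>0 < lam\<close> by (simp add: norm_mult)
  then have "cmod (LINT y|lborel. ?E y * g y) = cmod (LINT y|lborel. ?E y * g1 y) / (lam * r)"
    using \<open>0 < r\<close> \<open>0 < lam\<close> by simp
  also have "\<dots> \<le> ((2 ^ k * D / (lam * r)) ^ k * C1 * measure lborel K) / (lam * r)"
    using \<open>0 < r\<close> \<open>0 < lam\<close>
    by (intro divide_right_mono Suc.IH bounded_dd_antimono[OF Suc.prems(1)] g1(2) g10 C1) auto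
  also have "\<dots> = (2 ^ k * D / (lam * r)) ^ k * (2 ^ Suc k * D / (lam * r)) * C * measure lborel K"
    by (simp add: C1_def)
  \<comment> \<open>The induction hypothesis gives factors with \<open>2 ^ k\<close>, the new factor
    has \<open>2 ^ Suc k\<close>; enlarging the former makes it a single power.\<close>
  also have "\<dots> \<le> (2 ^ Suc k * D / (lam * r)) ^ k * (2 ^ Suc k * D / (lam * r)) * C * measure lborel K"
    using \<open>0 < r\<close> \<open>0 < lam\<close> \<open>0 \<le> D\<close> Suc.prems(5)
    by (intro mult_right_mono power_mono divide_right_mono) auto
  finally show ?case by (simp only: power_Suc2)
qed

text \<open>A power of the truncated quadratic \<open>1 - |y - y0|^2 / \<rho>^2\<close>. The
  exponent \<open>Suc k\<close> leaves room for \<open>k\<close> bounded derivatives, and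
  differentiating \<open>bump (Suc k)\<close> gives \<open>bump k\<close> times an affine function,
  which suits an induction on \<open>k\<close>.\<close>

definition bump :: "nat \<Rightarrow> real \<Rightarrow> 'a::euclidean_space \<Rightarrow> 'a \<Rightarrow> real" where
  "bump k \<rho> y0 y = max 0 (1 - (y - y0) \<bullet> (y - y0) / \<rho>\<^sup>2) ^ Suc k"

lemma bump_nonneg: "0 \<le> bump k \<rho> y0 y"
  by (simp add: bump_def)

lemma bump_le_1: "bump k \<rho> y0 y \<le> 1"
  unfolding bump_def by (intro power_le_one) auto

lemma bump_eq_0: "0 < \<rho> \<Longrightarrow> y \<notin> cball y0 \<rho> \<Longrightarrow> bump k \<rho> y0 y = 0"
proof -
  assume "0 < \<rho>" "y \<notin> cball y0 \<rho>"
  then have "\<rho>\<^sup>2 \<le> (norm (y - y0))\<^sup>2"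
    by (intro power_mono) (auto simp: dist_norm norm_minus_commute)
  with \<open>0 < \<rho>\<close> show ?thesis
    by (simp add: bump_def power2_norm_eq_inner max_absorb1 field_simps)
qed

lemma bump_ge:
  assumes "0 < \<rho>" "y \<in> ball y0 (\<rho> / 2)"
  shows "(1 / 2) ^ Suc k \<le> bump k \<rho> y0 y"
proof -
  have "(norm (y - y0))\<^sup>2 \<le> (\<rho> / 2)\<^sup>2"
    using assms by (intro power_mono) (auto simp: dist_norm norm_minus_commute)
  then have "(y - y0) \<bullet> (y - y0) \<le> \<rho>\<^sup>2 / 4"
    by (simp add: power2_norm_eq_inner power_divide)
  then have "(y - y0) \<bullet> (y - y0) / \<rho>\<^sup>2 \<le> 1 / 2"
    using assms(1) by (simp add: field_simps) (smt (verit) zero_less_power)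
  then show ?thesis
    unfolding bump_def by (intro power_mono order_trans[OF _ max.cobounded2]) linarith+
qed

lemma bump_measurable [measurable]: "bump k \<rho> y0 \<in> borel_measurable borel"
  unfolding bump_def [abs_def] by measurable

text \<open>The only delicate point is 0, where Caratheodory's criterion applies because one factor
  \<open>max 0 x\<close> may be replaced by \<open>x\<close>.\<close>

lemma DERIV_max_power: "((\<lambda>x::real. max 0 x ^ Suc (Suc m)) has_real_derivative real (Suc (Suc m)) * max 0 x ^ Suc m) (at x)"
proof -
  consider "x < 0" | "x = 0" | "x > 0" by linarith
  then show ?thesis
  proof cases
    case 1
    have "((\<lambda>x::real. 0) has_real_derivative 0) (at x)" by simp
    then have "((\<lambda>x::real. max 0 x ^ Suc (Suc m)) has_real_derivative 0) (at x)"
      using 1 by (rule_tac has_field_derivative_transform_within_open[where S = "{..<0}" and f = "\<lambda>x. 0"]) auto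
    with 1 show ?thesis by (simp add: max_absorb1)
  next
    case 2
    then show ?thesis
      unfolding CARAT_DERIV
    proof (intro exI[of _ "\<lambda>x. max 0 x ^ Suc m"] conjI)
      show "isCont (\<lambda>x. max 0 x ^ Suc m) x" by (intro continuous_intros)
    qed (auto simp: max_def)
  next
    case 3
    have "((\<lambda>x::real. x ^ Suc (Suc m)) has_real_derivative real (Suc (Suc m)) * x ^ Suc m) (at x)"
      using DERIV_pow[of "Suc (Suc m)" x] by simp
    then have "((\<lambda>x::real. max 0 x ^ Suc (Suc m)) has_real_derivative real (Suc (Suc m)) * x ^ Suc m) (at x)"
      using 3 by (rule_tac has_field_derivative_transform_within_open[where S = "{0<..}"]) (auto simp: max_def)
    with 3 show ?thesis by (simp add: max_absorb2)
  qed
qed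

text \<open>The constant is independent of the centre because all estimates involve only
  \<open>y - y0\<close>.\<close>

lemma bounded_dd_bump:
  assumes "0 < \<rho>"
  shows "\<exists>C\<ge>0. \<forall>y0::'a::euclidean_space. \<forall>e\<in>Basis. bounded_dd e UNIV k C (\<lambda>y. of_real (bump k \<rho> y0 y))"
proof (induction k)
  case 0
  have "bounded_dd e UNIV 0 1 (\<lambda>y. of_real (bump 0 \<rho> y0 y))" for e y0 :: 'a
    using bump_nonneg[of 0 \<rho> y0] bump_le_1[of 0 \<rho> y0] by (simp add: abs_of_nonneg)
  then show ?case by (intro exI[of _ 1]) (simp del: bounded_dd.simps)
next
  case (Suc k)
  then obtain C where C: "0 \<le> C" "\<And>(y0::'a) e. e \<in> Basis \<Longrightarrow> bounded_dd e UNIV k C (\<lambda>y. of_real (bump k \<rho> y0 y))"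
    by blast
  \<comment> \<open>Up to the factor \<open>Suc (Suc k)\<close>, this bounds \<open>s 0\<close> and
    its derivative: \<open>4 / \<rho>\<close> comes from \<open>norm (y - y0) < 2 * \<rho>\<close>,
    and \<open>2 / \<rho>^2\<close> is the size of the derivative.\<close>
  define B where "B = real (Suc (Suc k)) * (4 / \<rho> + 2 / \<rho>\<^sup>2)"
  define C' where "C' = 1 + 2 ^ k * C * B"
  have B: "0 \<le> B" using assms by (simp add: B_def)
  show ?case
  proof (intro exI[of _ C'] conjI allI ballI)
    fix y0 e :: 'a assume e: "e \<in> Basis"
    \<comment> \<open>The affine factor produced by the chain rule, followed by its successive
      derivatives.\<close>
    define s where "s i y = (if i = 0 then of_real (- (real (Suc (Suc k)) * (2 * ((y - y0) \<bullet> e) / \<rho>\<^sup>2)))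
      else if i = 1 then of_real (- (real (Suc (Suc k)) * (2 / \<rho>\<^sup>2))) else 0 :: complex)" for i :: nat and y
    have s': "((\<lambda>t. s i (y + t *\<^sub>R e)) has_vector_derivative s (Suc i) y) (at 0)" for i y
    proof (cases "i = 0")
      case True
      have "((\<lambda>t. (- (real (Suc (Suc k)) * (2 * ((y + t *\<^sub>R e - y0) \<bullet> e) / \<rho>\<^sup>2)))) has_real_derivative
         - (real (Suc (Suc k)) * (2 / \<rho>\<^sup>2))) (at 0)"
        using e assms
        by (auto intro!: derivative_eq_intros simp: inner_add_left inner_diff_left field_simps
            power4_eq_xxxx power2_eq_square)
      from has_vector_derivative_of_real[OF this] True show ?thesis
        by (simp add: s_def del: of_real_minus of_real_mult of_real_divide of_nat_Suc)
    next
      case False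
      then have "(\<lambda>t::real. s i (y + t *\<^sub>R e)) = (\<lambda>t. if i = 1 then of_real (- (real (Suc (Suc k)) * (2 / \<rho>\<^sup>2))) else 0)"
        by (auto simp: s_def)
      moreover have "s (Suc i) y = 0" using False by (simp add: s_def)
      ultimately show ?thesis by simp
    qed
    \<comment> \<open>An affine function is unbounded, so its bound is taken on a ball larger than
      the support of \<open>bump k\<close>; \<open>bounded_dd_mult\<close> allows this.\<close>
    have "bounded_dd e (ball y0 (2 * \<rho>)) k B (s 0)"
    proof (rule bounded_dd_sequence[where F = s, OF s'])
      fix i y assume "y \<in> ball y0 (2 * \<rho>)"
      then have "\<bar>(y - y0) \<bullet> e\<bar> \<le> 2 * \<rho>"
        using Basis_le_norm[OF e, of "y - y0"] by (simp add: dist_norm norm_minus_commute)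
      then have "2 * \<bar>(y - y0) \<bullet> e\<bar> / \<rho>\<^sup>2 \<le> 2 * (2 * \<rho>) / \<rho>\<^sup>2"
        using assms by (intro divide_right_mono) auto
      also have "\<dots> = 4 / \<rho>" using assms by (simp add: power2_eq_square)
      finally have 1: "2 * \<bar>(y - y0) \<bullet> e\<bar> / \<rho>\<^sup>2 \<le> 4 / \<rho> + 2 / \<rho>\<^sup>2"
        using assms by (smt (verit) divide_nonneg_nonneg zero_le_power2)
      have 2: "2 / \<rho>\<^sup>2 \<le> 4 / \<rho> + 2 / \<rho>\<^sup>2"
        using assms by simp
      have 0: "cmod (s i y) = real (Suc (Suc k)) * (if i = 0 then 2 * \<bar>(y - y0) \<bullet> e\<bar> / \<rho>\<^sup>2 else if i = 1 then 2 / \<rho>\<^sup>2 else 0)"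
        unfolding s_def by (simp only: if_distrib[of cmod] norm_of_real norm_minus_cancel norm_zero if_distrib[of "(*) _"])
           (auto simp: abs_mult simp del: of_nat_Suc)
      show "cmod (s i y) \<le> B"
        unfolding 0 B_def using 1 2 assms by (intro mult_left_mono) auto
    qed
    then have "bounded_dd e UNIV k (2 ^ k * C * B) (\<lambda>y. of_real (bump k \<rho> y0 y) * s 0 y)"
      using assms C B e by (intro bounded_dd_mult[of "cball y0 \<rho>" "ball y0 (2 * \<rho>)"]) (auto simp: bump_eq_0)
    then have 1: "bounded_dd e UNIV k C' (\<lambda>y. of_real (bump k \<rho> y0 y) * s 0 y)"
      by (rule bounded_dd_mono) (simp add: C'_def)
    have 2: "((\<lambda>t. of_real (bump (Suc k) \<rho> y0 (y + t *\<^sub>R e))) has_vector_derivative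
        (of_real (bump k \<rho> y0 y) * s 0 y :: complex)) (at 0)" for y
    proof -
      have "((\<lambda>t. 1 - (y + t *\<^sub>R e - y0) \<bullet> (y + t *\<^sub>R e - y0) / \<rho>\<^sup>2) has_real_derivative
        - (2 * ((y - y0) \<bullet> e) / \<rho>\<^sup>2)) (at 0)"
      proof -
        have eq: "(y + t *\<^sub>R e - y0) \<bullet> (y + t *\<^sub>R e - y0) =
          (y - y0) \<bullet> (y - y0) + 2 * t * ((y - y0) \<bullet> e) + t * t" for t
          using e by (simp add: inner_add_left inner_add_right inner_diff_left inner_diff_right inner_commute
              algebra_simps)
        show ?thesis
          unfolding eq using assms
          by (auto intro!: derivative_eq_intros simp: power4_eq_xxxx power2_eq_square)
      qed
      from DERIV_chain2[OF DERIV_max_power[of k] this]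
      have "((\<lambda>t. bump (Suc k) \<rho> y0 (y + t *\<^sub>R e)) has_real_derivative
         bump k \<rho> y0 y * (- (real (Suc (Suc k)) * (2 * ((y - y0) \<bullet> e) / \<rho>\<^sup>2)))) (at 0)"
        by (simp add: bump_def mult_ac del: of_nat_Suc power_Suc)
      from has_vector_derivative_of_real[OF this] show ?thesis
        by (simp only: s_def of_real_mult simp_thms if_True)
    qed
    have 3: "cmod (of_real (bump (Suc k) \<rho> y0 y)) \<le> C'" for y
      using bump_nonneg[of "Suc k" \<rho> y0 y] bump_le_1[of "Suc k" \<rho> y0 y] B C(1)
      by (simp add: C'_def add_increasing2)
    show "bounded_dd e UNIV (Suc k) C' (\<lambda>y. of_real (bump (Suc k) \<rho> y0 y))"
      by (intro bounded_dd_SucI[where f' = "\<lambda>y. of_real (bump k \<rho> y0 y) * s 0 y"] 1 2 3)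
  qed (use B C in \<open>simp add: C'_def\<close>)
qed

section \<open>Schur's test\<close>

lemma measurable_cnj [measurable]: "cnj \<in> borel_measurable borel"
  by (intro borel_measurable_continuous_onI continuous_intros)

lemma (in pair_sigma_finite) integrable_product:
  fixes f :: "'a \<Rightarrow> complex" and g :: "'b \<Rightarrow> complex"
  assumes f: "integrable M1 f" and g: "integrable M2 g"
  shows "integrable (M1 \<Otimes>\<^sub>M M2) (\<lambda>(x, y). f x * g y)"
    and "(LINT p|(M1 \<Otimes>\<^sub>M M2). (case p of (x, y) \<Rightarrow> f x * g y)) = (LINT x|M1. f x) * (LINT y|M2. g y)"
proof -
  note [measurable] = borel_measurable_integrable[OF f] borel_measurable_integrable[OF g]
  show *: "integrable (M1 \<Otimes>\<^sub>M M2) (\<lambda>(x, y). f x * g y)"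
  proof (rule Fubini_integrable)
    show "integrable M1 (\<lambda>x. LINT y|M2. norm (case (x, y) of (x, y) \<Rightarrow> f x * g y))"
      using f by (simp add: norm_mult integrable_norm)
  qed (use g in auto)
  show "(LINT p|(M1 \<Otimes>\<^sub>M M2). (case p of (x, y) \<Rightarrow> f x * g y)) = (LINT x|M1. f x) * (LINT y|M2. g y)"
    by (subst integral_fst'[OF *, symmetric]) simp
qed

text \<open>The integral bounded by \<open>k\<close> is, up to conjugation, the kernel of \<open>T\<^sup>* w T\<close>, where \<open>T\<close> has kernel \<open>A\<close>.\<close>

lemma weighted_L2_bound_Schur:
  fixes A :: "'a \<Rightarrow> 'b \<Rightarrow> complex" and F :: "'b \<Rightarrow> complex" and w :: "'a \<Rightarrow> real"
  assumes "sigma_finite_measure M" "sigma_finite_measure P"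
    and w: "integrable M w" "\<And>y. 0 \<le> w y"
    and A[measurable]: "(\<lambda>(y, \<xi>). A y \<xi>) \<in> borel_measurable (M \<Otimes>\<^sub>M P)" and B: "\<And>y \<xi>. cmod (A y \<xi>) \<le> B"
    and F: "integrable P F" "integrable P (\<lambda>\<xi>. (cmod (F \<xi>))\<^sup>2)"
    and k[measurable]: "(\<lambda>(\<xi>, \<eta>). k \<xi> \<eta>) \<in> borel_measurable (P \<Otimes>\<^sub>M P)"
    and k_sym: "\<And>\<xi> \<eta>. k \<xi> \<eta> = k \<eta> \<xi>" and k_nonneg: "\<And>\<xi> \<eta>. 0 \<le> k \<xi> \<eta>"
    and k_int: "\<And>\<xi>. (\<integral>\<^sup>+ \<eta>. ennreal (k \<xi> \<eta>) \<partial>P) \<le> ennreal b" and "0 \<le> b"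
    and K: "\<And>\<xi> \<eta>. F \<xi> \<noteq> 0 \<Longrightarrow> F \<eta> \<noteq> 0 \<Longrightarrow>
        cmod (LINT y|M. of_real (w y) * A y \<xi> * cnj (A y \<eta>)) \<le> k \<xi> \<eta>"
  shows "(\<integral>\<^sup>+ y. ennreal (w y * (cmod (LINT \<xi>|P. A y \<xi> * F \<xi>))\<^sup>2) \<partial>M) \<le> ennreal (b * (LINT \<xi>|P. (cmod (F \<xi>))\<^sup>2))"
proof -
  interpret M: sigma_finite_measure M by fact
  interpret P: sigma_finite_measure P by fact
  interpret PP: pair_sigma_finite P P by standard
  interpret Q: pair_sigma_finite "P \<Otimes>\<^sub>M P" M by standard
  note [measurable] = borel_measurable_integrable[OF w(1)] borel_measurable_integrable[OF F(1)]
  have A': "(\<lambda>\<xi>. A y \<xi>) \<in> borel_measurable P" if "y \<in> space M" for y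
    using measurable_compose[OF measurable_Pair1'[OF that] A] by simp
  have A'': "(\<lambda>y. A y \<xi>) \<in> borel_measurable M" if "\<xi> \<in> space P" for \<xi>
    using measurable_compose[OF measurable_Pair2'[OF that] A] by simp
  define u where "u y = (LINT \<xi>|P. A y \<xi> * F \<xi>)" for y
  \<comment> \<open>Integrated first over \<open>(\<xi>, \<eta>)\<close> this gives
    \<open>w y\<close> times the squared modulus of \<open>u y\<close>; integrated first over
    \<open>y\<close> it gives the kernel.\<close>
  define H where "H = (\<lambda>((\<xi>, \<eta>), y). (F \<xi> * cnj (F \<eta>)) * (of_real (w y) * A y \<xi> * cnj (A y \<eta>)))"
  have [measurable]: "H \<in> borel_measurable ((P \<Otimes>\<^sub>M P) \<Otimes>\<^sub>M M)"
  proof -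
    have 1: "(\<lambda>p. A (snd p) (fst (fst p))) \<in> borel_measurable ((P \<Otimes>\<^sub>M P) \<Otimes>\<^sub>M M)"
      using measurable_compose[OF _ A, of "\<lambda>p. (snd p, fst (fst p))" "(P \<Otimes>\<^sub>M P) \<Otimes>\<^sub>M M"] by simp
    have 2: "(\<lambda>p. A (snd p) (snd (fst p))) \<in> borel_measurable ((P \<Otimes>\<^sub>M P) \<Otimes>\<^sub>M M)"
      using measurable_compose[OF _ A, of "\<lambda>p. (snd p, snd (fst p))" "(P \<Otimes>\<^sub>M P) \<Otimes>\<^sub>M M"] by simp
    note [measurable] = 1 2
    show ?thesis unfolding H_def case_prod_beta by measurable
  qed
  have Fc: "integrable P (\<lambda>\<xi>. cnj (F \<xi>))" using F(1) by simp
  have Y: "integrable P (\<lambda>\<xi>. A y \<xi> * F \<xi>)" if "y \<in> space M" for y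
  proof (rule Bochner_Integration.integrable_bound)
    show "integrable P (\<lambda>\<xi>. of_real B * F \<xi>)" using F(1) by simp
    show "AE \<xi> in P. norm (A y \<xi> * F \<xi>) \<le> norm (of_real B * F \<xi>)"
      by (intro AE_I2) (auto simp: norm_mult intro!: mult_right_mono order_trans[OF B])
  qed (use A'[OF that] in measurable)
  \<comment> \<open>\<open>F\<close> and \<open>w\<close> are integrable and \<open>A\<close> is
    bounded, so a product of one-variable functions dominates \<open>H\<close>.\<close>
  have intH: "integrable ((P \<Otimes>\<^sub>M P) \<Otimes>\<^sub>M M) H"
  proof (rule Bochner_Integration.integrable_bound)
    show "integrable ((P \<Otimes>\<^sub>M P) \<Otimes>\<^sub>M M) (\<lambda>(p, y). (case p of (\<xi>, \<eta>) \<Rightarrow> F \<xi> * cnj (F \<eta>)) * of_real (B\<^sup>2 * w y))"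
      using F(1) w(1) by (intro Q.integrable_product PP.integrable_product) auto
    show "AE p in (P \<Otimes>\<^sub>M P) \<Otimes>\<^sub>M M. norm (H p)
       \<le> norm (case p of (p, y) \<Rightarrow> (case p of (\<xi>, \<eta>) \<Rightarrow> F \<xi> * cnj (F \<eta>)) * of_real (B\<^sup>2 * w y))"
    proof (intro AE_I2)
      fix p :: "('b \<times> 'b) \<times> 'a"
      obtain \<xi> \<eta> y where p: "p = ((\<xi>, \<eta>), y)" by (metis surj_pair)
      have "cmod (A y \<xi>) * cmod (A y \<eta>) \<le> \<bar>B\<bar> * \<bar>B\<bar>"
        by (intro mult_mono order_trans[OF B abs_ge_self]) auto
      from mult_left_mono[OF this w(2)[of y]]
      have "w y * (cmod (A y \<xi>) * cmod (A y \<eta>)) \<le> \<bar>B\<bar> * (\<bar>B\<bar> * w y)"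
        by (simp only: mult_ac)
      then show "norm (H p) \<le> norm (case p of (p, y) \<Rightarrow> (case p of (\<xi>, \<eta>) \<Rightarrow> F \<xi> * cnj (F \<eta>)) * of_real (B\<^sup>2 * w y))"
        using w(2)[of y] unfolding p H_def
        by (auto simp: norm_mult power2_eq_square abs_mult mult.assoc mult.left_commute[of _ "\<bar>w y\<bar>"]
             intro!: mult_left_mono)
    qed
  qed measurable
  have Hy: "(LINT p|(P \<Otimes>\<^sub>M P). H (p, y)) = of_real (w y * (cmod (u y))\<^sup>2)" if y: "y \<in> space M" for y
  proof -
    have "(LINT p|(P \<Otimes>\<^sub>M P). H (p, y)) = (LINT p|(P \<Otimes>\<^sub>M P). of_real (w y) *
        (case p of (\<xi>, \<eta>) \<Rightarrow> (A y \<xi> * F \<xi>) * cnj (A y \<eta> * F \<eta>)))"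
      by (intro Bochner_Integration.integral_cong) (auto simp: H_def mult_ac)
    also have "\<dots> = of_real (w y) * (u y * cnj (u y))"
      unfolding integral_mult_right_zero u_def
      by (subst PP.integrable_product(2)) (use Y[OF y] in \<open>simp_all del: complex_cnj_mult\<close>)
    finally show ?thesis by (simp only: complex_norm_square of_real_mult)
  qed
  have int_u: "integrable M (\<lambda>y. w y * (cmod (u y))\<^sup>2)"
  proof -
    have "integrable M (\<lambda>y. LINT p|(P \<Otimes>\<^sub>M P). H (p, y))"
      using Q.integrable_snd[of "\<lambda>p y. H (p, y)"] intH by simp
    then have "integrable M (\<lambda>y. of_real (w y * (cmod (u y))\<^sup>2) :: complex)"
      by (subst (asm) Bochner_Integration.integrable_cong[OF refl Hy]) auto
    from integrable_Re[OF this] show ?thesis by simp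
  qed
  have "(\<integral>\<^sup>+ y. ennreal (w y * (cmod (u y))\<^sup>2) \<partial>M) = ennreal (LINT y|M. w y * (cmod (u y))\<^sup>2)"
    using w(2) by (intro nn_integral_eq_integral int_u) auto
  also have "(LINT y|M. w y * (cmod (u y))\<^sup>2) \<le> cmod (of_real (LINT y|M. w y * (cmod (u y))\<^sup>2))"
    by simp
  also have "complex_of_real (LINT y|M. w y * (cmod (u y))\<^sup>2) = (LINT y|M. (LINT p|(P \<Otimes>\<^sub>M P). H (p, y)))"
    by (simp only: integral_complex_of_real[symmetric]) (intro Bochner_Integration.integral_cong refl Hy[symmetric])
  also have "\<dots> = (LINT p|(P \<Otimes>\<^sub>M P). (LINT y|M. H (p, y)))"
    using Q.Fubini_integral[of "\<lambda>p y. H (p, y)"] intH by simp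
  also have "ennreal (cmod \<dots>) \<le> (\<integral>\<^sup>+ p. ennreal (cmod (LINT y|M. H (p, y))) \<partial>(P \<Otimes>\<^sub>M P))"
    by (intro integral_norm_bound_ennreal Q.integrable_fst' intH)
  also have "\<dots> \<le> (\<integral>\<^sup>+ p. (case p of (\<xi>, \<eta>) \<Rightarrow> ennreal ((cmod (F \<xi>))\<^sup>2 / 2) * ennreal (k \<xi> \<eta>)) +
       (case p of (\<xi>, \<eta>) \<Rightarrow> ennreal ((cmod (F \<eta>))\<^sup>2 / 2) * ennreal (k \<eta> \<xi>)) \<partial>(P \<Otimes>\<^sub>M P))"
  proof (intro nn_integral_mono)
    fix p :: "'b \<times> 'b"
    obtain \<xi> \<eta> where p: "p = (\<xi>, \<eta>)" by (cases p)
    have "cmod (LINT y|M. H (p, y)) = cmod (F \<xi>) * cmod (F \<eta>) * cmod (LINT y|M. of_real (w y) * A y \<xi> * cnj (A y \<eta>))"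
      by (simp add: H_def p norm_mult)
    \<comment> \<open>The kernel bound is assumed only where \<open>F\<close> does not vanish, so
      that a cutoff of \<open>F\<close> localizes the kernel; elsewhere both sides are 0.\<close>
    also have "\<dots> \<le> cmod (F \<xi>) * cmod (F \<eta>) * k \<xi> \<eta>"
    proof (cases "F \<xi> = 0 \<or> F \<eta> = 0")
      case False
      then show ?thesis by (intro mult_left_mono K) auto
    qed auto
    \<comment> \<open>The inequality \<open>2 * s * t \<le> s^2 + t^2\<close> separates the two
      frequencies; by symmetry of \<open>k\<close> each half contributes at most
      \<open>b / 2\<close> times the squared norm.\<close>
    also have "\<dots> \<le> ((cmod (F \<xi>))\<^sup>2 / 2 + (cmod (F \<eta>))\<^sup>2 / 2) * k \<xi> \<eta>"
      using k_nonneg sum_squares_bound[of "cmod (F \<xi>)" "cmod (F \<eta>)"] by (intro mult_right_mono) auto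
    finally show "ennreal (cmod (LINT y|M. H (p, y))) \<le>
      (case p of (\<xi>, \<eta>) \<Rightarrow> ennreal ((cmod (F \<xi>))\<^sup>2 / 2) * ennreal (k \<xi> \<eta>)) +
       (case p of (\<xi>, \<eta>) \<Rightarrow> ennreal ((cmod (F \<eta>))\<^sup>2 / 2) * ennreal (k \<eta> \<xi>))"
      using k_nonneg k_sym[of \<eta> \<xi>]
      by (simp add: p ennreal_mult[symmetric] ennreal_plus[symmetric] distrib_right ennreal_leI del: ennreal_plus)
  qed
  also have "\<dots> = (\<integral>\<^sup>+ p. (case p of (\<xi>, \<eta>) \<Rightarrow> ennreal ((cmod (F \<xi>))\<^sup>2 / 2) * ennreal (k \<xi> \<eta>)) \<partial>(P \<Otimes>\<^sub>M P)) +
      (\<integral>\<^sup>+ p. (case p of (\<xi>, \<eta>) \<Rightarrow> ennreal ((cmod (F \<eta>))\<^sup>2 / 2) * ennreal (k \<eta> \<xi>)) \<partial>(P \<Otimes>\<^sub>M P))"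
  proof (rule nn_integral_add)
    have [measurable]: "(\<lambda>p. k (snd p) (fst p)) \<in> borel_measurable (P \<Otimes>\<^sub>M P)"
      using k unfolding k_sym[of "snd _"] by (simp add: case_prod_beta')
    show "(\<lambda>p. case p of (\<xi>, \<eta>) \<Rightarrow> ennreal ((cmod (F \<eta>))\<^sup>2 / 2) * ennreal (k \<eta> \<xi>)) \<in> borel_measurable (P \<Otimes>\<^sub>M P)"
      unfolding case_prod_beta by measurable
  qed measurable
  also have "(\<integral>\<^sup>+ p. (case p of (\<xi>, \<eta>) \<Rightarrow> ennreal ((cmod (F \<eta>))\<^sup>2 / 2) * ennreal (k \<eta> \<xi>)) \<partial>(P \<Otimes>\<^sub>M P)) =
     (\<integral>\<^sup>+ p. (case p of (\<xi>, \<eta>) \<Rightarrow> ennreal ((cmod (F \<xi>))\<^sup>2 / 2) * ennreal (k \<xi> \<eta>)) \<partial>(P \<Otimes>\<^sub>M P))"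
    by (subst (2) PP.distr_pair_swap) (simp add: nn_integral_distr case_prod_beta')
  also have "(\<integral>\<^sup>+ p. (case p of (\<xi>, \<eta>) \<Rightarrow> ennreal ((cmod (F \<xi>))\<^sup>2 / 2) * ennreal (k \<xi> \<eta>)) \<partial>(P \<Otimes>\<^sub>M P)) =
     (\<integral>\<^sup>+ \<xi>. ennreal ((cmod (F \<xi>))\<^sup>2 / 2) * (\<integral>\<^sup>+ \<eta>. ennreal (k \<xi> \<eta>) \<partial>P) \<partial>P)"
    by (subst P.nn_integral_fst[symmetric]) (auto intro!: nn_integral_cong nn_integral_cmult)
  also have "\<dots> \<le> (\<integral>\<^sup>+ \<xi>. ennreal ((cmod (F \<xi>))\<^sup>2 / 2) * ennreal b \<partial>P)"
    by (intro nn_integral_mono mult_left_mono k_int) auto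
  also have "\<dots> = ennreal ((LINT \<xi>|P. (cmod (F \<xi>))\<^sup>2 / 2 * b))"
    using F(2) \<open>0 \<le> b\<close> by (subst nn_integral_eq_integral[symmetric]) (auto simp: ennreal_mult[symmetric])
  also have "\<dots> + \<dots> = ennreal (b * (LINT \<xi>|P. (cmod (F \<xi>))\<^sup>2))"
    using \<open>0 \<le> b\<close> by (subst ennreal_plus[symmetric]) (auto simp: mult.commute)
  finally show ?thesis
    by (simp add: u_def ennreal_leI add_mono)
qed

section \<open>Nondegenerate phases\<close>

text \<open>Monotonicity in the bound lets a maximum serve. This merges the constants for different
  coordinate directions and orders of differentiation.\<close>

lemma finite_uniform_bound:
  fixes P :: "'i \<Rightarrow> real \<Rightarrow> bool"
  assumes "finite I" "\<And>i. i \<in> I \<Longrightarrow> \<exists>C. P i C" "\<And>i C D. P i C \<Longrightarrow> C \<le> D \<Longrightarrow> P i D"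
  shows "\<exists>C\<ge>0. \<forall>i\<in>I. P i C"
  using assms(1,2)
proof (induction I rule: finite_induct)
  case (insert i I)
  then obtain C D where CD: "0 \<le> C" "\<forall>i\<in>I. P i C" "P i D" by blast
  show ?case
  proof (intro exI[of _ "max C D"] conjI ballI)
    show "P j (max C D)" if "j \<in> insert i I" for j
      using that CD assms(3)[of j C "max C D"] assms(3)[of i D "max C D"] by auto
  qed (use CD in auto)
qed auto

lemma smooth_bounded_cball:
  fixes f :: "'a::euclidean_space \<Rightarrow> real"
  assumes "smooth f"
  shows "\<exists>C. \<forall>p\<in>cball 0 R. \<bar>f p\<bar> \<le> C"
proof -
  have "compact (f ` cball 0 R)"
    by (intro compact_continuous_image smooth_continuous_on[OF assms]) auto
  then show ?thesis
    by (auto dest!: compact_imp_bounded simp: bounded_iff)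
qed

lemma dd_snd_sum:
  fixes f :: "'a::euclidean_space \<times> 'b::euclidean_space \<Rightarrow> real"
  assumes "smooth f"
  shows "dd (0, d) f p = (\<Sum>b\<in>Basis. (d \<bullet> b) * dd (0, b) f p)"
proof -
  have "(0, d) = (\<Sum>b\<in>Basis. (d \<bullet> b) *\<^sub>R (0 :: 'a, b))"
    by (simp add: prod_eq_iff fst_sum snd_sum euclidean_representation)
  then have "dd (0, d) f p = dd (\<Sum>b\<in>Basis. (d \<bullet> b) *\<^sub>R (0, b)) f p" by simp
  also have "\<dots> = (\<Sum>b\<in>Basis. dd ((d \<bullet> b) *\<^sub>R (0, b)) f p)"
    by (rule linear_sum[OF smooth_dd_linear[OF assms]])
  also have "\<dots> = (\<Sum>b\<in>Basis. (d \<bullet> b) * dd (0, b) f p)"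
    by (intro sum.cong refl) (simp only: linear_cmul[OF smooth_dd_linear[OF assms]] real_scaleR_def)
  finally show ?thesis .
qed

text \<open>Mean value theorem on the segment from \<open>\<eta>\<close> to \<open>\<xi>\<close>.
  The intermediate point serves all coordinates at once but may depend on \<open>y\<close>.\<close>

lemma smooth_snd_increment:
  fixes f :: "'a::euclidean_space \<times> 'b::euclidean_space \<Rightarrow> real"
  assumes "smooth f" "convex S" "\<xi> \<in> S" "\<eta> \<in> S"
  shows "\<exists>\<zeta>\<in>S. f (y, \<xi>) - f (y, \<eta>) = (\<Sum>b\<in>Basis. ((\<xi> - \<eta>) \<bullet> b) * dd (0, b) f (y, \<zeta>))"
proof -
  obtain t where t: "t \<in> {0<..<1}" "f ((y, \<eta>) + (0, \<xi> - \<eta>)) - f (y, \<eta>) = dd (0, \<xi> - \<eta>) f ((y, \<eta>) + t *\<^sub>R (0, \<xi> - \<eta>))"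
    using smooth_mvt[OF assms(1)] by blast
  have "(1 - t) *\<^sub>R \<eta> + t *\<^sub>R \<xi> \<in> S"
    using assms t by (intro convexD) auto
  moreover have "(1 - t) *\<^sub>R \<eta> + t *\<^sub>R \<xi> = \<eta> + t *\<^sub>R (\<xi> - \<eta>)"
    by (simp add: algebra_simps)
  ultimately show ?thesis
    using t(2) dd_snd_sum[OF assms(1), of "\<xi> - \<eta>" "(y, \<eta> + t *\<^sub>R (\<xi> - \<eta>))"]
    by (intro bexI[of _ "\<eta> + t *\<^sub>R (\<xi> - \<eta>)"]) simp_all
qed

lemma sum_Basis_le_norm:
  fixes d :: "'b::euclidean_space"
  assumes "\<And>b. b \<in> Basis \<Longrightarrow> \<bar>c b\<bar> \<le> C"
  shows "\<bar>\<Sum>b\<in>Basis. (d \<bullet> b) * c b\<bar> \<le> real DIM('b) * C * norm d"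
proof -
  have "\<bar>\<Sum>b\<in>Basis. (d \<bullet> b) * c b\<bar> \<le> (\<Sum>b\<in>(Basis :: 'b set). norm d * C)"
    using assms by (intro order_trans[OF sum_abs] sum_mono) (auto simp: abs_mult intro!: mult_mono Basis_le_norm)
  then show ?thesis by (simp add: mult_ac)
qed

text \<open>The factor \<open>norm (\<xi> - \<eta>)\<close> keeps difference quotients of phase
  derivatives bounded up to the diagonal.\<close>

lemma smooth_snd_lipschitz:
  fixes f :: "'a::euclidean_space \<times> 'b::euclidean_space \<Rightarrow> real"
  assumes "smooth f"
  shows "\<exists>C. \<forall>y\<in>cball 0 R. \<forall>\<xi>\<in>cball 0 R. \<forall>\<eta>\<in>cball 0 R. \<bar>f (y, \<xi>) - f (y, \<eta>)\<bar> \<le> C * norm (\<xi> - \<eta>)"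
proof -
  \<comment> \<open>A pair of points of norm at most \<open>R\<close> has norm at most
    \<open>2 * R\<close>.\<close>
  have "\<exists>C\<ge>0. \<forall>b\<in>Basis. \<forall>p\<in>cball 0 (2 * R). \<bar>dd (0, b :: 'b) f p\<bar> \<le> C"
  proof (rule finite_uniform_bound)
    show "\<exists>C. \<forall>p\<in>cball 0 (2 * R). \<bar>dd (0, b) f p\<bar> \<le> C" for b :: 'b
      by (intro smooth_bounded_cball smooth_dd assms)
    show "\<forall>p\<in>cball 0 (2 * R). \<bar>dd (0, b) f p\<bar> \<le> D"
      if "\<forall>p\<in>cball 0 (2 * R). \<bar>dd (0, b) f p\<bar> \<le> C" "C \<le> D" for b :: 'b and C D
      using that by fastforce
  qed auto
  then obtain C where C: "\<And>b p. b \<in> Basis \<Longrightarrow> p \<in> cball 0 (2 * R) \<Longrightarrow> \<bar>dd (0, b :: 'b) f p\<bar> \<le> C" by blast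
  have "\<bar>f (y, \<xi>) - f (y, \<eta>)\<bar> \<le> real DIM('b) * C * norm (\<xi> - \<eta>)"
    if y: "y \<in> cball 0 R" and \<xi>\<eta>: "\<xi> \<in> cball 0 R" "\<eta> \<in> cball 0 R" for y \<xi> \<eta>
  proof -
    obtain \<zeta> where \<zeta>: "\<zeta> \<in> cball 0 R" "f (y, \<xi>) - f (y, \<eta>) = (\<Sum>b\<in>Basis. ((\<xi> - \<eta>) \<bullet> b) * dd (0, b) f (y, \<zeta>))"
      using smooth_snd_increment[OF assms convex_cball \<xi>\<eta>] by blast
    have "norm (y, \<zeta>) \<le> 2 * R"
      using norm_Pair_le[of y \<zeta>] y \<zeta>(1) by auto
    then show ?thesis
      unfolding \<zeta>(2) by (intro sum_Basis_le_norm C) auto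
  qed
  then show ?thesis by blast
qed

text \<open>Compactness makes nondegeneracy quantitative. The order of quantifiers matters:
  \<open>e\<close> is chosen from \<open>\<xi>\<close> and \<open>\<eta>\<close> and then serves all
  \<open>y\<close> near \<open>y1\<close>, so that one direction can be used throughout the repeated
  integration by parts.\<close>

lemma nondegenerate_phase_lower_bound:
  fixes \<Psi> :: "'a::euclidean_space \<times> 'b::euclidean_space \<Rightarrow> real"
  assumes \<Psi>: "smooth \<Psi>" and K: "compact K"
    and nondeg: "\<And>p d. p \<in> K \<Longrightarrow> d \<noteq> 0 \<Longrightarrow> \<exists>e\<in>Basis. dd (0, d) (dd (e, 0) \<Psi>) p \<noteq> 0"
  shows "\<exists>\<delta>>0. \<exists>c>0. \<forall>y1 \<xi>1 \<xi> \<eta>. (y1, \<xi>1) \<in> K \<longrightarrow> dist \<xi> \<xi>1 < \<delta> \<longrightarrow> dist \<eta> \<xi>1 < \<delta> \<longrightarrow>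
    (\<exists>e\<in>Basis. \<forall>y. dist y y1 < \<delta> \<longrightarrow> c * norm (\<xi> - \<eta>) \<le> \<bar>dd (e, 0) \<Psi> (y, \<xi>) - dd (e, 0) \<Psi> (y, \<eta>)\<bar>)"
proof (cases "K = {}")
  case True
  then show ?thesis by (intro exI[of _ 1] conjI) auto
next
  case False
  define H where "H e b = dd (0, b) (dd (e, 0) \<Psi>)" for e b
  have H: "smooth (H e b)" for e b
    by (simp add: H_def smooth_dd \<Psi>)
  \<comment> \<open>The l1 norm of the mixed Hessian at \<open>p\<close> applied to
    \<open>d\<close>; nondegeneracy makes it positive on the unit sphere, in particular at its
    minimum.\<close>
  define m where "m = (\<lambda>(p, d). \<Sum>e\<in>Basis. \<bar>\<Sum>b\<in>Basis. (d \<bullet> b) * H e b p\<bar>)"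
  have "continuous_on (K \<times> sphere 0 1) m"
    unfolding m_def case_prod_beta
    by (intro continuous_intros continuous_on_compose2[OF smooth_continuous_on[OF H, of UNIV]]) auto
  moreover have "compact (K \<times> sphere (0::'b) 1)" "K \<times> sphere (0::'b) 1 \<noteq> {}"
    using K False by (auto intro!: compact_Times)
  ultimately obtain x where "x \<in> K \<times> sphere 0 1" "\<forall>y\<in>K \<times> sphere 0 1. m x \<le> m y"
    using continuous_attains_inf[of "K \<times> sphere 0 1" m] by blast
  then obtain p0 d0 where p0: "(p0, d0) \<in> K \<times> sphere 0 1"
    and min: "\<And>p d. (p, d) \<in> K \<times> sphere 0 1 \<Longrightarrow> m (p0, d0) \<le> m (p, d)"
    by (cases x) blast
  define c0 where "c0 = m (p0, d0)"
  have "d0 \<noteq> 0" "p0 \<in> K" using p0 by auto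
  then obtain e0 where e0: "e0 \<in> Basis" "dd (0, d0) (dd (e0, 0) \<Psi>) p0 \<noteq> 0"
    using nondeg by blast
  then have "0 < \<bar>\<Sum>b\<in>Basis. (d0 \<bullet> b) * H e0 b p0\<bar>"
    using dd_snd_sum[OF smooth_dd[OF \<Psi>], of d0 "(e0, 0)" p0] by (simp add: H_def)
  also have "\<dots> \<le> c0"
    unfolding c0_def m_def prod.case using e0(1)
    by (intro member_le_sum[of e0 Basis "\<lambda>e. \<bar>\<Sum>b\<in>Basis. (d0 \<bullet> b) * H e b p0\<bar>"]) auto
  finally have "0 < c0" .
  \<comment> \<open>By pigeonhole, one of the \<open>DIM('a)\<close> terms of \<open>m\<close> is at
    least the average.\<close>
  define c1 where "c1 = c0 / real DIM('a)"
  have "0 < c1" using \<open>0 < c0\<close> by (simp add: c1_def)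
  have lower: "\<exists>e\<in>Basis. c1 * norm d \<le> \<bar>\<Sum>b\<in>Basis. (d \<bullet> b) * H e b p\<bar>" if "p \<in> K" for p d
  proof (cases "d = 0")
    case True
    then show ?thesis using nonempty_Basis by (auto simp: ex_in_conv)
  next
    case False
    show ?thesis
    proof (rule ccontr)
      assume contra: "\<not> ?thesis"
      have *: "\<bar>\<Sum>b\<in>Basis. (d \<bullet> b) * H e b p\<bar> < c1 * norm d" if "e \<in> Basis" for e
        by (rule ccontr) (use contra that in \<open>auto simp: not_less\<close>)
      have "c0 \<le> m (p, d /\<^sub>R norm d)"
        unfolding c0_def using that False by (intro min) auto
      also have "\<dots> = (\<Sum>e\<in>Basis. \<bar>\<Sum>b\<in>Basis. (d \<bullet> b) * H e b p\<bar>) / norm d"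
      proof -
        have eq: "(\<Sum>b\<in>Basis. ((d /\<^sub>R norm d) \<bullet> b) * H e b p) = (\<Sum>b\<in>Basis. (d \<bullet> b) * H e b p) / norm d" for e
          by (simp add: sum_distrib_left divide_inverse mult_ac)
        show ?thesis
          unfolding m_def prod.case
          by (simp only: eq abs_divide abs_norm_cancel sum_divide_distrib[symmetric])
      qed
      also have "\<dots> < (\<Sum>e\<in>(Basis :: 'a set). c1 * norm d) / norm d"
        using False by (intro divide_strict_right_mono sum_strict_mono[OF finite_Basis nonempty_Basis *]) auto
      also have "\<dots> = c0" using False by (simp add: c1_def)
      finally show False by simp
    qed
  qed
  \<comment> \<open>Perturbing each of the \<open>DIM('b)\<close> Hessian entries in the row of
    \<open>e\<close> by at most \<open>\<epsilon>\<close> costs at most half of the lower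
    bound.\<close>
  define \<epsilon> where "\<epsilon> = c1 / (2 * real DIM('b))"
  have "0 < \<epsilon>" using \<open>0 < c1\<close> by (simp add: \<epsilon>_def)
  obtain R where R: "K \<subseteq> cball 0 R"
    using compact_imp_bounded[OF K] by (auto simp: bounded_iff subset_iff)
  \<comment> \<open>Phrased as an eventuality so that finitely many moduli of uniform continuity
    combine into one \<open>\<delta>\<close>.\<close>
  have "\<forall>\<^sub>F \<delta> in at_right 0. \<forall>e\<in>Basis. \<forall>b\<in>Basis. \<forall>p\<in>cball 0 (R + 1). \<forall>q\<in>cball 0 (R + 1).
    dist q p < \<delta> \<longrightarrow> \<bar>H e b q - H e b p\<bar> \<le> \<epsilon>"
  proof (simp only: eventually_ball_finite_distrib[OF finite_Basis], intro ballI)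
    fix e :: 'a and b :: 'b
    have "uniformly_continuous_on (cball 0 (R + 1)) (H e b)"
      by (intro compact_uniformly_continuous smooth_continuous_on H) auto
    then obtain \<delta> where "\<delta> > 0" "\<forall>p\<in>cball 0 (R + 1). \<forall>q\<in>cball 0 (R + 1). dist q p < \<delta> \<longrightarrow> \<bar>H e b q - H e b p\<bar> < \<epsilon>"
      using \<open>0 < \<epsilon>\<close> unfolding uniformly_continuous_on_def dist_real_def by metis
    then show "\<forall>\<^sub>F \<delta> in at_right 0. \<forall>p\<in>cball 0 (R + 1). \<forall>q\<in>cball 0 (R + 1). dist q p < \<delta> \<longrightarrow> \<bar>H e b q - H e b p\<bar> \<le> \<epsilon>"
      unfolding eventually_at_right_field by (intro exI[of _ \<delta>]) (force intro: less_imp_le)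
  qed
  moreover have "\<forall>\<^sub>F \<delta> in at_right (0::real). 0 < \<delta> \<and> \<delta> < 1"
    unfolding eventually_at_right_field by (intro exI[of _ 1]) auto
  ultimately have "\<forall>\<^sub>F \<delta> in at_right 0. (0 < \<delta> \<and> \<delta> < 1) \<and> (\<forall>e\<in>Basis. \<forall>b\<in>Basis. \<forall>p\<in>cball 0 (R + 1). \<forall>q\<in>cball 0 (R + 1).
    dist q p < \<delta> \<longrightarrow> \<bar>H e b q - H e b p\<bar> \<le> \<epsilon>)"
    by (rule eventually_conj[rotated])
  then obtain \<delta> where \<delta>: "0 < \<delta>" "\<delta> < 1" and close: "\<And>e b p q. e \<in> Basis \<Longrightarrow> b \<in> Basis \<Longrightarrow> p \<in> cball 0 (R + 1) \<Longrightarrow> q \<in> cball 0 (R + 1) \<Longrightarrow>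
     dist q p < \<delta> \<Longrightarrow> \<bar>H e b q - H e b p\<bar> \<le> \<epsilon>"
    using eventually_happens'[OF trivial_limit_at_right_real] by blast
  show ?thesis
  \<comment> \<open>Halving keeps the pair \<open>(y, \<zeta>)\<close> within
    \<open>\<delta>\<close> of \<open>(y1, \<xi>1)\<close>.\<close>
  proof (rule exI[of _ "\<delta> / 2"], intro exI[of _ "c1 / 2"] conjI allI impI)
    show "0 < \<delta> / 2" "0 < c1 / 2" using \<delta> \<open>0 < c1\<close> by auto
    fix y1 \<xi>1 \<xi> \<eta> assume p: "(y1, \<xi>1) \<in> K" and \<xi>\<eta>: "dist \<xi> \<xi>1 < \<delta> / 2" "dist \<eta> \<xi>1 < \<delta> / 2"
    obtain e where e: "e \<in> Basis" "c1 * norm (\<xi> - \<eta>) \<le> \<bar>\<Sum>b\<in>Basis. ((\<xi> - \<eta>) \<bullet> b) * H e b (y1, \<xi>1)\<bar>"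
      using lower[OF p] by blast
    have "c1 / 2 * norm (\<xi> - \<eta>) \<le> \<bar>dd (e, 0) \<Psi> (y, \<xi>) - dd (e, 0) \<Psi> (y, \<eta>)\<bar>" if y: "dist y y1 < \<delta> / 2" for y
    proof -
      have "\<xi> \<in> ball \<xi>1 (\<delta> / 2)" "\<eta> \<in> ball \<xi>1 (\<delta> / 2)"
        using \<xi>\<eta> by (simp_all add: dist_commute)
      note increment = smooth_snd_increment[OF smooth_dd[OF \<Psi>] convex_ball this, of "(e, 0)" y]
      obtain \<zeta> where \<zeta>: "\<zeta> \<in> ball \<xi>1 (\<delta> / 2)" "dd (e, 0) \<Psi> (y, \<xi>) - dd (e, 0) \<Psi> (y, \<eta>) = (\<Sum>b\<in>Basis. ((\<xi> - \<eta>) \<bullet> b) * H e b (y, \<zeta>))"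
        using increment unfolding H_def by blast
      have "dist (y, \<zeta>) (y1, \<xi>1) \<le> dist y y1 + dist \<zeta> \<xi>1"
        unfolding dist_Pair_Pair using real_sqrt_sum_squares_triangle_ineq[of "dist y y1" 0 0 "dist \<zeta> \<xi>1"] by simp
      also have "\<dots> < \<delta>" using y \<zeta>(1) by (simp add: dist_commute)
      finally have d: "dist (y, \<zeta>) (y1, \<xi>1) < \<delta>" .
      have 1: "(y1, \<xi>1) \<in> cball 0 R" using R p by auto
      then have "(y, \<zeta>) \<in> cball 0 (R + 1)"
        using d \<delta>(2) dist_triangle[of 0 "(y, \<zeta>)" "(y1, \<xi>1)"] by (simp only: mem_cball dist_commute[of 0])  
           (smt (verit) dist_commute)
      then have "\<bar>\<Sum>b\<in>Basis. ((\<xi> - \<eta>) \<bullet> b) * (H e b (y, \<zeta>) - H e b (y1, \<xi>1))\<bar> \<le> real DIM('b) * \<epsilon> * norm (\<xi> - \<eta>)"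
        using 1 by (intro sum_Basis_le_norm close e(1) d) auto
      then have diff: "\<bar>(\<Sum>b\<in>Basis. ((\<xi> - \<eta>) \<bullet> b) * H e b (y, \<zeta>)) - (\<Sum>b\<in>Basis. ((\<xi> - \<eta>) \<bullet> b) * H e b (y1, \<xi>1))\<bar>
         \<le> c1 * norm (\<xi> - \<eta>) / 2"
        by (simp add: right_diff_distrib sum_subtractf \<epsilon>_def)
      have "A / 2 \<le> \<bar>X\<bar>" if "A \<le> \<bar>B\<bar>" "\<bar>X - B\<bar> \<le> A / 2" for A B X :: real
        using that by linarith
      from this[OF e(2) diff] show ?thesis
        unfolding \<zeta>(2) by simp
    qed
    then show "\<exists>e\<in>Basis. \<forall>y. dist y y1 < \<delta> / 2 \<longrightarrow> c1 / 2 * norm (\<xi> - \<eta>) \<le> \<bar>dd (e, 0) \<Psi> (y, \<xi>) - dd (e, 0) \<Psi> (y, \<eta>)\<bar>"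
      using e(1) by blast
  qed
qed

lemma dd_zero_off_support:
  fixes f :: "'a::euclidean_space \<Rightarrow> complex"
  assumes "smooth f" "closed K" "\<And>p. p \<notin> K \<Longrightarrow> f p = 0" "p \<notin> K"
  shows "dd v f p = 0"
  using dd_zero_off_closed[OF assms(2-4), where e = v and D = "dd v f p"] smooth_line_derivative[OF assms(1), of p v 0] by simp

text \<open>All iterated derivatives vanish off \<open>K\<close>, so bounds over \<open>K\<close>
  hold everywhere, in both variables at once; hence the uniformity in \<open>\<xi>\<close>.\<close>

lemma bounded_dd_compact_support:
  fixes a :: "'a::euclidean_space \<times> 'b::euclidean_space \<Rightarrow> complex"
  assumes a: "smooth a" and K: "compact K" "\<And>p. p \<notin> K \<Longrightarrow> a p = 0"
  shows "\<exists>C\<ge>0. \<forall>e\<in>Basis. \<forall>\<xi>. bounded_dd e UNIV k C (\<lambda>y. a (y, \<xi>))"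
proof -
  have zero: "(dd v ^^ i) a p = 0" if "p \<notin> K" for v i p
    using that
  proof (induction i arbitrary: p)
    case (Suc i)
    then show ?case
      using dd_zero_off_support[OF smooth_funpow_dd[OF a] compact_imp_closed[OF K(1)]] by simp
  qed (use K in simp)
  have "\<exists>C\<ge>0. \<forall>x\<in>Basis \<times> {..k}. \<forall>p. cmod ((dd (fst x, 0) ^^ snd x) a p) \<le> C"
  proof (rule finite_uniform_bound)
    show "\<forall>p. cmod ((dd (fst x, 0) ^^ snd x) a p) \<le> D"
      if "\<forall>p. cmod ((dd (fst x, 0) ^^ snd x) a p) \<le> C" "C \<le> D" for x C D
      using that by (meson order_trans)
    fix x :: "'a \<times> nat"
    obtain e i where x: "x = (e, i)" by (cases x)
    have "compact ((dd (e, 0) ^^ i) a ` K)"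
      by (intro compact_continuous_image smooth_continuous_on smooth_funpow_dd a K)
    then have "bounded ((dd (e, 0) ^^ i) a ` K)"
      by (rule compact_imp_bounded)
    then obtain C where C: "\<forall>p\<in>K. cmod ((dd (e, 0) ^^ i) a p) \<le> C"
      unfolding bounded_iff by blast
    have "cmod ((dd (e, 0) ^^ i) a p) \<le> max C 0" for p
      using C zero by (cases "p \<in> K") (auto intro: max.coboundedI1)
    then show "\<exists>C. \<forall>p. cmod ((dd (fst x, 0) ^^ snd x) a p) \<le> C"
      unfolding x by auto
  qed auto
  then obtain C where C: "0 \<le> C" "\<And>e i p. e \<in> Basis \<Longrightarrow> i \<le> k \<Longrightarrow> cmod ((dd (e, 0) ^^ i) a p) \<le> C"
    by auto
  have "bounded_dd e UNIV k C (\<lambda>y. (dd (e, 0) ^^ 0) a (y, \<xi>))" if "e \<in> Basis" for e \<xi>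
  proof (rule bounded_dd_sequence[where F = "\<lambda>i y. (dd (e, 0) ^^ i) a (y, \<xi>)"])
    show "((\<lambda>t. (dd (e, 0) ^^ i) a (y + t *\<^sub>R e, \<xi>)) has_vector_derivative (dd (e, 0) ^^ Suc i) a (y, \<xi>)) (at 0)" for i y
      using smooth_line_derivative[OF smooth_funpow_dd[OF a, of i "(e, 0)"], of "(y, \<xi>)" "(e, 0)" 0] by simp
  qed (use C that in auto)
  with C(1) show ?thesis by auto
qed

section \<open>An integrable majorant for the kernel\<close>

lemma nn_integral_inverse_1_plus_square:
  "(\<integral>\<^sup>+ t. ennreal (inverse (1 + t\<^sup>2)) \<partial>lborel) \<le> ennreal pi"
proof -
  let ?f = "\<lambda>t::real. inverse (1 + t\<^sup>2)"
  have half: "(\<integral>\<^sup>+ t. ennreal (?f t) * indicator {0..} t \<partial>lborel) = ennreal (pi / 2)"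
  proof -
    have "(\<integral>\<^sup>+ t. ennreal (?f t) * indicator {0..} t \<partial>lborel) = ennreal (pi / 2 - arctan 0)"
      by (rule nn_integral_FTC_atLeast) (auto intro!: tendsto_arctan_at_top DERIV_arctan)
    then show ?thesis by simp
  qed
  have "(\<integral>\<^sup>+ t. ennreal (?f t) * indicator {..0} t \<partial>lborel) =
     (\<integral>\<^sup>+ t. ennreal (?f t) * indicator {0..} t \<partial>lborel)"
    by (subst nn_integral_real_affine[where c = "-1" and t = 0]) (auto simp: indicator_def intro!: nn_integral_cong)
  with half have other: "(\<integral>\<^sup>+ t. ennreal (?f t) * indicator {..0} t \<partial>lborel) = ennreal (pi / 2)" by simp
  have "(\<integral>\<^sup>+ t. ennreal (?f t) \<partial>lborel) \<le>
     (\<integral>\<^sup>+ t. ennreal (?f t) * indicator {0..} t + ennreal (?f t) * indicator {..0} t \<partial>lborel)"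
    by (intro nn_integral_mono) (auto simp: indicator_def)
  also have "\<dots> = ennreal (pi / 2) + ennreal (pi / 2)"
    by (subst nn_integral_add) (auto simp: half other)
  also have "\<dots> = ennreal pi" by (subst ennreal_plus[symmetric]) auto
  finally show ?thesis .
qed

lemma prod_mono_ennreal:
  fixes f g :: "'i \<Rightarrow> ennreal"
  shows "(\<And>i. i \<in> I \<Longrightarrow> f i \<le> g i) \<Longrightarrow> prod f I \<le> prod g I"
proof (induction I rule: infinite_finite_induct)
  case (insert i I)
  then show ?case by (simp add: mult_mono)
qed auto

text \<open>The majorant factorizes over the coordinates; translating and rescaling by
  \<open>lam\<close> turns every factor into \<open>1 / (1 + t^2)\<close>.\<close>

lemma nn_integral_product_kernel:
  fixes \<xi> :: "'b::euclidean_space"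
  assumes "0 < lam" "0 \<le> C"
  shows "(\<integral>\<^sup>+ \<eta>. ennreal (C * (\<Prod>b\<in>Basis. inverse (1 + (lam * ((\<xi> - \<eta>) \<bullet> b))\<^sup>2))) \<partial>lborel)
    \<le> ennreal (C * (pi / lam) ^ DIM('b))"
proof -
  have 1: "(\<integral>\<^sup>+ t. ennreal (inverse (1 + (lam * (s - t))\<^sup>2)) \<partial>lborel) \<le> ennreal (pi / lam)" for s
  proof -
    have "(\<integral>\<^sup>+ t. ennreal (inverse (1 + (lam * (s - t))\<^sup>2)) \<partial>lborel) =
       ennreal (1 / lam) * (\<integral>\<^sup>+ t. ennreal (inverse (1 + t\<^sup>2)) \<partial>lborel)"
      using assms(1) by (subst nn_integral_real_affine[where c = "-1 / lam" and t = s]) auto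
    also have "\<dots> \<le> ennreal (1 / lam) * ennreal pi"
      by (intro mult_left_mono nn_integral_inverse_1_plus_square) auto
    also have "\<dots> = ennreal (pi / lam)"
      using assms(1) by (simp add: ennreal_mult[symmetric])
    finally show ?thesis .
  qed
  have "(\<integral>\<^sup>+ \<eta>. ennreal (C * (\<Prod>b\<in>Basis. inverse (1 + (lam * ((\<xi> - \<eta>) \<bullet> b))\<^sup>2))) \<partial>lborel) =
     (\<integral>\<^sup>+ \<eta>. ennreal C * (\<Prod>b\<in>Basis. ennreal (inverse (1 + (lam * (\<xi> \<bullet> b - \<eta> \<bullet> b))\<^sup>2))) \<partial>lborel)"
    using assms(2) by (simp add: ennreal_mult prod_nonneg prod_ennreal inner_diff_left)
  also have "\<dots> = ennreal C * (\<Prod>b\<in>Basis. (\<integral>\<^sup>+ t. ennreal (inverse (1 + (lam * (\<xi> \<bullet> b - t))\<^sup>2)) \<partial>lborel))"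
    by (subst nn_integral_cmult) (auto intro!: arg_cong2[where f = "(*)"] nn_integral_lborel_prod)
  also have "\<dots> \<le> ennreal C * (\<Prod>b\<in>(Basis::'b set). ennreal (pi / lam))"
    by (intro mult_left_mono prod_mono_ennreal 1) auto
  also have "\<dots> = ennreal (C * (pi / lam) ^ DIM('b))"
    using assms by (simp add: ennreal_mult ennreal_power)
  finally show ?thesis .
qed

lemma smooth_measurable: "smooth f \<Longrightarrow> f \<in> borel_measurable borel"
  by (intro borel_measurable_continuous_onI smooth_continuous_on)

text \<open>Merges the trivial bound, good near the diagonal, with the decay away from it. The
  passage to the product uses that each coordinate of \<open>d\<close> is at most
  \<open>norm d\<close> in size.\<close>

lemma min_power_le_product:
  fixes d :: "'b::euclidean_space"
  assumes "0 \<le> C1" "0 \<le> C2" "X = (lam * norm d)\<^sup>2" "0 < lam"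
    and 1: "K \<le> C1" and 2: "d \<noteq> 0 \<Longrightarrow> K \<le> C2 / X ^ DIM('b)"
  shows "K \<le> (C1 + C2) * 2 ^ DIM('b) * (\<Prod>b\<in>Basis. inverse (1 + (lam * (d \<bullet> b))\<^sup>2))"
proof -
  let ?N = "DIM('b)"
  have X: "0 \<le> X" using assms(3) by simp
  have "K \<le> (C1 + C2) * 2 ^ ?N * inverse (1 + X) ^ ?N"
  \<comment> \<open>\<open>1 + X\<close> is at most 2 here and at most \<open>2 * X\<close> in the
    other case; \<open>2 ^ ?N\<close> covers both losses.\<close>
  proof (cases "X \<le> 1")
    case True
    have "1 / 2 \<le> inverse (1 + X)"
      using True X by (simp add: field_simps)
    then have "(1 / 2) ^ ?N \<le> inverse (1 + X) ^ ?N"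
      by (intro power_mono) auto
    then have "(C1 + C2) * 2 ^ ?N * (1 / 2) ^ ?N \<le> (C1 + C2) * 2 ^ ?N * inverse (1 + X) ^ ?N"
      using assms(1,2) by (intro mult_left_mono) auto
    then have "C1 + C2 \<le> (C1 + C2) * 2 ^ ?N * inverse (1 + X) ^ ?N"
      by (simp add: power_one_over)
    then show ?thesis using 1 assms(2) by linarith
  next
    case False
    then have "d \<noteq> 0" using assms(3) by auto
    have "1 / (2 * X) \<le> inverse (1 + X)"
      using False by (simp add: field_simps)
    then have "(1 / (2 * X)) ^ ?N \<le> inverse (1 + X) ^ ?N"
      using X by (intro power_mono) auto
    then have "(C1 + C2) * 2 ^ ?N * (1 / (2 * X)) ^ ?N \<le> (C1 + C2) * 2 ^ ?N * inverse (1 + X) ^ ?N"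
      using assms(1,2) by (intro mult_left_mono) auto
    then have "(C1 + C2) / X ^ ?N \<le> (C1 + C2) * 2 ^ ?N * inverse (1 + X) ^ ?N"
      by (simp add: power_divide power_mult_distrib)
    moreover have "C2 / X ^ ?N \<le> (C1 + C2) / X ^ ?N"
      using assms(1) X by (intro divide_right_mono) auto
    ultimately show ?thesis using 2[OF \<open>d \<noteq> 0\<close>] by linarith
  qed
  also have "\<dots> = (C1 + C2) * 2 ^ ?N * (\<Prod>b\<in>(Basis :: 'b set). inverse (1 + X))" by simp
  also have "\<dots> \<le> (C1 + C2) * 2 ^ ?N * (\<Prod>b\<in>Basis. inverse (1 + (lam * (d \<bullet> b))\<^sup>2))"
  proof (intro mult_left_mono prod_mono conjI)
    fix b :: 'b assume b: "b \<in> Basis"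
    have "\<bar>lam * (d \<bullet> b)\<bar> \<le> lam * norm d"
      using Basis_le_norm[OF b, of d] assms(4) by (simp add: abs_mult)
    then have "(lam * (d \<bullet> b))\<^sup>2 \<le> X"
      unfolding assms(3) by (metis abs_ge_zero power2_abs power_mono)
    then show "inverse (1 + X) \<le> inverse (1 + (lam * (d \<bullet> b))\<^sup>2)"
      by (intro le_imp_inverse_le) (auto intro: add_pos_nonneg)
  qed (use assms(1,2) X in auto)
  finally show ?thesis .
qed

text \<open>\<open>\<rho>\<close> and \<open>C\<close> are chosen before the centres, the
  frequencies and \<open>lam\<close>: the scale of the localization is fixed once and for
  all.\<close>

lemma oscillatory_kernel_bound:
  fixes \<Psi> :: "'a::euclidean_space \<times> 'b::euclidean_space \<Rightarrow> real"
    and a :: "'a \<times> 'b \<Rightarrow> complex"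
  assumes \<Psi>: "smooth \<Psi>" and a: "smooth a" and K: "compact K" "\<And>p. p \<notin> K \<Longrightarrow> a p = 0"
    and nondeg: "\<And>p d. p \<in> K \<Longrightarrow> d \<noteq> 0 \<Longrightarrow> \<exists>e\<in>Basis. dd (0, d) (dd (e, 0) \<Psi>) p \<noteq> 0"
  defines "k \<equiv> 2 * DIM('b)"
  shows "\<exists>\<rho>>0. \<exists>C\<ge>0. \<forall>y0 \<xi>0 \<xi> \<eta> lam. 0 < lam \<longrightarrow> \<xi> \<in> ball \<xi>0 \<rho> \<longrightarrow> \<eta> \<in> ball \<xi>0 \<rho> \<longrightarrow>
    cmod (LINT y|lborel. of_real (bump k \<rho> y0 y) * (exp (\<i> * of_real (lam * \<Psi> (y, \<xi>))) * a (y, \<xi>)) *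
        cnj (exp (\<i> * of_real (lam * \<Psi> (y, \<eta>))) * a (y, \<eta>)))
    \<le> C * (\<Prod>b\<in>Basis. inverse (1 + (lam * ((\<xi> - \<eta>) \<bullet> b))\<^sup>2))"
proof -
  obtain \<delta>' c where "0 < \<delta>'" "0 < c" and lower': "\<And>y1 \<xi>1 \<xi> \<eta>. (y1, \<xi>1) \<in> K \<Longrightarrow> dist \<xi> \<xi>1 < \<delta>' \<Longrightarrow> dist \<eta> \<xi>1 < \<delta>' \<Longrightarrow>
    \<exists>e\<in>Basis. \<forall>y. dist y y1 < \<delta>' \<longrightarrow> c * norm (\<xi> - \<eta>) \<le> \<bar>dd (e, 0) \<Psi> (y, \<xi>) - dd (e, 0) \<Psi> (y, \<eta>)\<bar>"
    using nondegenerate_phase_lower_bound[OF \<Psi> K(1) nondeg] by metis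
  \<comment> \<open>The bound 1 keeps the points near \<open>K\<close> inside balls of radius
    \<open>R + 1\<close>.\<close>
  define \<delta> where "\<delta> = min \<delta>' 1"
  have \<delta>: "0 < \<delta>" "\<delta> \<le> 1" "\<delta> \<le> \<delta>'" using \<open>0 < \<delta>'\<close> by (auto simp: \<delta>_def)
  \<comment> \<open>Two points of a ball of this radius differ by less than
    \<open>2 * \<rho>\<close>, and points of the doubled ball \<open>S\<close> lie within
    \<open>3 * \<rho>\<close> of any point of the ball; both are below
    \<open>\<delta>\<close>.\<close>
  define \<rho> where "\<rho> = \<delta> / 4"
  have "0 < \<rho>" using \<delta> by (simp add: \<rho>_def)
  obtain R where R: "K \<subseteq> cball 0 R"
    using compact_imp_bounded[OF K(1)] by (auto simp: bounded_iff subset_iff)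
  \<comment> \<open>\<open>Suc i\<close>, because order 0 is meant to be the phase derivative in
    direction \<open>e\<close>, not the phase.\<close>
  define F where "F e i y \<xi> = (dd (e, 0) ^^ Suc i) \<Psi> (y, \<xi>)" for e i y \<xi>
  have "\<exists>C2\<ge>0. \<forall>x\<in>Basis \<times> {..k}. \<forall>y\<in>cball 0 (R + 1). \<forall>\<xi>\<in>cball 0 (R + 1). \<forall>\<eta>\<in>cball 0 (R + 1).
      \<bar>F (fst x) (snd x) y \<xi> - F (fst x) (snd x) y \<eta>\<bar> \<le> C2 * norm (\<xi> - \<eta>)"
  proof (rule finite_uniform_bound)
    show "\<exists>C2. \<forall>y\<in>cball 0 (R + 1). \<forall>\<xi>\<in>cball 0 (R + 1). \<forall>\<eta>\<in>cball 0 (R + 1).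
      \<bar>F (fst x) (snd x) y \<xi> - F (fst x) (snd x) y \<eta>\<bar> \<le> C2 * norm (\<xi> - \<eta>)" for x
      unfolding F_def by (intro smooth_snd_lipschitz smooth_funpow_dd \<Psi>)
    show "\<forall>y\<in>cball 0 (R + 1). \<forall>\<xi>\<in>cball 0 (R + 1). \<forall>\<eta>\<in>cball 0 (R + 1).
      \<bar>F (fst x) (snd x) y \<xi> - F (fst x) (snd x) y \<eta>\<bar> \<le> D * norm (\<xi> - \<eta>)"
      if "\<forall>y\<in>cball 0 (R + 1). \<forall>\<xi>\<in>cball 0 (R + 1). \<forall>\<eta>\<in>cball 0 (R + 1).
      \<bar>F (fst x) (snd x) y \<xi> - F (fst x) (snd x) y \<eta>\<bar> \<le> C * norm (\<xi> - \<eta>)" "C \<le> D" for x C D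
      using that by (meson mult_right_mono norm_ge_zero order_trans)
  qed auto
  then obtain C2 where C2: "0 \<le> C2" "\<And>e i y \<xi> \<eta>. e \<in> Basis \<Longrightarrow> i \<le> k \<Longrightarrow> y \<in> cball 0 (R + 1) \<Longrightarrow> \<xi> \<in> cball 0 (R + 1) \<Longrightarrow>
      \<eta> \<in> cball 0 (R + 1) \<Longrightarrow> \<bar>F e i y \<xi> - F e i y \<eta>\<bar> \<le> C2 * norm (\<xi> - \<eta>)"
    by fastforce
  obtain D where D: "0 \<le> D" "\<And>(e::'a) S f. bounded_dd e S k C2 f \<Longrightarrow> \<forall>y\<in>S. c \<le> cmod (f y) \<Longrightarrow>
      bounded_dd e S k D (\<lambda>y. inverse (f y))"
    using bounded_dd_inverse[OF \<open>0 < c\<close> C2(1), of k] by blast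
  obtain Ca where Ca: "0 \<le> Ca" "\<And>e \<xi>. e \<in> Basis \<Longrightarrow> bounded_dd e UNIV k Ca (\<lambda>y. a (y, \<xi>))"
    using bounded_dd_compact_support[OF a K, of k] by blast
  obtain Cb where Cb: "0 \<le> Cb" "\<And>(y0::'a) e. e \<in> Basis \<Longrightarrow> bounded_dd e UNIV k Cb (\<lambda>y. of_real (bump k \<rho> y0 y))"
    using bounded_dd_bump[OF \<open>0 < \<rho>\<close>, of k, where 'a = 'a] by blast
  define C3 where "C3 = 2 ^ k * Cb * (2 ^ k * Ca * Ca)"
  define V where "V = measure lborel (cball (0::'a) \<rho>)"
  have V: "measure lborel (cball y0 \<rho>) = V" for y0 :: 'a
    using \<open>0 < \<rho>\<close> by (simp add: V_def content_cball)
  have "0 \<le> V" by (simp add: V_def)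
  have "0 \<le> C3" using Ca Cb by (simp add: C3_def)
  define C4 where "C4 = (2 ^ k * D) ^ k * C3 * V"
  have "0 \<le> C4" using D(1) \<open>0 \<le> C3\<close> \<open>0 \<le> V\<close> by (simp add: C4_def)
  note [measurable] = smooth_measurable[OF \<Psi>] smooth_measurable[OF a]
  have main: "cmod (LINT y|lborel. of_real (bump k \<rho> y0 y) * (exp (\<i> * of_real (lam * \<Psi> (y, \<xi>))) * a (y, \<xi>)) *
        cnj (exp (\<i> * of_real (lam * \<Psi> (y, \<eta>))) * a (y, \<eta>)))
    \<le> (C3 * V + C4) * 2 ^ DIM('b) * (\<Prod>b\<in>Basis. inverse (1 + (lam * ((\<xi> - \<eta>) \<bullet> b))\<^sup>2))"
    if "0 < lam" and \<xi>\<eta>: "\<xi> \<in> ball \<xi>0 \<rho>" "\<eta> \<in> ball \<xi>0 \<rho>" for y0 \<xi>0 \<xi> \<eta> lam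
  proof -
    define g where "g y = of_real (bump k \<rho> y0 y) * (a (y, \<xi>) * cnj (a (y, \<eta>)))" for y
    define \<phi> where "\<phi> y = \<Psi> (y, \<xi>) - \<Psi> (y, \<eta>)" for y
    have [measurable]: "g \<in> borel_measurable borel" "\<phi> \<in> borel_measurable borel"
      unfolding g_def \<phi>_def by measurable
    have g0: "g y = 0" if "y \<notin> cball y0 \<rho>" for y
      using bump_eq_0[OF \<open>0 < \<rho>\<close> that] by (simp add: g_def)
    have g: "bounded_dd e UNIV k C3 g" if "e \<in> Basis" for e
      unfolding g_def C3_def using that Ca Cb
      by (intro bounded_dd_mult_UNIV bounded_dd_cnj) auto
    let ?I = "LINT y|lborel. exp (\<i> * of_real (lam * \<phi> y)) * g y"
    have eq: "(LINT y|lborel. of_real (bump k \<rho> y0 y) * (exp (\<i> * of_real (lam * \<Psi> (y, \<xi>))) * a (y, \<xi>)) *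
        cnj (exp (\<i> * of_real (lam * \<Psi> (y, \<eta>))) * a (y, \<eta>))) = ?I"
    proof (intro Bochner_Integration.integral_cong refl)
      fix y
      have "exp (\<i> * of_real (lam * \<phi> y)) = exp (\<i> * of_real (lam * \<Psi> (y, \<xi>))) * cnj (exp (\<i> * of_real (lam * \<Psi> (y, \<eta>))))"
        by (simp add: \<phi>_def exp_cnj exp_diff exp_minus divide_inverse right_diff_distrib)
      then show "of_real (bump k \<rho> y0 y) * (exp (\<i> * of_real (lam * \<Psi> (y, \<xi>))) * a (y, \<xi>)) *
        cnj (exp (\<i> * of_real (lam * \<Psi> (y, \<eta>))) * a (y, \<eta>)) = exp (\<i> * of_real (lam * \<phi> y)) * g y"
        by (simp add: g_def mult_ac)
    qed
    obtain e0 :: 'a where e0: "e0 \<in> Basis" using nonempty_Basis by blast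
    have trivial: "cmod ?I \<le> C3 * V"
      unfolding V[of y0, symmetric]
      using bounded_dd_bound[OF g[OF e0]] by (intro norm_integral_bounded_support) (auto simp: g0 norm_mult)
    have decay: "cmod ?I \<le> C4 / ((lam * norm (\<xi> - \<eta>))\<^sup>2) ^ DIM('b)" if "\<xi> - \<eta> \<noteq> 0"
    \<comment> \<open>The lower bound is available only around a point of \<open>K\<close>; if
      \<open>K\<close> has no point over \<open>\<xi>\<close> with position in the ball, the
      amplitude vanishes identically.\<close>
    proof (cases "\<exists>y1\<in>cball y0 \<rho>. (y1, \<xi>) \<in> K")
      case False
      then have "g y = 0" for y
        using g0[of y] K(2)[of "(y, \<xi>)"] by (cases "y \<in> cball y0 \<rho>") (auto simp: g_def)
      then show ?thesis using \<open>0 \<le> C4\<close> by simp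
    next
      case True
      then obtain y1 where y1: "y1 \<in> cball y0 \<rho>" "(y1, \<xi>) \<in> K" by blast
      define r where "r = norm (\<xi> - \<eta>)"
      have "0 < r" using that by (simp add: r_def)
      have "dist \<eta> \<xi> < 2 * \<rho>"
        using \<xi>\<eta> dist_triangle[of \<eta> \<xi> \<xi>0] by (simp add: dist_commute)
      then have dist: "dist \<eta> \<xi> < \<delta>'" "dist \<xi> \<xi> < \<delta>'" "dist \<eta> \<xi> < 1"
        using \<delta> by (auto simp: \<rho>_def)
      obtain e where e: "e \<in> Basis" and
        lower: "\<And>y. dist y y1 < \<delta>' \<Longrightarrow> c * r \<le> \<bar>dd (e, 0) \<Psi> (y, \<xi>) - dd (e, 0) \<Psi> (y, \<eta>)\<bar>"
        using lower'[OF y1(2) dist(2,1)] unfolding r_def by blast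
      define S where "S = ball y0 (2 * \<rho>)"
      have S: "dist y y1 < \<delta>'" "y \<in> cball 0 (R + 1)" if "y \<in> S" for y
      proof -
        have "dist y y1 < 3 * \<rho>"
          using that y1(1) dist_triangle[of y y1 y0] by (auto simp: S_def dist_commute)
        then have *: "dist y y1 < \<delta>" using \<delta>(1) by (simp add: \<rho>_def)
        then show "dist y y1 < \<delta>'" using \<delta> by simp
        have "norm y1 \<le> norm (y1, \<xi>)" by (simp add: norm_Pair)
        also have "\<dots> \<le> R" using R y1(2) by auto
        finally show "y \<in> cball 0 (R + 1)"
          using * \<delta>(2) norm_triangle_sub[of y y1] by (simp add: dist_norm)
      qed
      have "norm \<xi> \<le> norm (y1, \<xi>)" by (simp add: norm_Pair)
      also have "\<dots> \<le> R" using R y1(2) by auto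
      finally have \<xi>R: "\<xi> \<in> cball 0 (R + 1)" and \<eta>R: "\<eta> \<in> cball 0 (R + 1)"
        using dist(3) norm_triangle_sub[of \<eta> \<xi>] by (simp_all add: dist_norm)
      define p where "p y = dd (e, 0) \<Psi> (y, \<xi>) - dd (e, 0) \<Psi> (y, \<eta>)" for y
      \<comment> \<open>Dividing by \<open>r\<close> normalizes the phase derivative: on
        \<open>S\<close>, \<open>C2\<close> bounds it together with its derivatives and
        \<open>c\<close> bounds \<open>G 0\<close> from below, independently of the
        frequencies.\<close>
      define G where "G i y = complex_of_real ((F e i y \<xi> - F e i y \<eta>) / r)" for i y
      define h where "h y = inverse (G 0 y)" for y
      have G0: "G 0 y = of_real (p y / r)" for y
        by (simp add: G_def F_def p_def)
      have "bounded_dd e S k C2 (G 0)"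
      proof (rule bounded_dd_sequence[where F = G])
        show "((\<lambda>t. G i (y + t *\<^sub>R e)) has_vector_derivative G (Suc i) y) (at 0)" for i y
        proof -
          have "((\<lambda>t. F e i (y + t *\<^sub>R e) \<xi>) has_vector_derivative F e (Suc i) y \<xi>) (at 0)" for \<xi>
            using smooth_line_derivative[OF smooth_funpow_dd[OF \<Psi>, of "Suc i" "(e, 0)"], of "(y, \<xi>)" "(e, 0)" 0]
            by (simp add: F_def)
          then have "((\<lambda>t. (F e i (y + t *\<^sub>R e) \<xi> - F e i (y + t *\<^sub>R e) \<eta>) / r) has_real_derivative
             (F e (Suc i) y \<xi> - F e (Suc i) y \<eta>) / r) (at 0)"
            by (intro DERIV_cdivide DERIV_diff) (auto simp: has_real_derivative_iff_has_vector_derivative)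
          from has_vector_derivative_of_real[OF this] show ?thesis
            by (simp only: G_def)
        qed
        show "cmod (G i y) \<le> C2" if "i \<le> 0 + k" "y \<in> S" for i y
          using C2(2)[OF e _ S(2)[OF that(2)] \<xi>R \<eta>R, of i] that(1) \<open>0 < r\<close>
          unfolding G_def norm_of_real by (simp add: r_def field_simps)
      qed
      moreover have Gc: "c \<le> cmod (G 0 y)" if "y \<in> S" for y
        using lower[OF S(1)[OF that]] \<open>0 < r\<close> unfolding G0 norm_of_real by (simp add: p_def field_simps)
      ultimately have h: "bounded_dd e S k D h"
        unfolding h_def by (intro D(2)) auto
      have "continuous_on UNIV (\<lambda>y. dd (e, 0) \<Psi> (y, \<xi>))" for \<xi>
        by (intro continuous_on_compose2[OF smooth_continuous_on[OF smooth_dd[OF \<Psi>], of UNIV]] continuous_intros) auto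
      then have [measurable]: "(\<lambda>y. dd (e, 0) \<Psi> (y, \<xi>)) \<in> borel_measurable borel" for \<xi>
        by (rule borel_measurable_continuous_onI)
      have [measurable]: "h \<in> borel_measurable borel"
        unfolding h_def G0 p_def by measurable
      have \<phi>': "((\<lambda>t. \<phi> (y + t *\<^sub>R e)) has_vector_derivative p y) (at 0)" for y
      proof -
        have "((\<lambda>t. \<Psi> (y + t *\<^sub>R e, \<xi>)) has_vector_derivative dd (e, 0) \<Psi> (y, \<xi>)) (at 0)" for \<xi>
          using smooth_line_derivative[OF \<Psi>, of "(y, \<xi>)" "(e, 0)" 0] by simp
        then show ?thesis
          unfolding \<phi>_def p_def by (intro has_vector_derivative_diff)
      qed
      have hp: "h y * of_real (p y) = of_real r" if "y \<in> S" for y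
      proof -
        have "p y \<noteq> 0"
          using Gc[OF that] \<open>0 < c\<close> by (auto simp: G0)
        then show ?thesis using \<open>0 < r\<close> by (simp add: h_def G0 field_simps)
      qed
      have "cmod ?I \<le> (2 ^ k * D / (lam * r)) ^ k * C3 * measure lborel (cball y0 \<rho>)"
        using \<open>0 < \<rho>\<close>
        by (intro oscillatory_integral_decay[where S = S and h = h and p = p and e = e] g[OF e] h hp \<phi>' g0
             \<open>0 < r\<close> \<open>0 < lam\<close> D(1) \<open>0 \<le> C3\<close>) (auto simp: S_def)
      also have "\<dots> = C4 / (lam * r) ^ k"
        by (simp add: C4_def V power_divide)
      \<comment> \<open>The exponent \<open>2 * DIM('b)\<close> becomes a power of the square, as
        the majorant requires.\<close>
      also have "(lam * r) ^ k = ((lam * norm (\<xi> - \<eta>))\<^sup>2) ^ DIM('b)"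
        by (simp add: k_def power_mult r_def)
      finally show ?thesis .
    qed
    show ?thesis
      unfolding eq using trivial decay \<open>0 \<le> C3\<close> \<open>0 \<le> C4\<close> \<open>0 \<le> V\<close> that(1)
      by (intro min_power_le_product[OF _ _ refl]) auto
  qed
  show ?thesis
    using main \<open>0 < \<rho>\<close> \<open>0 \<le> C3\<close> \<open>0 \<le> C4\<close> \<open>0 \<le> V\<close>
    by (intro exI[of _ \<rho>] conjI exI[of _ "(C3 * V + C4) * 2 ^ DIM('b)"]) auto
qed

section \<open>The estimate for nondegenerate phases\<close>

text \<open>On a bounded set \<open>t \<le> 1 + t^2\<close> gives a dominating function.
  Integrability of \<open>F\<close> is what Fubini in Schur's test asks for.\<close>

lemma L2_bounded_support_integrable:
  fixes F :: "'a::euclidean_space \<Rightarrow> complex"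
  assumes [measurable]: "F \<in> borel_measurable borel" and F: "integrable lborel (\<lambda>\<xi>. (cmod (F \<xi>))\<^sup>2)"
    and K: "bounded K" "\<And>\<xi>. \<xi> \<notin> K \<Longrightarrow> F \<xi> = 0"
  shows "integrable lborel F"
proof -
  obtain R where R: "K \<subseteq> cball 0 R"
    using K(1) by (auto simp: bounded_iff subset_iff)
  have "integrable lborel (\<lambda>\<xi>. indicator (cball (0::'a) R) \<xi> + (cmod (F \<xi>))\<^sup>2)"
    using emeasure_compact_finite[of "cball (0::'a) R"]
    by (intro Bochner_Integration.integrable_add integrable_real_indicator F) auto
  then show ?thesis
  proof (rule Bochner_Integration.integrable_bound)
    have "cmod (F \<xi>) \<le> indicator (cball 0 R) \<xi> + (cmod (F \<xi>))\<^sup>2" for \<xi>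
    proof (cases "\<xi> \<in> K")
      case True
      have "cmod (F \<xi>) \<le> 1 + (cmod (F \<xi>))\<^sup>2"
        using sum_squares_bound[of "cmod (F \<xi>)" 1] by (simp add: power2_eq_square) (smt (verit) zero_le_square norm_ge_zero)
      with True R show ?thesis by (auto simp: indicator_def)
    qed (simp add: K)
    then show "AE \<xi> in lborel. norm (F \<xi>) \<le> norm (indicator (cball 0 R) \<xi> + (cmod (F \<xi>))\<^sup>2)"
      by (intro AE_I2) simp
  qed measurable
qed

text \<open>Schur's test bounds the localized operator; the two compact projections of the support
  are then covered by finitely many balls.\<close>

theorem oscillatory_integral_L2_bound:
  fixes \<Psi> :: "'a::euclidean_space \<times> 'b::euclidean_space \<Rightarrow> real"
    and a :: "'a \<times> 'b \<Rightarrow> complex"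
  assumes \<Psi>: "smooth \<Psi>" and a: "smooth a" and K: "compact (supp a)"
    and nondeg: "\<And>p d. p \<in> supp a \<Longrightarrow> d \<noteq> 0 \<Longrightarrow> \<exists>e\<in>Basis. dd (0, d) (dd (e, 0) \<Psi>) p \<noteq> 0"
  shows "\<exists>C\<ge>0. \<forall>lam>0. \<forall>F. F \<in> borel_measurable borel \<longrightarrow> integrable lborel (\<lambda>\<xi>. (cmod (F \<xi>))\<^sup>2) \<longrightarrow>
    (\<integral>\<^sup>+ y. ennreal ((cmod (LINT \<xi>|lborel. exp (\<i> * of_real (lam * \<Psi> (y, \<xi>))) * a (y, \<xi>) * F \<xi>))\<^sup>2) \<partial>lborel)
    \<le> ennreal (C / lam ^ DIM('b) * (LINT \<xi>|lborel. (cmod (F \<xi>))\<^sup>2))"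
proof -
  define K where "K = supp a"
  have cK: "compact K" using assms(3) by (simp add: K_def)
  have a0: "a p = 0" if "p \<notin> K" for p
    using that closure_subset[of "{p. a p \<noteq> 0}"] by (auto simp: K_def supp_def)
  define k where "k = 2 * DIM('b)"
  have "\<exists>\<rho>>0. \<exists>C\<ge>0. \<forall>y0 \<xi>0 \<xi> \<eta> lam. 0 < lam \<longrightarrow> \<xi> \<in> ball \<xi>0 \<rho> \<longrightarrow> \<eta> \<in> ball \<xi>0 \<rho> \<longrightarrow>
    cmod (LINT y|lborel. of_real (bump k \<rho> y0 y) * (exp (\<i> * of_real (lam * \<Psi> (y, \<xi>))) * a (y, \<xi>)) *
        cnj (exp (\<i> * of_real (lam * \<Psi> (y, \<eta>))) * a (y, \<eta>)))
    \<le> C * (\<Prod>b\<in>Basis. inverse (1 + (lam * ((\<xi> - \<eta>) \<bullet> b))\<^sup>2))"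
    unfolding k_def using a0 nondeg[folded K_def]
    by (intro oscillatory_kernel_bound[OF \<Psi> a cK]) auto
  then obtain \<rho> Ck where "0 < \<rho>" "0 \<le> Ck" and kernel': "\<forall>y0 \<xi>0 \<xi> \<eta> lam. 0 < lam \<longrightarrow> \<xi> \<in> ball \<xi>0 \<rho> \<longrightarrow> \<eta> \<in> ball \<xi>0 \<rho> \<longrightarrow>
    cmod (LINT y|lborel. of_real (bump k \<rho> y0 y) * (exp (\<i> * of_real (lam * \<Psi> (y, \<xi>))) * a (y, \<xi>)) *
        cnj (exp (\<i> * of_real (lam * \<Psi> (y, \<eta>))) * a (y, \<eta>)))
    \<le> Ck * (\<Prod>b\<in>Basis. inverse (1 + (lam * ((\<xi> - \<eta>) \<bullet> b))\<^sup>2))"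
    by (elim exE conjE)
  note kernel = kernel'[rule_format]
  obtain Ca where "0 \<le> Ca" and Ca': "\<And>e \<xi>. e \<in> Basis \<Longrightarrow> bounded_dd e UNIV 0 Ca (\<lambda>y. a (y, \<xi>))"
    using bounded_dd_compact_support[OF a cK a0, of 0] by blast
  have Ca: "cmod (a (y, \<xi>)) \<le> Ca" for y \<xi>
    using Ca' nonempty_Basis bounded_dd_bound by blast
  have [measurable]: "\<Psi> \<in> borel_measurable (borel \<Otimes>\<^sub>M borel)" "a \<in> borel_measurable (borel \<Otimes>\<^sub>M borel)"
    using smooth_measurable[OF \<Psi>] smooth_measurable[OF a] by (simp_all add: borel_prod)
  define A where "A lam y \<xi> = exp (\<i> * of_real (lam * \<Psi> (y, \<xi>))) * a (y, \<xi>)" for lam y \<xi>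
  have A_le: "cmod (A lam y \<xi>) \<le> Ca" for lam y \<xi>
    using Ca by (simp add: A_def norm_mult)
  have A_meas [measurable]: "(\<lambda>(y, \<xi>). A lam y \<xi>) \<in> borel_measurable (lborel \<Otimes>\<^sub>M lborel)" for lam
    unfolding A_def by measurable
  have A_meas' [measurable]: "(\<lambda>\<xi>. A lam y \<xi>) \<in> borel_measurable borel" for lam y
    unfolding A_def by measurable
  define T where "T lam F y = (LINT \<xi>|lborel. A lam y \<xi> * F \<xi>)" for lam F y
  have AF_int: "integrable lborel (\<lambda>\<xi>. A lam y \<xi> * F \<xi>)" if F: "integrable lborel F" for lam y F
  proof (rule Bochner_Integration.integrable_bound)
    show "integrable lborel (\<lambda>\<xi>. of_real Ca * F \<xi>)" using F by simp
    show "AE \<xi> in lborel. norm (A lam y \<xi> * F \<xi>) \<le> norm (of_real Ca * F \<xi>)"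
      using A_le \<open>0 \<le> Ca\<close> by (intro AE_I2) (auto simp: norm_mult intro!: mult_right_mono)
    have [measurable]: "F \<in> borel_measurable borel"
      using borel_measurable_integrable[OF F] by simp
    show "(\<lambda>\<xi>. A lam y \<xi> * F \<xi>) \<in> borel_measurable lborel" by measurable
  qed
  have T_meas [measurable]: "T lam F \<in> borel_measurable borel" if [measurable]: "F \<in> borel_measurable borel" for lam F
  proof -
    have "T lam F \<in> borel_measurable lborel"
      unfolding T_def A_def by measurable
    then show ?thesis by simp
  qed
  \<comment> \<open>Bound for the integral of the kernel majorant in one variable, as Schur's test
    requires.\<close>
  define b where "b lam = Ck * (pi / lam) ^ DIM('b)" for lam
  have b: "0 \<le> b lam" if "0 < lam" for lam
    using that \<open>0 \<le> Ck\<close> by (simp add: b_def)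
  have localized: "(\<integral>\<^sup>+ y. ennreal (bump k \<rho> y0 y * (cmod (T lam F y))\<^sup>2) \<partial>lborel) \<le> ennreal (b lam * (LINT \<xi>|lborel. (cmod (F \<xi>))\<^sup>2))"
    if "0 < lam" and [measurable]: "F \<in> borel_measurable borel" and F: "integrable lborel (\<lambda>\<xi>. (cmod (F \<xi>))\<^sup>2)"
      and F0: "\<And>\<xi>. \<xi> \<notin> ball \<xi>0 \<rho> \<Longrightarrow> F \<xi> = 0" for lam F y0 \<xi>0
    unfolding T_def
  proof (rule weighted_L2_bound_Schur[where B = Ca and
        k = "\<lambda>\<xi> \<eta>. Ck * (\<Prod>b\<in>Basis. inverse (1 + (lam * ((\<xi> - \<eta>) \<bullet> b))\<^sup>2))"])
    show "sigma_finite_measure lborel" "sigma_finite_measure lborel"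
      by (rule sigma_finite_lborel)+
    show "integrable lborel (bump k \<rho> y0)"
    proof (rule Bochner_Integration.integrable_bound)
      show "integrable lborel (indicator (cball y0 \<rho>) :: 'a \<Rightarrow> real)"
        using emeasure_compact_finite[of "cball y0 \<rho>"] by (intro integrable_real_indicator) auto
      show "AE y in lborel. norm (bump k \<rho> y0 y) \<le> norm (indicator (cball y0 \<rho>) y :: real)"
      proof (intro AE_I2)
        fix y
        show "norm (bump k \<rho> y0 y) \<le> norm (indicator (cball y0 \<rho>) y :: real)"
          using bump_nonneg[of k \<rho> y0 y] bump_le_1[of k \<rho> y0 y] bump_eq_0[OF \<open>0 < \<rho>\<close>, of y y0 k]
          by (cases "y \<in> cball y0 \<rho>") (simp_all add: indicator_def)
      qed
    qed measurable
    show "integrable lborel F"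
      by (rule L2_bounded_support_integrable[OF _ F bounded_ball F0]) measurable
    show "(\<lambda>(\<xi>, \<eta>). Ck * (\<Prod>b\<in>Basis. inverse (1 + (lam * ((\<xi> - \<eta>) \<bullet> b))\<^sup>2))) \<in> borel_measurable (lborel \<Otimes>\<^sub>M lborel)"
      by measurable
    show "Ck * (\<Prod>b\<in>Basis. inverse (1 + (lam * ((\<xi> - \<eta>) \<bullet> b))\<^sup>2)) = Ck * (\<Prod>b\<in>Basis. inverse (1 + (lam * ((\<eta> - \<xi>) \<bullet> b))\<^sup>2))" for \<xi> \<eta> :: 'b
      by (simp add: inner_diff_left power_mult_distrib power2_commute)
    show "0 \<le> Ck * (\<Prod>b\<in>Basis. inverse (1 + (lam * ((\<xi> - \<eta>) \<bullet> b))\<^sup>2))" for \<xi> \<eta> :: 'b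
      using \<open>0 \<le> Ck\<close> by (intro mult_nonneg_nonneg prod_nonneg) auto
    show "(\<integral>\<^sup>+ \<eta>. ennreal (Ck * (\<Prod>b\<in>Basis. inverse (1 + (lam * ((\<xi> - \<eta>) \<bullet> b))\<^sup>2))) \<partial>lborel) \<le> ennreal (b lam)" for \<xi> :: 'b
      unfolding b_def by (rule nn_integral_product_kernel[OF \<open>0 < lam\<close> \<open>0 \<le> Ck\<close>])
    show "cmod (LINT y|lborel. of_real (bump k \<rho> y0 y) * A lam y \<xi> * cnj (A lam y \<eta>))
        \<le> Ck * (\<Prod>b\<in>Basis. inverse (1 + (lam * ((\<xi> - \<eta>) \<bullet> b))\<^sup>2))" if "F \<xi> \<noteq> 0" "F \<eta> \<noteq> 0" for \<xi> \<eta>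
    proof -
      have "\<xi> \<in> ball \<xi>0 \<rho>" "\<eta> \<in> ball \<xi>0 \<rho>"
        using that F0 by blast+
      from kernel[OF \<open>0 < lam\<close> this] show ?thesis unfolding A_def .
    qed
  qed (use b[OF \<open>0 < lam\<close>] F A_le bump_nonneg in auto)
  \<comment> \<open>The balls are split off one at a time. Each step uses
    \<open>(s + t)^2 \<le> 2 * s^2 + 2 * t^2\<close>, hence the factor
    \<open>2 ^ card D\<close>.\<close>
  have covered: "(\<integral>\<^sup>+ y. ennreal (bump k \<rho> y0 y * (cmod (T lam F y))\<^sup>2) \<partial>lborel)
      \<le> ennreal (2 ^ card D * b lam * (LINT \<xi>|lborel. (cmod (F \<xi>))\<^sup>2))"
    if "finite D" "0 < lam" "F \<in> borel_measurable borel" "integrable lborel (\<lambda>\<xi>. (cmod (F \<xi>))\<^sup>2)"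
      and "\<And>\<xi>. \<xi> \<notin> (\<Union>x\<in>D. ball x \<rho>) \<Longrightarrow> F \<xi> = 0" for lam F y0 D
    using that
  proof (induction D arbitrary: F rule: finite_induct)
    case empty
    then show ?case by (simp add: T_def)
  next
    case (insert x D)
    note [measurable] = insert.prems(2)
    have [measurable]: "ball x \<rho> \<in> sets borel" by simp
    \<comment> \<open>Sharp cutoffs have disjoint supports, so the squared norms of the pieces add
      up exactly.\<close>
    define F1 where "F1 \<xi> = indicator (ball x \<rho>) \<xi> * F \<xi>" for \<xi>
    define F2 where "F2 \<xi> = indicator (- ball x \<rho>) \<xi> * F \<xi>" for \<xi>
    have [measurable]: "F1 \<in> borel_measurable borel" "F2 \<in> borel_measurable borel"
      unfolding F1_def F2_def by measurable
    have I: "integrable lborel (\<lambda>\<xi>. (cmod (F1 \<xi>))\<^sup>2)" "integrable lborel (\<lambda>\<xi>. (cmod (F2 \<xi>))\<^sup>2)"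
      by (rule Bochner_Integration.integrable_bound[OF insert.prems(3)];
          auto simp: F1_def F2_def indicator_def intro!: AE_I2)+
    have F2_0: "F2 \<xi> = 0" if "\<xi> \<notin> (\<Union>x\<in>D. ball x \<rho>)" for \<xi>
      using that insert.prems(4)[of \<xi>] by (auto simp: F2_def indicator_def)
    have F1_0: "F1 \<xi> = 0" if "\<xi> \<notin> ball x \<rho>" for \<xi>
      using that by (simp add: F1_def)
    have int1: "integrable lborel F1"
      by (rule L2_bounded_support_integrable[OF _ I(1) bounded_ball F1_0]) measurable
    have "bounded (\<Union>x\<in>D. ball x \<rho>)"
      using insert.hyps(1) by (intro bounded_UN) auto
    from L2_bounded_support_integrable[OF _ I(2) this F2_0] have int2: "integrable lborel F2"
      by simp
    have sum: "(LINT \<xi>|lborel. (cmod (F1 \<xi>))\<^sup>2) + (LINT \<xi>|lborel. (cmod (F2 \<xi>))\<^sup>2) = (LINT \<xi>|lborel. (cmod (F \<xi>))\<^sup>2)"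
      by (subst Bochner_Integration.integral_add[symmetric, OF I])
         (auto intro!: Bochner_Integration.integral_cong simp: F1_def F2_def indicator_def)
    have T: "T lam F y = T lam F1 y + T lam F2 y" for y
      unfolding T_def
      by (subst Bochner_Integration.integral_add[symmetric, OF AF_int[OF int1] AF_int[OF int2]])
         (auto intro!: Bochner_Integration.integral_cong simp: F1_def F2_def indicator_def)
    have sq: "(cmod (T lam F y))\<^sup>2 \<le> 2 * (cmod (T lam F1 y))\<^sup>2 + 2 * (cmod (T lam F2 y))\<^sup>2" for y
    proof -
      have "(cmod (T lam F y))\<^sup>2 \<le> (cmod (T lam F1 y) + cmod (T lam F2 y))\<^sup>2"
        unfolding T by (intro power_mono norm_triangle_ineq) auto
      also have "\<dots> \<le> 2 * (cmod (T lam F1 y))\<^sup>2 + 2 * (cmod (T lam F2 y))\<^sup>2"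
        using sum_squares_bound[of "cmod (T lam F1 y)" "cmod (T lam F2 y)"] by (simp add: power2_sum)
      finally show ?thesis .
    qed
    have "(\<integral>\<^sup>+ y. ennreal (bump k \<rho> y0 y * (cmod (T lam F y))\<^sup>2) \<partial>lborel) \<le>
      (\<integral>\<^sup>+ y. 2 * ennreal (bump k \<rho> y0 y * (cmod (T lam F1 y))\<^sup>2) + 2 * ennreal (bump k \<rho> y0 y * (cmod (T lam F2 y))\<^sup>2) \<partial>lborel)"
    proof (intro nn_integral_mono)
      fix y
      have "bump k \<rho> y0 y * (cmod (T lam F y))\<^sup>2 \<le> 2 * (bump k \<rho> y0 y * (cmod (T lam F1 y))\<^sup>2) + 2 * (bump k \<rho> y0 y * (cmod (T lam F2 y))\<^sup>2)"
        using mult_left_mono[OF sq bump_nonneg, of k \<rho> y0 y y] by (simp add: algebra_simps)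
      then have "ennreal (bump k \<rho> y0 y * (cmod (T lam F y))\<^sup>2) \<le> ennreal (2 * (bump k \<rho> y0 y * (cmod (T lam F1 y))\<^sup>2) + 2 * (bump k \<rho> y0 y * (cmod (T lam F2 y))\<^sup>2))"
        by (rule ennreal_leI)
      then show "ennreal (bump k \<rho> y0 y * (cmod (T lam F y))\<^sup>2) \<le> 2 * ennreal (bump k \<rho> y0 y * (cmod (T lam F1 y))\<^sup>2) + 2 * ennreal (bump k \<rho> y0 y * (cmod (T lam F2 y))\<^sup>2)"
        using bump_nonneg[of k \<rho> y0 y] by (simp add: ennreal_plus ennreal_mult)
    qed
    also have "\<dots> = 2 * (\<integral>\<^sup>+ y. ennreal (bump k \<rho> y0 y * (cmod (T lam F1 y))\<^sup>2) \<partial>lborel) + 2 * (\<integral>\<^sup>+ y. ennreal (bump k \<rho> y0 y * (cmod (T lam F2 y))\<^sup>2) \<partial>lborel)"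
      by (simp add: nn_integral_add nn_integral_cmult)
    also have "\<dots> \<le> 2 * ennreal (b lam * (LINT \<xi>|lborel. (cmod (F1 \<xi>))\<^sup>2)) + 2 * ennreal (2 ^ card D * b lam * (LINT \<xi>|lborel. (cmod (F2 \<xi>))\<^sup>2))"
      using \<open>0 < lam\<close> I F1_0 F2_0
      by (intro add_mono mult_left_mono localized[OF _ _ _ F1_0] insert.IH) auto
    also have "\<dots> = ennreal (2 * (b lam * (LINT \<xi>|lborel. (cmod (F1 \<xi>))\<^sup>2)) + 2 * (2 ^ card D * b lam * (LINT \<xi>|lborel. (cmod (F2 \<xi>))\<^sup>2)))"
      using b[OF \<open>0 < lam\<close>] by (simp add: ennreal_plus ennreal_mult)
    also have "\<dots> \<le> ennreal (2 ^ card (insert x D) * b lam * (LINT \<xi>|lborel. (cmod (F \<xi>))\<^sup>2))"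
    proof (intro ennreal_leI)
      have "1 * (b lam * (LINT \<xi>|lborel. (cmod (F1 \<xi>))\<^sup>2)) \<le> 2 ^ card D * (b lam * (LINT \<xi>|lborel. (cmod (F1 \<xi>))\<^sup>2))"
        using b[OF \<open>0 < lam\<close>] by (intro mult_right_mono) auto
      then show "2 * (b lam * (LINT \<xi>|lborel. (cmod (F1 \<xi>))\<^sup>2)) + 2 * (2 ^ card D * b lam * (LINT \<xi>|lborel. (cmod (F2 \<xi>))\<^sup>2))
        \<le> 2 ^ card (insert x D) * b lam * (LINT \<xi>|lborel. (cmod (F \<xi>))\<^sup>2)"
        unfolding sum[symmetric] using insert.hyps by (simp add: algebra_simps)
    qed
    finally show ?case .
  qed
  have "compact (fst ` K)" "compact (snd ` K)"
    by (intro compact_continuous_image continuous_intros cK)+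
  \<comment> \<open>Half radii in \<open>y\<close>, where \<open>bump\<close> is bounded below; full
    radii in \<open>\<xi>\<close>, where the cutoff is sharp.\<close>
  then obtain D E where D: "finite D" "snd ` K \<subseteq> (\<Union>x\<in>D. ball x \<rho>)" and E: "finite E" "fst ` K \<subseteq> (\<Union>x\<in>E. ball x (\<rho> / 2))"
    using \<open>0 < \<rho>\<close> compactE_image[of "snd ` K" "snd ` K" "\<lambda>x. ball x \<rho>"]
      compactE_image[of "fst ` K" "fst ` K" "\<lambda>x. ball x (\<rho> / 2)"]
    by (smt (verit) centre_in_ball half_gt_zero open_ball UN_I subsetI)
  \<comment> \<open>\<open>card E\<close> bumps, \<open>2 ^ Suc k\<close> for the lower bound of a
    bump, \<open>2 ^ card D\<close> for the cover in \<open>\<xi>\<close>, and the rest from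
    \<open>b\<close>.\<close>
  define C where "C = real (card E) * 2 ^ Suc k * 2 ^ card D * Ck * pi ^ DIM('b)"
  have "0 \<le> C" using \<open>0 \<le> Ck\<close> by (simp add: C_def)
  moreover have "(\<integral>\<^sup>+ y. ennreal ((cmod (T lam F y))\<^sup>2) \<partial>lborel) \<le> ennreal (C / lam ^ DIM('b) * (LINT \<xi>|lborel. (cmod (F \<xi>))\<^sup>2))"
    if "0 < lam" and [measurable]: "F \<in> borel_measurable borel" and F: "integrable lborel (\<lambda>\<xi>. (cmod (F \<xi>))\<^sup>2)" for lam F
  proof -
    \<comment> \<open>\<open>A\<close> vanishes at frequencies outside the cover, so the truncation
      does not change the operator, and it provides a bounded support.\<close>
    define G where "G \<xi> = indicator (\<Union>x\<in>D. ball x \<rho>) \<xi> * F \<xi>" for \<xi>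
    have [measurable]: "(\<Union>x\<in>D. ball x \<rho>) \<in> sets borel"
      by (intro borel_open open_UN) auto
    have [measurable]: "G \<in> borel_measurable borel"
      unfolding G_def by measurable
    have G: "integrable lborel (\<lambda>\<xi>. (cmod (G \<xi>))\<^sup>2)"
    proof (rule Bochner_Integration.integrable_bound[OF F])
      show "AE \<xi> in lborel. norm ((cmod (G \<xi>))\<^sup>2) \<le> norm ((cmod (F \<xi>))\<^sup>2)"
        by (intro AE_I2) (simp add: G_def indicator_def)
    qed measurable
    have G_le: "(LINT \<xi>|lborel. (cmod (G \<xi>))\<^sup>2) \<le> (LINT \<xi>|lborel. (cmod (F \<xi>))\<^sup>2)"
      by (intro integral_mono G F) (auto simp: G_def indicator_def)
    have T_eq: "T lam F y = T lam G y" for y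
      unfolding T_def
    proof (intro Bochner_Integration.integral_cong refl)
      fix \<xi>
      show "A lam y \<xi> * F \<xi> = A lam y \<xi> * G \<xi>"
        using a0[of "(y, \<xi>)"] D(2) by (cases "(y, \<xi>) \<in> K") (force simp: A_def G_def indicator_def)+
    qed
    have pw: "ennreal ((cmod (T lam F y))\<^sup>2) \<le> (\<Sum>x\<in>E. ennreal (2 ^ Suc k) * ennreal (bump k \<rho> x y * (cmod (T lam G y))\<^sup>2))" for y
    proof (cases "y \<in> fst ` K")
      case False
      then have "A lam y \<xi> = 0" for \<xi>
        using a0[of "(y, \<xi>)"] by (force simp: A_def)
      then show ?thesis by (simp add: T_def)
    next
      case True
      then obtain x where x: "x \<in> E" "y \<in> ball x (\<rho> / 2)" using E(2) by blast
      have "1 = 2 ^ Suc k * (1 / 2 :: real) ^ Suc k" by (simp add: power_one_over)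
      also have "\<dots> \<le> 2 ^ Suc k * bump k \<rho> x y"
        by (intro mult_left_mono bump_ge[OF \<open>0 < \<rho>\<close> x(2)]) auto
      finally have "1 * (cmod (T lam F y))\<^sup>2 \<le> 2 ^ Suc k * bump k \<rho> x y * (cmod (T lam F y))\<^sup>2"
        by (intro mult_right_mono) auto
      then have "ennreal ((cmod (T lam F y))\<^sup>2) \<le> ennreal (2 ^ Suc k) * ennreal (bump k \<rho> x y * (cmod (T lam G y))\<^sup>2)"
        unfolding T_eq by (subst ennreal_mult[symmetric]) (auto intro!: ennreal_leI simp: bump_nonneg mult.assoc simp del: power_Suc)
      also have "\<dots> \<le> (\<Sum>x\<in>E. ennreal (2 ^ Suc k) * ennreal (bump k \<rho> x y * (cmod (T lam G y))\<^sup>2))"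
        using x(1) E(1) by (intro member_le_sum) auto
      finally show ?thesis .
    qed
    have "(\<integral>\<^sup>+ y. ennreal ((cmod (T lam F y))\<^sup>2) \<partial>lborel) \<le>
       (\<integral>\<^sup>+ y. (\<Sum>x\<in>E. ennreal (2 ^ Suc k) * ennreal (bump k \<rho> x y * (cmod (T lam G y))\<^sup>2)) \<partial>lborel)"
      by (intro nn_integral_mono pw)
    also have "\<dots> = (\<Sum>x\<in>E. ennreal (2 ^ Suc k) * (\<integral>\<^sup>+ y. ennreal (bump k \<rho> x y * (cmod (T lam G y))\<^sup>2) \<partial>lborel))"
      by (subst nn_integral_sum) (auto simp: nn_integral_cmult simp del: power_Suc)
    also have "\<dots> \<le> (\<Sum>x\<in>E. ennreal (2 ^ Suc k) * ennreal (2 ^ card D * b lam * (LINT \<xi>|lborel. (cmod (F \<xi>))\<^sup>2)))"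
    proof (intro sum_mono mult_left_mono)
      fix x
      have "(\<integral>\<^sup>+ y. ennreal (bump k \<rho> x y * (cmod (T lam G y))\<^sup>2) \<partial>lborel) \<le> ennreal (2 ^ card D * b lam * (LINT \<xi>|lborel. (cmod (G \<xi>))\<^sup>2))"
        by (intro covered[OF D(1) \<open>0 < lam\<close> _ G]) (auto simp: G_def)
      also have "\<dots> \<le> ennreal (2 ^ card D * b lam * (LINT \<xi>|lborel. (cmod (F \<xi>))\<^sup>2))"
        using b[OF \<open>0 < lam\<close>] by (intro ennreal_leI mult_left_mono G_le) auto
      finally show "(\<integral>\<^sup>+ y. ennreal (bump k \<rho> x y * (cmod (T lam G y))\<^sup>2) \<partial>lborel) \<le> ennreal (2 ^ card D * b lam * (LINT \<xi>|lborel. (cmod (F \<xi>))\<^sup>2))" .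
    qed auto
    also have "\<dots> = ennreal (real (card E) * (2 ^ Suc k * (2 ^ card D * b lam * (LINT \<xi>|lborel. (cmod (F \<xi>))\<^sup>2))))"
      using b[OF \<open>0 < lam\<close>]
      by (simp add: ennreal_mult[symmetric] ennreal_of_nat_eq_real_of_nat del: power_Suc)
    also have "real (card E) * (2 ^ Suc k * (2 ^ card D * b lam * (LINT \<xi>|lborel. (cmod (F \<xi>))\<^sup>2))) = C / lam ^ DIM('b) * (LINT \<xi>|lborel. (cmod (F \<xi>))\<^sup>2)"
      by (simp add: C_def b_def power_divide)
    finally show ?thesis .
  qed
  ultimately show ?thesis
    unfolding T_def A_def by blast
qed

section \<open>Zero-sum tuples and the determinant condition\<close>

lemma sum_UNIV_option:
  fixes f :: "'m::finite option \<Rightarrow> 'b::comm_monoid_add"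
  shows "(\<Sum>j\<in>UNIV. f j) = f None + (\<Sum>l\<in>UNIV. f (Some l))"
  by (simp add: UNIV_option_conv sum.reindex)

text \<open>The test tuples: \<open>u\<close> in one slot, balanced in the slot
  \<open>None\<close>.\<close>

lemma zero_sum_tuple_axis:
  "zero_sum_tuple (axis k u) None = - u"
  "zero_sum_tuple (axis k u) (Some l) = (if l = k then u else 0)"
proof -
  have "(\<Sum>l\<in>UNIV. axis k u $ l) = (\<Sum>l\<in>UNIV. if l = k then u else 0)"
    by (intro sum.cong) (auto simp: axis_def)
  then show "zero_sum_tuple (axis k u) None = - u"
    by (simp add: zero_sum_tuple_def)
  show "zero_sum_tuple (axis k u) (Some l) = (if l = k then u else 0)"
    by (simp add: zero_sum_tuple_def axis_def)
qed

lemma det_cols_zero_cancel: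
  assumes "det_cols c \<noteq> 0" "(\<Sum>k\<in>UNIV. t k *\<^sub>R c k) = 0"
  shows "t k = 0"
proof -
  let ?A = "\<chi> i k. c k $ i"
  have "?A *v (\<chi> k. t k) = (\<Sum>k\<in>UNIV. t k *\<^sub>R c k)"
    by (simp add: vec_eq_iff matrix_vector_mult_def mult.commute)
  moreover have "invertible ?A"
    using assms(1) by (simp add: det_cols_def invertible_det_nz)
  ultimately have "(\<chi> k. t k) = 0"
    using assms(2) matrix_left_invertible_ker[of ?A] by (auto simp: invertible_def)
  then show ?thesis by (simp add: vec_eq_iff)
qed

lemma det_cols_orthogonal:
  assumes "det_cols w \<noteq> 0" "\<And>k. w k \<bullet> v = 0"
  shows "v = 0"
proof -
  let ?A = "transpose (\<chi> i k. w k $ i)"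
  have "?A *v v = (\<chi> k. w k \<bullet> v)"
    by (simp add: vec_eq_iff matrix_vector_mult_def transpose_def inner_vec_def)
  also have "\<dots> = 0" using assms(2) by (simp add: vec_eq_iff)
  finally have "?A *v v = 0" .
  moreover have "invertible ?A"
    using assms(1) by (simp add: det_cols_def invertible_det_nz)
  ultimately show ?thesis
    using matrix_left_invertible_ker[of ?A] by (auto simp: invertible_def)
qed

text \<open>A family orthogonal to all tuples with sum zero is constant, and the vectors \<open>w j\<close>, being
  normal to the \<open>m j l\<close>, annihilate its common value.\<close>

lemma zero_sum_nondegenerate:
  fixes m :: "'m::finite option \<Rightarrow> 'm \<Rightarrow> real ^ 'm option" and d :: "'m option \<Rightarrow> 'm \<Rightarrow> real"
  assumes w: "\<And>j v. w j \<bullet> v = det_cols (case_option v (m j))"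
    and det: "det_cols w \<noteq> 0"
    and orth: "\<And>y :: (real ^ 'm option) ^ 'm. (\<Sum>j\<in>UNIV. (\<Sum>l\<in>UNIV. d j l *\<^sub>R m j l) \<bullet> zero_sum_tuple y j) = 0"
  shows "d j l = 0"
proof -
  define V where "V j = (\<Sum>l\<in>UNIV. d j l *\<^sub>R m j l)" for j
  \<comment> \<open>Testing with \<open>axis k u\<close> compares the slots \<open>Some k\<close>
    and \<open>None\<close>.\<close>
  have "V (Some k) \<bullet> u = V None \<bullet> u" for k u
  proof -
    have "V None \<bullet> (- u) + (\<Sum>l\<in>UNIV. V (Some l) \<bullet> (if l = k then u else 0)) = 0"
      using orth[of "axis k u"] unfolding V_def[symmetric] sum_UNIV_option zero_sum_tuple_axis .
    also have "(\<Sum>l\<in>UNIV. V (Some l) \<bullet> (if l = k then u else 0)) = (\<Sum>l\<in>UNIV. if l = k then V (Some l) \<bullet> u else 0)"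
      by (intro sum.cong) auto
    finally show ?thesis by simp
  qed
  then have "V (Some k) = V None" for k
    by (metis vector_eq_rdot)
  then have V: "V j = V None" for j
    by (cases j) auto
  \<comment> \<open>The determinant has \<open>m j l\<close> as a column twice.\<close>
  have wm: "w j \<bullet> m j l = 0" for j l
    unfolding w det_cols_def
    by (rule det_identical_columns[of None "Some l"]) (auto simp: column_def)
  have "w j \<bullet> V None = 0" for j
    unfolding V[of j, symmetric] unfolding V_def by (simp add: inner_sum_right wm)
  then have "V None = 0"
    by (rule det_cols_orthogonal[OF det])
  have "w j \<noteq> 0"
  proof
    assume "w j = 0"
    then have "(\<Sum>k\<in>UNIV. (if k = j then 1 else 0) *\<^sub>R w k) = 0"
      by (intro sum.neutral) auto
    from det_cols_zero_cancel[OF det this, of j] show False by simp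
  qed
  \<comment> \<open>Pairing \<open>w j\<close> with itself expresses its squared length as the
    determinant of \<open>w j\<close> and the \<open>m j l\<close>, which are therefore linearly
    independent.\<close>
  then have "det_cols (case_option (w j) (m j)) \<noteq> 0"
    using w[of j "w j"] by (metis inner_eq_zero_iff)
  \<comment> \<open>With coefficient 0 for \<open>w j\<close>, this is
    \<open>V j = V None = 0\<close>.\<close>
  moreover have "(\<Sum>k\<in>UNIV. case_option 0 (d j) k *\<^sub>R case_option (w j) (m j) k) = 0"
    using V[of j] \<open>V None = 0\<close> by (simp add: sum_UNIV_option V_def)
  ultimately show ?thesis
    using det_cols_zero_cancel[of "case_option (w j) (m j)" "case_option 0 (d j)" "Some l"] by simp
qed

text \<open>Links the definitions by \<open>THE\<close> and \<open>vector_derivative\<close> to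
  iterated \<open>dd\<close>. The gradient is expanded in the basis, so that it can be
  differentiated in the frequency coefficient by coefficient.\<close>

lemma mixed_deriv_inner:
  fixes \<Phi> :: "(real ^ 'm option) \<times> (real ^ 'm::finite) \<Rightarrow> real"
  assumes \<Phi>: "smooth \<Phi>"
  shows "mixed_deriv \<Phi> l (x, \<xi>) \<bullet> u = dd (0, axis l 1) (dd (u, 0) \<Phi>) (x, \<xi>)"
proof -
  define G where "G \<eta> = (\<Sum>b\<in>Basis. dd (b, 0) \<Phi> (x, \<eta>) *\<^sub>R b)" for \<eta>
  have G: "G \<eta> \<bullet> h = dd (h, 0) \<Phi> (x, \<eta>)" for \<eta> h
  proof -
    have lin: "linear (\<lambda>h. dd (h, 0) \<Phi> (x, \<eta>))"
      using linear_compose[OF _ smooth_dd_linear[OF \<Phi>, of "(x, \<eta>)"], of "\<lambda>h. (h, 0)"]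
      by (simp add: o_def linear_iff)
    have "dd (h, 0) \<Phi> (x, \<eta>) = dd (\<Sum>b\<in>Basis. (h \<bullet> b) *\<^sub>R b, 0) \<Phi> (x, \<eta>)"
      by (simp only: euclidean_representation)
    also have "\<dots> = (\<Sum>b\<in>Basis. dd ((h \<bullet> b) *\<^sub>R b, 0) \<Phi> (x, \<eta>))"
      by (rule linear_sum[OF lin])
    also have "\<dots> = (\<Sum>b\<in>Basis. (h \<bullet> b) * dd (b, 0) \<Phi> (x, \<eta>))"
      by (intro sum.cong refl) (simp only: linear_cmul[OF lin] real_scaleR_def)
    finally show ?thesis
      unfolding G_def inner_sum_left by (simp add: inner_commute mult.commute)
  qed
  have "grad (\<lambda>y. \<Phi> (y, \<eta>)) x = G \<eta>" for \<eta>
  proof -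
    have "((\<lambda>y. \<Phi> (y, \<eta>)) has_derivative (\<lambda>h. dd (h, 0) \<Phi> (x, \<eta>))) (at x)"
      by (rule has_derivative_compose[OF _ smooth_has_derivative[OF \<Phi>]]) (auto intro!: derivative_eq_intros)
    then have "GDERIV (\<lambda>y. \<Phi> (y, \<eta>)) x :> G \<eta>"
      by (simp add: gderiv_def G inner_commute[of _ "G \<eta>"])
    then show ?thesis
      unfolding grad_def
    proof (rule the_equality)
      show "D = G \<eta>" if "GDERIV (\<lambda>y. \<Phi> (y, \<eta>)) x :> D" for D
        using that \<open>GDERIV (\<lambda>y. \<Phi> (y, \<eta>)) x :> G \<eta>\<close> has_derivative_unique
        unfolding gderiv_def by (metis vector_eq_ldot)
    qed
  qed
  then have md: "mixed_deriv \<Phi> l (x, \<xi>) = vector_derivative (\<lambda>t. G (\<xi> + t *\<^sub>R axis l 1)) (at 0)"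
    by (simp add: mixed_deriv_def partial_deriv_def)
  have line: "((\<lambda>t. dd (u, 0) \<Phi> (x, \<xi> + t *\<^sub>R axis l 1)) has_vector_derivative dd (0, axis l 1) (dd (u, 0) \<Phi>) (x, \<xi>)) (at 0)" for u
    using smooth_line_derivative[OF smooth_dd[OF \<Phi>, of "(u, 0)"], of "(x, \<xi>)" "(0, axis l 1)" 0] by simp
  have "((\<lambda>t. G (\<xi> + t *\<^sub>R axis l 1)) has_vector_derivative (\<Sum>b\<in>Basis. dd (0, axis l 1) (dd (b, 0) \<Phi>) (x, \<xi>) *\<^sub>R b)) (at 0)"
    unfolding G_def
    by (intro has_vector_derivative_sum bounded_linear.has_vector_derivative[OF bounded_linear_scaleR_left] line)
  then have "((\<lambda>t. G (\<xi> + t *\<^sub>R axis l 1)) has_vector_derivative mixed_deriv \<Phi> l (x, \<xi>)) (at 0)"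
    unfolding md by (simp add: vector_derivative_at)
  then have "((\<lambda>t. G (\<xi> + t *\<^sub>R axis l 1) \<bullet> u) has_vector_derivative mixed_deriv \<Phi> l (x, \<xi>) \<bullet> u) (at 0)"
    by (rule bounded_linear.has_vector_derivative[OF bounded_linear_inner_left])
  then show ?thesis
    unfolding G using line vector_derivative_unique_at by blast
qed

section \<open>Product measure on tuples and Borel representatives\<close>

lemma prod_Basis_vec:
  fixes f :: "'a::euclidean_space ^ 'n::finite \<Rightarrow> 'b::comm_monoid_mult"
  shows "(\<Prod>b\<in>Basis. f b) = (\<Prod>j\<in>UNIV. \<Prod>b\<in>Basis. f (axis j b))"
proof -
  have B: "Basis = (\<lambda>(j, b). axis j b) ` ((UNIV :: 'n set) \<times> (Basis :: 'a set))"
    by (auto simp: Basis_vec_def)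
  have inj: "inj_on (\<lambda>(j, b). axis j b) ((UNIV :: 'n set) \<times> (Basis :: 'a set))"
    by (auto simp: inj_on_def axis_eq_axis nonzero_Basis)
  have "(\<Prod>b\<in>Basis. f b) = (\<Prod>(j, b)\<in>UNIV \<times> Basis. f (axis j b))"
    unfolding B by (subst prod.reindex[OF inj]) (simp add: case_prod_unfold)
  then show ?thesis by (simp add: prod.cartesian_product)
qed

lemma measurable_vec_lambda_PiM:
  "(\<lambda>g. \<chi> j. g j) \<in> measurable (\<Pi>\<^sub>M j\<in>(UNIV::'n::finite set). (lborel :: 'a::euclidean_space measure)) borel"
proof (subst borel_measurable_euclidean_space, intro ballI)
  fix i :: "'a ^ 'n" assume "i \<in> Basis"
  then obtain j b where "i = axis j b" by (auto simp: Basis_vec_def)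
  then show "(\<lambda>g. (\<chi> j. g j) \<bullet> i) \<in> borel_measurable (\<Pi>\<^sub>M j\<in>(UNIV::'n set). (lborel :: 'a measure))"
    by (simp add: inner_axis)
qed

text \<open>Lebesgue measure is determined by its values on boxes, and a box in the space of tuples
  is a product of boxes. This gives access to Fubini for finite products.\<close>

lemma lborel_vec_eq_distr_PiM:
  "(lborel :: ('a::euclidean_space ^ 'n::finite) measure) = distr (\<Pi>\<^sub>M j\<in>UNIV. lborel) borel (\<lambda>g. \<chi> j. g j)"
proof (rule lborel_eqI)
  interpret product_sigma_finite "\<lambda>j::'n. (lborel :: 'a measure)"
    by standard
  fix l u :: "'a ^ 'n"
  assume le: "\<And>b. b \<in> Basis \<Longrightarrow> l \<bullet> b \<le> u \<bullet> b"
  have le': "l $ j \<bullet> b \<le> u $ j \<bullet> b" if "b \<in> Basis" for j b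
    using le[of "axis j b"] that by (auto simp: Basis_vec_def inner_axis)
  have box: "(\<lambda>g. \<chi> j. g j) -` box l u \<inter> space (\<Pi>\<^sub>M j\<in>UNIV. lborel) = (\<Pi>\<^sub>E j\<in>UNIV. box (l $ j) (u $ j))"
    by (auto simp: mem_box Basis_vec_def inner_axis space_PiM PiE_def Pi_iff)
  have "emeasure (distr (\<Pi>\<^sub>M j\<in>UNIV. lborel) borel (\<lambda>g. \<chi> j. g j)) (box l u) =
      (\<Prod>j\<in>UNIV. emeasure lborel (box (l $ j) (u $ j)))"
    by (subst emeasure_distr[OF measurable_vec_lambda_PiM]) (simp_all add: box emeasure_PiM)
  also have "\<dots> = (\<Prod>j\<in>UNIV. ennreal (\<Prod>b\<in>Basis. (u $ j - l $ j) \<bullet> b))"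
    using le' by (simp add: emeasure_lborel_box_eq)
  also have "\<dots> = ennreal (\<Prod>b\<in>Basis. (u - l) \<bullet> b)"
    using le' by (subst prod_ennreal) (auto simp: prod_Basis_vec inner_axis inner_diff_left intro!: prod_nonneg)
  finally show "emeasure (distr (\<Pi>\<^sub>M j\<in>UNIV. lborel) borel (\<lambda>g. \<chi> j. g j)) (box l u) = ennreal (\<Prod>b\<in>Basis. (u - l) \<bullet> b)" .
qed simp

lemma
  fixes g :: "'n::finite \<Rightarrow> 'a::euclidean_space \<Rightarrow> 'b::{real_normed_field,banach,second_countable_topology}"
  assumes g: "\<And>j. integrable lborel (g j)"
  shows integrable_prod_vec: "integrable lborel (\<lambda>\<xi>::'a ^ 'n. \<Prod>j\<in>UNIV. g j (\<xi> $ j))"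
    and integral_prod_vec: "(LINT \<xi>|(lborel :: ('a ^ 'n) measure). (\<Prod>j\<in>UNIV. g j (\<xi> $ j))) = (\<Prod>j\<in>UNIV. LINT x|lborel. g j x)"
proof -
  interpret product_sigma_finite "\<lambda>j::'n. (lborel :: 'a measure)"
    by standard
  have [measurable]: "g j \<in> borel_measurable borel" for j
    using borel_measurable_integrable[OF g] by simp
  have [measurable]: "(\<lambda>\<xi>::'a ^ 'n. \<xi> $ j) \<in> borel_measurable borel" for j
    by (intro borel_measurable_continuous_onI continuous_intros)
  have [measurable]: "(\<lambda>\<xi>::'a ^ 'n. \<Prod>j\<in>UNIV. g j (\<xi> $ j)) \<in> borel_measurable borel"
    by measurable
  show "integrable lborel (\<lambda>\<xi>::'a ^ 'n. \<Prod>j\<in>UNIV. g j (\<xi> $ j))"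
    unfolding lborel_vec_eq_distr_PiM
    by (subst integrable_distr_eq[OF measurable_vec_lambda_PiM]) (auto intro!: product_integrable_prod g)
  show "(LINT \<xi>|(lborel :: ('a ^ 'n) measure). (\<Prod>j\<in>UNIV. g j (\<xi> $ j))) = (\<Prod>j\<in>UNIV. LINT x|lborel. g j x)"
    unfolding lborel_vec_eq_distr_PiM
    by (subst integral_distr[OF measurable_vec_lambda_PiM]) (auto intro!: product_integral_prod g)
qed

text \<open>\<open>L2\<close> consists of Lebesgue measurable functions, whereas products and
  sections are handled with Borel measurability. Real and imaginary parts are replaced
  separately.\<close>

lemma L2_borel_representative:
  fixes f :: "'a::euclidean_space \<Rightarrow> complex"
  assumes "f \<in> L2"
  obtains g where "g \<in> borel_measurable borel" "AE \<xi> in lborel. f \<xi> = g \<xi>"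
    "integrable lborel (\<lambda>\<xi>. (cmod (g \<xi>))\<^sup>2)" "(L2_norm f)\<^sup>2 = (LINT \<xi>|lborel. (cmod (g \<xi>))\<^sup>2)"
proof -
  have f: "f \<in> borel_measurable lebesgue" "integrable lebesgue (\<lambda>\<xi>. (cmod (f \<xi>))\<^sup>2)"
    using assms by (auto simp: L2_def)
  obtain u where u: "u \<in> borel_measurable lborel" "AE \<xi> in lborel. Re (f \<xi>) = u \<xi>"
    using completion_ex_borel_measurable_real[of "\<lambda>\<xi>. Re (f \<xi>)" lborel] f(1) by auto
  obtain v where v: "v \<in> borel_measurable lborel" "AE \<xi> in lborel. Im (f \<xi>) = v \<xi>"
    using completion_ex_borel_measurable_real[of "\<lambda>\<xi>. Im (f \<xi>)" lborel] f(1) by auto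
  define g where "g \<xi> = Complex (u \<xi>) (v \<xi>)" for \<xi>
  have g [measurable]: "g \<in> borel_measurable borel"
    using u(1) v(1) by (simp add: borel_measurable_complex_iff g_def)
  have ae: "AE \<xi> in lborel. f \<xi> = g \<xi>"
    using u(2) v(2) by eventually_elim (simp add: g_def complex_eq_iff)
  have ae': "AE \<xi> in lebesgue. (cmod (f \<xi>))\<^sup>2 = (cmod (g \<xi>))\<^sup>2"
    using AE_completion[OF ae] by eventually_elim simp
  have g_meas: "(\<lambda>\<xi>. (cmod (g \<xi>))\<^sup>2) \<in> borel_measurable lborel" by measurable
  have f_meas: "(\<lambda>\<xi>. (cmod (f \<xi>))\<^sup>2) \<in> borel_measurable lebesgue" using f(2) by auto
  have "integrable lebesgue (\<lambda>\<xi>. (cmod (g \<xi>))\<^sup>2)"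
    using f(2) integrable_cong_AE[OF f_meas measurable_completion[OF g_meas] ae'] by simp
  then have "integrable lborel (\<lambda>\<xi>. (cmod (g \<xi>))\<^sup>2)"
    by (simp add: integrable_completion g_meas)
  moreover have "(LINT \<xi>|lebesgue. (cmod (f \<xi>))\<^sup>2) = (LINT \<xi>|lborel. (cmod (g \<xi>))\<^sup>2)"
    using integral_cong_AE[OF f_meas measurable_completion[OF g_meas] ae'] integral_completion[OF g_meas] by simp
  then have "(L2_norm f)\<^sup>2 = (LINT \<xi>|lborel. (cmod (g \<xi>))\<^sup>2)"
    by (simp add: L2_norm_def)
  ultimately show ?thesis
    using that[OF g ae] by blast
qed

text \<open>A change of \<open>f\<close> on a null set leaves the value at every single
  \<open>x\<close> unchanged, so the representatives can be substituted at all zero-sum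
  tuples.\<close>

lemma T_op_cong_AE:
  fixes f g :: "'b::euclidean_space \<Rightarrow> complex"
  assumes f: "f \<in> borel_measurable lebesgue" and [measurable]: "g \<in> borel_measurable borel"
    and ae: "AE \<xi> in lborel. f \<xi> = g \<xi>"
    and [measurable]: "(\<lambda>\<xi>. \<Phi> (x, \<xi>)) \<in> borel_measurable borel" "(\<lambda>\<xi>. \<psi> (x, \<xi>)) \<in> borel_measurable borel"
  shows "T_op \<Phi> \<psi> lam f x = (LINT \<xi>|lborel. exp (\<i> * of_real (lam * \<Phi> (x, \<xi>))) * \<psi> (x, \<xi>) * g \<xi>)"
proof -
  have m: "(\<lambda>\<xi>. exp (\<i> * of_real (lam * \<Phi> (x, \<xi>))) * \<psi> (x, \<xi>)) \<in> borel_measurable lborel"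
    and mg: "(\<lambda>\<xi>. exp (\<i> * of_real (lam * \<Phi> (x, \<xi>))) * \<psi> (x, \<xi>) * g \<xi>) \<in> borel_measurable lborel"
    by measurable
  have "T_op \<Phi> \<psi> lam f x = (LINT \<xi>|lebesgue. exp (\<i> * of_real (lam * \<Phi> (x, \<xi>))) * \<psi> (x, \<xi>) * g \<xi>)"
    unfolding T_op_def
  proof (rule integral_cong_AE)
    show "AE \<xi> in lebesgue. exp (\<i> * of_real (lam * \<Phi> (x, \<xi>))) * \<psi> (x, \<xi>) * f \<xi> =
       exp (\<i> * of_real (lam * \<Phi> (x, \<xi>))) * \<psi> (x, \<xi>) * g \<xi>"
      using AE_completion[OF ae] by eventually_elim simp
  qed (use measurable_completion[OF m] measurable_completion[OF mg] f in auto)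
  then show ?thesis
    unfolding integral_completion[OF mg] .
qed

section \<open>Reduction to a single operator on tuples\<close>

lemma bounded_vec:
  fixes S :: "('a::real_normed_vector ^ 'n::finite) set"
  assumes "\<And>j. bounded ((\<lambda>y. y $ j) ` S)"
  shows "bounded S"
proof -
  obtain B where B: "\<And>j y. y \<in> S \<Longrightarrow> norm (y $ j) \<le> B j"
    using assms unfolding bounded_iff by (metis image_eqI)
  have "norm y \<le> (\<Sum>j\<in>UNIV. B j)" if "y \<in> S" for y
  proof -
    have "norm y \<le> (\<Sum>j\<in>UNIV. norm (y $ j))"
      unfolding norm_vec_def by (intro L2_set_le_sum) auto
    also have "\<dots> \<le> (\<Sum>j\<in>UNIV. B j)"
      using that by (intro sum_mono B)
    finally show ?thesis .
  qed
  then show ?thesis unfolding bounded_iff by blast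
qed

lemma linear_zero_sum_tuple: "linear (\<lambda>y :: 'a::real_vector ^ 'm::finite. zero_sum_tuple y j)"
  by (cases j) (auto simp: linear_iff zero_sum_tuple_def sum.distrib scaleR_sum_right)

lemma dd_snd_axis_sum:
  fixes f :: "'a::euclidean_space \<times> (real ^ 'm::finite) \<Rightarrow> real"
  assumes "smooth f"
  shows "dd (0, d) f p = (\<Sum>l\<in>UNIV. d $ l * dd (0, axis l 1) f p)"
proof -
  note lin = smooth_dd_linear[OF assms, of p]
  have "d = (\<Sum>l\<in>UNIV. d $ l *\<^sub>R axis l 1)"
    using basis_expansion[of d] by (simp add: scalar_mult_eq_scaleR)
  then have "(0, d) = (\<Sum>l\<in>UNIV. d $ l *\<^sub>R (0 :: 'a, axis l 1))"
    by (simp add: prod_eq_iff fst_sum snd_sum)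
  then have "dd (0, d) f p = dd (\<Sum>l\<in>UNIV. d $ l *\<^sub>R (0, axis l 1)) f p" by simp
  also have "\<dots> = (\<Sum>l\<in>UNIV. dd (d $ l *\<^sub>R (0, axis l 1)) f p)"
    by (rule linear_sum[OF lin])
  also have "\<dots> = (\<Sum>l\<in>UNIV. d $ l * dd (0, axis l 1) f p)"
    by (intro sum.cong refl) (simp only: linear_cmul[OF lin] real_scaleR_def)
  finally show ?thesis .
qed

theorem theorem4p1:
  fixes \<Phi> :: "'m::finite option \<Rightarrow> (real ^ 'm option) \<times> (real ^ 'm) \<Rightarrow> real"
    and \<psi> :: "'m option \<Rightarrow> (real ^ 'm option) \<times> (real ^ 'm) \<Rightarrow> complex"
    and c :: real
  assumes "\<And>j. smooth (\<Phi> j)"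
    and "\<And>j. smooth (\<psi> j)"
    and "\<And>j. compact (supp (\<psi> j))"
    and "c > 0"
    and "\<And>x \<xi>. (\<And>j. (x j, \<xi> j) \<in> supp (\<psi> j)) \<Longrightarrow>
           det_cols (\<lambda>j. X_field (\<Phi> j) (x j, \<xi> j)) \<ge> c"
  shows "\<exists>C::real. \<forall>lam\<ge>1. \<forall>f :: 'm option \<Rightarrow> real ^ 'm \<Rightarrow> complex. (\<forall>j. f j \<in> L2) \<longrightarrow>
    (\<integral>\<^sup>+ y. ennreal (\<Prod>j\<in>UNIV. (cmod (T_op (\<Phi> j) (\<psi> j) lam (f j) (zero_sum_tuple y j)))\<^sup>2)
       \<partial>(lborel :: ((real ^ 'm option) ^ 'm) measure))
    \<le> ennreal (C * lam powi (- int (CARD('m option) * (CARD('m option) - 1))) *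
        (\<Prod>j\<in>UNIV. (L2_norm (f j))\<^sup>2))"
proof -
  note \<Phi> = assms(1) and \<psi> = assms(2)
  \<comment> \<open>Picks the \<open>j\<close>-th pair of position and frequency. It is linear, so
    smoothness and derivatives pass from \<open>\<Phi> j\<close> and \<open>\<psi> j\<close> to the
    combined phase and amplitude.\<close>
  define L where "L j p = (zero_sum_tuple (fst p) j, snd p $ j)"
    for j and p :: "((real ^ 'm option) ^ 'm) \<times> ((real ^ 'm) ^ 'm option)"
  have "linear (L j)" for j
    using linear_zero_sum_tuple[of j, where 'a = "real ^ 'm option"] by (auto simp: L_def linear_iff)
  then have L: "bounded_linear (L j)" for j
    by (simp add: linear_conv_bounded_linear)
  define \<Psi> where "\<Psi> p = (\<Sum>j\<in>UNIV. \<Phi> j (L j p))" for p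
  define a where "a p = (\<Prod>j\<in>UNIV. \<psi> j (L j p))" for p
  have smooth_L: "smooth h \<Longrightarrow> smooth (\<lambda>p. h (L j p))"
    for h :: "(real ^ 'm option) \<times> (real ^ 'm) \<Rightarrow> 'c::real_normed_vector" and j
    by (rule smooth_compose_linear[OF L])
  have smooth: "smooth \<Psi>" "smooth a"
    unfolding \<Psi>_def [abs_def] a_def [abs_def]
    by (rule smooth_sum, rule smooth_L, rule \<Phi>) (rule smooth_prod, rule smooth_L, rule \<psi>)
  have "closed {p. \<forall>j. L j p \<in> supp (\<psi> j)}"
  proof -
    have "closed (L j -` supp (\<psi> j))" for j
      using assms(3) linear_continuous_on[OF L] by (intro closed_vimage) (auto simp: compact_imp_closed)
    then have "closed (\<Inter>j. L j -` supp (\<psi> j))" by blast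
    then show ?thesis by (simp add: vimage_def Collect_all_eq[symmetric])
  qed
  moreover have "{p. a p \<noteq> 0} \<subseteq> {p. \<forall>j. L j p \<in> supp (\<psi> j)}"
    using closure_subset by (fastforce simp: a_def supp_def)
  ultimately have supp: "supp a \<subseteq> {p. \<forall>j. L j p \<in> supp (\<psi> j)}"
    unfolding supp_def[of a] by (rule closure_minimal[rotated])
  have "bounded (supp a)"
  proof -
    have b: "bounded (fst ` supp (\<psi> j))" "bounded (snd ` supp (\<psi> j))" for j
      by (intro bounded_fst bounded_snd compact_imp_bounded assms(3))+
    \<comment> \<open>The free positions are the slots \<open>Some k\<close>, and each is confined
      by its own amplitude.\<close>
    have "bounded (fst ` supp a)"
    proof (rule bounded_vec)
      show "bounded ((\<lambda>y. y $ k) ` fst ` supp a)" for k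
        using supp by (intro bounded_subset[OF b(1)[of "Some k"]]) (force simp: L_def zero_sum_tuple_def)
    qed
    moreover have "bounded (snd ` supp a)"
    proof (rule bounded_vec)
      show "bounded ((\<lambda>\<xi>. \<xi> $ j) ` snd ` supp a)" for j
        using supp by (intro bounded_subset[OF b(2)[of j]]) (force simp: L_def)
    qed
    ultimately have "bounded (fst ` supp a \<times> snd ` supp a)"
      by (rule bounded_Times)
    then show ?thesis by (rule bounded_subset) force
  qed
  then have compact: "compact (supp a)"
    by (simp add: compact_eq_bounded_closed supp_def)
  \<comment> \<open>The chain rule through the linear maps \<open>L j\<close> yields the pairing to
    which \<open>zero_sum_nondegenerate\<close> applies.\<close>
  have dd\<Psi>: "dd (0, d) (dd (e, 0) \<Psi>) p =
      (\<Sum>j\<in>UNIV. (\<Sum>l\<in>UNIV. d $ j $ l *\<^sub>R mixed_deriv (\<Phi> j) l (L j p)) \<bullet> zero_sum_tuple e j)" for d e p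
  proof -
    have 1: "dd (e, 0) \<Psi> = (\<lambda>p. \<Sum>j\<in>UNIV. dd (L j (e, 0)) (\<Phi> j) (L j p))"
      unfolding \<Psi>_def [abs_def]
      using dd_sum[of UNIV "\<lambda>j p. \<Phi> j (L j p)" "(e, 0)", OF smooth_L[OF \<Phi>]]
      by (simp only: dd_compose_linear[OF L \<Phi>])
    have 2: "dd (0, d) (dd (e, 0) \<Psi>) = (\<lambda>p. \<Sum>j\<in>UNIV. dd (L j (0, d)) (dd (L j (e, 0)) (\<Phi> j)) (L j p))"
      unfolding 1
      using dd_sum[of UNIV "\<lambda>j p. dd (L j (e, 0)) (\<Phi> j) (L j p)" "(0, d)", OF smooth_L[OF smooth_dd[OF \<Phi>]]]
      by (simp only: dd_compose_linear[OF L smooth_dd[OF \<Phi>]])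
    have 3: "L j (0, d) = (0, d $ j)" "L j (e, 0) = (zero_sum_tuple e j, 0)" for j
      using linear_0[OF linear_zero_sum_tuple[of j, where 'a = "real ^ 'm option"]] by (auto simp: L_def)
    have "dd (0, d $ j) (dd (u, 0) (\<Phi> j)) q = (\<Sum>l\<in>UNIV. d $ j $ l *\<^sub>R mixed_deriv (\<Phi> j) l q) \<bullet> u" for j u q
      by (subst dd_snd_axis_sum[OF smooth_dd[OF \<Phi>]])
         (cases q, simp add: inner_sum_left mixed_deriv_inner[OF \<Phi>])
    then show ?thesis
      unfolding 2 3 by simp
  qed
  have nondeg: "\<exists>e\<in>Basis. dd (0, d) (dd (e, 0) \<Psi>) p \<noteq> 0" if p: "p \<in> supp a" and "d \<noteq> 0" for p d
  proof (rule ccontr)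
    assume "\<not> ?thesis"
    then have zero: "\<And>e. e \<in> Basis \<Longrightarrow> dd (0, d) (dd (e, 0) \<Psi>) p = 0" by blast
    let ?f = "\<lambda>y. \<Sum>j\<in>UNIV. (\<Sum>l\<in>UNIV. d $ j $ l *\<^sub>R mixed_deriv (\<Phi> j) l (L j p)) \<bullet> zero_sum_tuple y j"
    have "linear ?f"
      using linear_zero_sum_tuple[where 'a = "real ^ 'm option" and 'm = 'm]
      by (auto simp: linear_iff inner_add_right sum.distrib sum_distrib_left)
    \<comment> \<open>Linearity passes from the coordinate directions to all zero-sum
      tuples.\<close>
    then have "?f = (\<lambda>y. 0)"
      using zero unfolding dd\<Psi> by (intro linear_eq_stdbasis[OF \<open>linear ?f\<close>]) (auto simp: linear_iff)
    then have "?f y = 0" for y by metis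
    \<comment> \<open>Points of \<open>supp a\<close> project into every
      \<open>supp (\<psi> j)\<close>, so the determinant is at least \<open>c\<close>.\<close>
    moreover have "det_cols (\<lambda>j. X_field (\<Phi> j) (L j p)) \<noteq> 0"
      using assms(5)[of "\<lambda>j. fst (L j p)" "\<lambda>j. snd (L j p)"] supp p \<open>c > 0\<close> by auto
    ultimately have "d $ j $ l = 0" for j l
      by (intro zero_sum_nondegenerate[where w = "\<lambda>j. X_field (\<Phi> j) (L j p)" and
            m = "\<lambda>j l. mixed_deriv (\<Phi> j) l (L j p)" and d = "\<lambda>j l. d $ j $ l"] X_field_inner) auto
    then show False using \<open>d \<noteq> 0\<close> by (simp add: vec_eq_iff)
  qed
  have "\<exists>C\<ge>0. \<forall>lam>0. \<forall>F. F \<in> borel_measurable borel \<longrightarrow> integrable lborel (\<lambda>\<xi>. (cmod (F \<xi>))\<^sup>2) \<longrightarrow>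
    (\<integral>\<^sup>+ y. ennreal ((cmod (LINT \<xi>|lborel. exp (\<i> * of_real (lam * \<Psi> (y, \<xi>))) * a (y, \<xi>) * F \<xi>))\<^sup>2) \<partial>lborel)
    \<le> ennreal (C / lam ^ DIM((real ^ 'm) ^ 'm option) * (LINT \<xi>|lborel. (cmod (F \<xi>))\<^sup>2))"
    by (rule oscillatory_integral_L2_bound[OF smooth compact]) (rule nondeg)
  then obtain C where C': "\<forall>lam>0. \<forall>F. F \<in> borel_measurable borel \<longrightarrow> integrable lborel (\<lambda>\<xi>. (cmod (F \<xi>))\<^sup>2) \<longrightarrow>
    (\<integral>\<^sup>+ y. ennreal ((cmod (LINT \<xi>|lborel. exp (\<i> * of_real (lam * \<Psi> (y, \<xi>))) * a (y, \<xi>) * F \<xi>))\<^sup>2) \<partial>lborel)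
    \<le> ennreal (C / lam ^ DIM((real ^ 'm) ^ 'm option) * (LINT \<xi>|lborel. (cmod (F \<xi>))\<^sup>2))"
    by (elim exE conjE)
  note C = C'[rule_format]
  show ?thesis
  proof (intro exI[of _ C] allI impI)
    fix lam :: real and f :: "'m option \<Rightarrow> real ^ 'm \<Rightarrow> complex"
    assume "lam \<ge> 1" and f: "\<forall>j. f j \<in> L2"
    have "\<exists>g. g \<in> borel_measurable borel \<and> (AE \<xi> in lborel. f j \<xi> = g \<xi>) \<and>
       integrable lborel (\<lambda>\<xi>. (cmod (g \<xi>))\<^sup>2) \<and> (L2_norm (f j))\<^sup>2 = (LINT \<xi>|lborel. (cmod (g \<xi>))\<^sup>2)" for j
      by (rule L2_borel_representative[OF f[rule_format, of j]]) blast
    then have "\<exists>g. \<forall>j. g j \<in> borel_measurable borel \<and> (AE \<xi> in lborel. f j \<xi> = g j \<xi>) \<and>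
       integrable lborel (\<lambda>\<xi>. (cmod (g j \<xi>))\<^sup>2) \<and> (L2_norm (f j))\<^sup>2 = (LINT \<xi>|lborel. (cmod (g j \<xi>))\<^sup>2)"
      by (intro choice allI)
    then obtain g where gs: "\<And>j. g j \<in> borel_measurable borel \<and> (AE \<xi> in lborel. f j \<xi> = g j \<xi>) \<and>
       integrable lborel (\<lambda>\<xi>. (cmod (g j \<xi>))\<^sup>2) \<and> (L2_norm (f j))\<^sup>2 = (LINT \<xi>|lborel. (cmod (g j \<xi>))\<^sup>2)"
      by blast
    then have g [measurable]: "\<And>j. g j \<in> borel_measurable borel"
      and fg: "\<And>j. AE \<xi> in lborel. f j \<xi> = g j \<xi>"
      and g_int: "\<And>j. integrable lborel (\<lambda>\<xi>. (cmod (g j \<xi>))\<^sup>2)"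
      and g_norm: "\<And>j. (L2_norm (f j))\<^sup>2 = (LINT \<xi>|lborel. (cmod (g j \<xi>))\<^sup>2)"
      by blast+
    define F where "F \<xi> = (\<Prod>j\<in>UNIV. g j (\<xi> $ j))" for \<xi>
    have [measurable]: "(\<lambda>\<xi>::(real ^ 'm) ^ 'm option. \<xi> $ j) \<in> borel_measurable borel" for j
      by (intro borel_measurable_continuous_onI continuous_intros)
    have F: "F \<in> borel_measurable borel" unfolding F_def by measurable
    have F_sq: "(cmod (F \<xi>))\<^sup>2 = (\<Prod>j\<in>UNIV. (cmod (g j (\<xi> $ j)))\<^sup>2)" for \<xi>
      by (simp add: F_def prod_norm prod_power_distrib[symmetric])
    have F_int: "integrable lborel (\<lambda>\<xi>. (cmod (F \<xi>))\<^sup>2)"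
      unfolding F_sq by (rule integrable_prod_vec[OF g_int])
    have F_norm: "(LINT \<xi>|lborel. (cmod (F \<xi>))\<^sup>2) = (\<Prod>j\<in>UNIV. (L2_norm (f j))\<^sup>2)"
      unfolding F_sq g_norm by (rule integral_prod_vec[OF g_int])
    have slice: "(\<lambda>\<xi>. h (x, \<xi>)) \<in> borel_measurable borel" if "smooth h"
      for h :: "(real ^ 'm option) \<times> (real ^ 'm) \<Rightarrow> 'c::{real_normed_vector, second_countable_topology}" and x
      by (intro borel_measurable_continuous_onI continuous_on_compose2[OF smooth_continuous_on[OF that, of UNIV]]
            continuous_intros) auto
    \<comment> \<open>Fubini for the product needs integrable factors: each is square integrable
      with bounded support in the frequency.\<close>
    have factor: "integrable lborel (\<lambda>\<xi>. exp (\<i> * of_real (lam * \<Phi> j (x, \<xi>))) * \<psi> j (x, \<xi>) * g j \<xi>)"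
      (is "integrable _ ?h") for j x
    proof -
      note [measurable] = slice[OF \<Phi>] slice[OF \<psi>]
      have zero: "\<psi> j p = 0" if "p \<notin> supp (\<psi> j)" for p
        using that closure_subset[of "{p. \<psi> j p \<noteq> 0}"] by (auto simp: supp_def)
      have "bounded (\<psi> j ` supp (\<psi> j))"
        by (intro compact_imp_bounded compact_continuous_image smooth_continuous_on \<psi> assms(3))
      then obtain B where B: "\<forall>p\<in>supp (\<psi> j). cmod (\<psi> j p) \<le> B" unfolding bounded_iff by blast
      have B': "cmod (\<psi> j p) \<le> \<bar>B\<bar>" for p
        using B zero[of p] by (cases "p \<in> supp (\<psi> j)") (auto intro: order_trans[OF _ abs_ge_self])
      show ?thesis
      proof (rule L2_bounded_support_integrable)
        show "bounded (snd ` supp (\<psi> j))"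
          by (intro bounded_snd compact_imp_bounded assms(3))
        show "?h \<xi> = 0" if "\<xi> \<notin> snd ` supp (\<psi> j)" for \<xi>
          using zero[of "(x, \<xi>)"] that by force
        show "integrable lborel (\<lambda>\<xi>. (cmod (?h \<xi>))\<^sup>2)"
        proof (rule Bochner_Integration.integrable_bound)
          show "integrable lborel (\<lambda>\<xi>. \<bar>B\<bar>\<^sup>2 * (cmod (g j \<xi>))\<^sup>2)" using g_int by simp
          show "AE \<xi> in lborel. norm ((cmod (?h \<xi>))\<^sup>2) \<le> norm (\<bar>B\<bar>\<^sup>2 * (cmod (g j \<xi>))\<^sup>2)"
          proof (intro AE_I2)
            fix \<xi>
            have "(cmod (\<psi> j (x, \<xi>)))\<^sup>2 * (cmod (g j \<xi>))\<^sup>2 \<le> \<bar>B\<bar>\<^sup>2 * (cmod (g j \<xi>))\<^sup>2"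
              by (intro mult_right_mono power_mono B') auto
            then show "norm ((cmod (?h \<xi>))\<^sup>2) \<le> norm (\<bar>B\<bar>\<^sup>2 * (cmod (g j \<xi>))\<^sup>2)"
              by (simp add: norm_mult power_mult_distrib)
          qed
        qed measurable
      qed measurable
    qed
    have T: "(\<Prod>j\<in>UNIV. T_op (\<Phi> j) (\<psi> j) lam (f j) (zero_sum_tuple y j)) =
       (LINT \<xi>|lborel. exp (\<i> * of_real (lam * \<Psi> (y, \<xi>))) * a (y, \<xi>) * F \<xi>)" for y
    proof -
      have "(\<Prod>j\<in>UNIV. T_op (\<Phi> j) (\<psi> j) lam (f j) (zero_sum_tuple y j)) =
        (\<Prod>j\<in>UNIV. LINT \<xi>|lborel. exp (\<i> * of_real (lam * \<Phi> j (zero_sum_tuple y j, \<xi>))) * \<psi> j (zero_sum_tuple y j, \<xi>) * g j \<xi>)"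
        using f by (intro prod.cong refl T_op_cong_AE g fg slice \<Phi> \<psi>) (auto simp: L2_def)
      also have "\<dots> = (LINT \<xi>|lborel. (\<Prod>j\<in>UNIV. exp (\<i> * of_real (lam * \<Phi> j (zero_sum_tuple y j, \<xi> $ j))) * \<psi> j (zero_sum_tuple y j, \<xi> $ j) * g j (\<xi> $ j)))"
        by (rule integral_prod_vec[symmetric, OF factor])
      also have "\<dots> = (LINT \<xi>|lborel. exp (\<i> * of_real (lam * \<Psi> (y, \<xi>))) * a (y, \<xi>) * F \<xi>)"
        by (intro Bochner_Integration.integral_cong refl)
           (simp add: prod.distrib \<Psi>_def a_def F_def L_def sum_distrib_left exp_sum)
      finally show ?thesis .
    qed
    have "(\<integral>\<^sup>+ y. ennreal (\<Prod>j\<in>UNIV. (cmod (T_op (\<Phi> j) (\<psi> j) lam (f j) (zero_sum_tuple y j)))\<^sup>2) \<partial>lborel) =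
      (\<integral>\<^sup>+ y. ennreal ((cmod (LINT \<xi>|lborel. exp (\<i> * of_real (lam * \<Psi> (y, \<xi>))) * a (y, \<xi>) * F \<xi>))\<^sup>2) \<partial>lborel)"
      by (simp only: T prod_norm prod_power_distrib[symmetric])
    also have "\<dots> \<le> ennreal (C / lam ^ DIM((real ^ 'm) ^ 'm option) * (LINT \<xi>|lborel. (cmod (F \<xi>))\<^sup>2))"
      using \<open>lam \<ge> 1\<close> by (intro C F F_int) auto
    \<comment> \<open>\<open>n\<close> frequencies of dimension \<open>n - 1\<close> make
      \<open>n * (n - 1)\<close> real dimensions.\<close>
    also have "C / lam ^ DIM((real ^ 'm) ^ 'm option) = C * lam powi (- int (CARD('m option) * (CARD('m option) - 1)))"
    proof -
      have "DIM((real ^ 'm) ^ 'm option) = CARD('m option) * (CARD('m option) - 1)"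
        by simp
      then show ?thesis
        by (simp only: power_int_minus power_int_of_nat divide_inverse)
    qed
    finally show "(\<integral>\<^sup>+ y. ennreal (\<Prod>j\<in>UNIV. (cmod (T_op (\<Phi> j) (\<psi> j) lam (f j) (zero_sum_tuple y j)))\<^sup>2) \<partial>lborel)
      \<le> ennreal (C * lam powi (- int (CARD('m option) * (CARD('m option) - 1))) * (\<Prod>j\<in>UNIV. (L2_norm (f j))\<^sup>2))"
      unfolding F_norm .
  qed
qed

end
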